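(* Let $N\in\mathbb N$ and let $\omega$ be an admissible radial measure on $\overline{\mathbb B_d}$. Then $\mathbb C_{\mathrm{stable}}[z]\subseteq\mathcal C_N(B^N_\omega)$. Furthermore, if $N>0$ and $\omega$ is of the form $d\omega(z)=u(r)\,2r\,dr\,d\sigma(w)$ ($z=rw$, $0\le r\le 1$, $w\in\partial\mathbb B_d$) for some $u\in L^\infty([0,1])$, then $\mathbb C_{\mathrm{stable}}[z]\subseteq\mathcal C_{N-1}(B^N_\omega)$.
   Context: $\mathbb N=\{1,2,\dots\}$, $d\in\mathbb N$, $\mathbb B_d$ is the open unit ball of $\mathbb C^d$, $\sigma$ is the normalized rotationally invariant measure on $\partial\mathbb B_d$, and $\mathrm{Hol}(\mathbb B_d)$ is the set of analytic functions on $\mathbb B_d$. $\mathbb C_{\mathrm{stable}}[z]$ is the set of $d$-variable complex polynomials with no zeros in $\mathbb B_d$. An admissible radial measure $\omega$ on $\overline{\mathbb B_d}$ is one of the form $d\omega(z)=d\mu(r)\,d\sigma(w)$, $z=rw$ (i.e. the image of $\mu\times\sigma$ under $(r,w)\mapsto rw$), where $\mu$ is a finite Borel measure on $[0,1]$ with $\mu((r,1])>0$ for all $0<r<1$. For analytic $f$ put $\|f\|^2_{L^2(\omega)}=\int_{\mathbb B_d}|f|^2d\omega+\mu(\{1\})\|f\|^2_{H^2(\partial\mathbb B_d)}$, where $\|f\|^2_{H^2(\partial\mathbb B_d)}=\sup_{0<r<1}\int_{\partial\mathbb B_d}|f(rw)|^2d\sigma(w)$ and the second term is omitted if $\mu(\{1\})=0$.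 Let $R=\sum_{j=1}^d z_j\frac{\partial}{\partial z_j}$. The radially weighted Besov space is $B^N_\omega=\{f\in\mathrm{Hol}(\mathbb B_d):\|R^Nf\|_{L^2(\omega)}<\infty\}$ with $\|f\|^2_{B^N_\omega}=\mu([0,1])|f(0)|^2+\|R^Nf\|^2_{L^2(\omega)}$ for $N\ge1$. All polynomials are multipliers of $B^N_\omega$. For a Hilbert space $\mathcal H$ of functions, $\mathrm{Mult}(\mathcal H)=\{\varphi:\varphi f\in\mathcal H\text{ for all }f\in\mathcal H\}$; for $f\in\mathcal H$, $[f]$ is the closure in $\mathcal H$ of $\{\varphi f:\varphi\in\mathrm{Mult}(\mathcal H)\}$; and for integers $n\ge0$, $\mathcal C_n(\mathcal H)=\{\varphi\in\mathrm{Mult}(\mathcal H):\varphi\ne0,\ [\varphi^n]=[\varphi^{n+1}]\}$, with $\varphi^0=1$. *)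

theory Defs
  imports "HOL-Analysis.Analysis" "HOL-Probability.Probability_Measure"
begin

section \<open>The normalized rotation invariant measure on the unit sphere\<close>

text \<open>
  The Euclidean space \<open>\<complex>\<^sup>d\<close> is \<open>complex ^ 'd\<close>, whose norm is the Euclidean one.
  The measure \<open>\<sigma>\<close> is the image of the uniform distribution on the unit ball under
  \<open>z \<mapsto> z / \<bar>z\<bar>\<close>; it is a Borel measure on the whole space.  The lemmas below show that
  it is a probability measure carried by the unit sphere and invariant under all rotations.
\<close>

definition sphere_measure :: "'a::euclidean_space measure" where
  "sphere_measure = distr (uniform_measure lborel (ball 0 1)) borel sgn"

lemma nn_integral_lborel_translate:
  fixes f :: "'a::euclidean_space \<Rightarrow> ennreal"
  assumes [measurable]: "f \<in> borel_measurable borel"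
  shows "(\<integral>\<^sup>+x. f (c + x) \<partial>lborel) = (\<integral>\<^sup>+x. f x \<partial>lborel)"
proof -
  have "(\<integral>\<^sup>+x. f x \<partial>lborel) = (\<integral>\<^sup>+x. f x \<partial>distr lborel borel ((+) c))"
    by (simp only: lborel_distr_plus)
  also have "\<dots> = (\<integral>\<^sup>+x. f (c + x) \<partial>lborel)"
    by (subst nn_integral_distr) auto
  finally show ?thesis by simp
qed

lemma lborel_distr_orthogonal:
  fixes T :: "'a::euclidean_space \<Rightarrow> 'a"
  assumes T: "orthogonal_transformation T"
  shows "distr lborel borel T = lborel"
proof (rule measure_eqI)
  show "sets (distr lborel borel T) = sets lborel" by simp
next
  fix A assume "A \<in> sets (distr lborel borel T)"
  then have A[measurable]: "A \<in> sets borel" by simp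
  have lin: "linear T" using T by (rule orthogonal_transformation_linear)
  have [measurable]: "T \<in> borel_measurable borel"
    by (intro borel_measurable_continuous_onI linear_continuous_on
        linear_conv_bounded_linear[THEN iffD1] lin)
  let ?B = "ball (0::'a) 1"
  have [measurable]: "?B \<in> sets borel" by simp
  let ?S = "inv T"
  have TS: "T (?S y) = y" for y
    using orthogonal_transformation_surj[OF T] by (simp add: surj_f_inv_f)
  have nB: "emeasure lborel ?B \<noteq> \<infinity>" "emeasure lborel ?B \<noteq> 0"
    using emeasure_lborel_ball_finite[of "0::'a" 1] content_ball_pos[of 1 "0::'a"]
    by (auto simp: emeasure_eq_ennreal_measure)
  have "emeasure (distr lborel borel T) A * emeasure lborel ?B
      = (\<integral>\<^sup>+y. (\<integral>\<^sup>+x. indicator A (T x) \<partial>lborel) * indicator ?B y \<partial>lborel)"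
  proof -
    have "emeasure (distr lborel borel T) A = (\<integral>\<^sup>+x. indicator A (T x) \<partial>lborel)"
      by (subst nn_integral_indicator[symmetric]) (simp, subst nn_integral_distr, auto)
    then show ?thesis
      by (subst nn_integral_cmult) (auto intro!: borel_measurable_indicator)
  qed
  also have "\<dots> = (\<integral>\<^sup>+y. (\<integral>\<^sup>+x. indicator A (T (?S y + x)) \<partial>lborel) * indicator ?B y \<partial>lborel)"
    by (subst nn_integral_lborel_translate[where f="\<lambda>x. indicator A (T x)"]) auto
  also have "\<dots> = (\<integral>\<^sup>+y. (\<integral>\<^sup>+x. indicator A (T x + y) * indicator ?B y \<partial>lborel) \<partial>lborel)"
    by (simp add: linear_add[OF lin] TS add.commute nn_integral_multc)
  also have "\<dots> = (\<integral>\<^sup>+x. (\<integral>\<^sup>+y. indicator A (T x + y) * indicator ?B y \<partial>lborel) \<partial>lborel)"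
    by (rule lborel_pair.Fubini') measurable
  also have "\<dots> = (\<integral>\<^sup>+x. (\<integral>\<^sup>+y. indicator A y * indicator ?B (y - T x) \<partial>lborel) \<partial>lborel)"
  proof (rule nn_integral_cong)
    fix x :: 'a
    show "(\<integral>\<^sup>+y. indicator A (T x + y) * indicator ?B y \<partial>lborel)
        = (\<integral>\<^sup>+y. indicator A y * indicator ?B (y - T x) \<partial>lborel)"
      using nn_integral_lborel_translate
        [where f="\<lambda>y. indicator A y * indicator ?B (y - T x)" and c="T x"] by simp
  qed
  also have "\<dots> = (\<integral>\<^sup>+y. (\<integral>\<^sup>+x. indicator A y * indicator ?B (y - T x) \<partial>lborel) \<partial>lborel)"
    by (rule lborel_pair.Fubini') measurable
  also have "\<dots> = (\<integral>\<^sup>+y. indicator A y * emeasure lborel ?B \<partial>lborel)"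
  proof (rule nn_integral_cong)
    fix y :: 'a
    have n: "norm (y - T x) = norm (?S y - x)" for x
    proof -
      have "y - T x = T (?S y - x)" by (simp add: linear_diff[OF lin] TS)
      then show ?thesis using orthogonal_transformation_norm[OF T] by simp
    qed
    have "(\<integral>\<^sup>+x. indicator ?B (y - T x) \<partial>lborel)
        = (\<integral>\<^sup>+x. (indicator ?B (?S y - x) :: ennreal) \<partial>lborel)"
      by (rule nn_integral_cong) (simp add: indicator_def n)
    also have "\<dots> = (\<integral>\<^sup>+x. indicator ?B (?S y - (?S y + x)) \<partial>lborel)"
      by (subst nn_integral_lborel_translate[where f="\<lambda>x. indicator ?B (?S y - x)"]) auto
    also have "\<dots> = (\<integral>\<^sup>+x. indicator ?B x \<partial>lborel)"
      by (rule nn_integral_cong) (simp add: indicator_def)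
    finally have e: "(\<integral>\<^sup>+x. indicator ?B (y - T x) \<partial>lborel) = emeasure lborel ?B" by simp
    show "(\<integral>\<^sup>+x. indicator A y * indicator ?B (y - T x) \<partial>lborel)
        = indicator A y * emeasure lborel ?B"
      by (subst nn_integral_cmult) (auto simp: e)
  qed
  also have "\<dots> = emeasure lborel A * emeasure lborel ?B"
    by (simp add: nn_integral_multc)
  finally show "emeasure (distr lborel borel T) A = emeasure lborel A"
    using nB by (simp add: ennreal_mult_cancel_left mult.commute[of _ "emeasure lborel ?B"])
qed

lemma sgn_borel_measurable: "(sgn :: 'a::euclidean_space \<Rightarrow> 'a) \<in> borel_measurable borel"
  unfolding sgn_div_norm by measurable

lemma sets_sphere_measure [simp, measurable_cong]: "sets sphere_measure = sets borel"
  by (simp add: sphere_measure_def)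

lemma emeasure_lborel_unit_ball:
  "emeasure lborel (ball (0::'a::euclidean_space) 1) \<noteq> 0"
  "emeasure lborel (ball (0::'a::euclidean_space) 1) \<noteq> \<infinity>"
  using emeasure_lborel_ball_finite[of "0::'a" 1] content_ball_pos[of 1 "0::'a"]
  by (auto simp: emeasure_eq_ennreal_measure)

lemma prob_space_sphere_measure: "prob_space (sphere_measure :: 'a::euclidean_space measure)"
  unfolding sphere_measure_def
  by (intro prob_space.prob_space_distr prob_space_uniform_measure emeasure_lborel_unit_ball)
    (simp add: sgn_borel_measurable)

lemma sphere_measure_sphere: "AE w in sphere_measure. norm (w::'a::euclidean_space) = 1"
proof -
  have "AE x in lborel. x \<noteq> (0::'a)"
    by (rule AE_lborel_singleton)
  then have "AE x in uniform_measure lborel (ball (0::'a) 1). norm (sgn x) = 1"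
    by (intro AE_uniform_measureI) (auto simp: norm_sgn)
  then show ?thesis
    unfolding sphere_measure_def
    by (subst AE_distr_iff) (auto simp: sgn_borel_measurable)
qed

lemma sphere_measure_rotation_invariant:
  fixes T :: "'a::euclidean_space \<Rightarrow> 'a"
  assumes T: "orthogonal_transformation T"
  shows "distr sphere_measure borel T = sphere_measure"
proof -
  have lin: "linear T" using T by (rule orthogonal_transformation_linear)
  have [measurable]: "T \<in> borel_measurable borel"
    by (intro borel_measurable_continuous_onI linear_continuous_on
        linear_conv_bounded_linear[THEN iffD1] lin)
  note sgn_borel_measurable[measurable]
  let ?U = "uniform_measure lborel (ball (0::'a) 1)"
  have Ts: "T (sgn x) = sgn (T x)" for x
    by (simp add: sgn_div_norm linear_scale[OF lin] orthogonal_transformation_norm[OF T])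
  have U: "distr ?U borel T = ?U"
  proof (rule measure_eqI)
    fix A assume "A \<in> sets (distr ?U borel T)"
    then have A[measurable]: "A \<in> sets borel" by simp
    have "ball 0 1 \<inter> T -` A = T -` (ball 0 1 \<inter> A)"
      by (auto simp: orthogonal_transformation_norm[OF T])
    then have "emeasure (distr ?U borel T) A
        = emeasure (distr lborel borel T) (ball 0 1 \<inter> A) / emeasure lborel (ball (0::'a) 1)"
      using measurable_sets_borel[of T borel A] A
      by (simp add: emeasure_distr del: vimage_Int)
    then show "emeasure (distr ?U borel T) A = emeasure ?U A"
      by (simp add: lborel_distr_orthogonal[OF T])
  qed simp
  have "distr sphere_measure borel T = distr ?U borel (\<lambda>x. T (sgn x))"
    unfolding sphere_measure_def by (subst distr_distr) (auto simp: comp_def)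
  also have "\<dots> = distr (distr ?U borel T) borel sgn"
    unfolding Ts by (subst distr_distr) (auto simp: comp_def)
  finally show ?thesis by (simp add: U sphere_measure_def)
qed


section \<open>Admissible radial measures\<close>

text \<open>A measure on \<open>[0,1]\<close> is one whose underlying space is the set \<open>{0..1}\<close>.\<close>

definition admissible :: "real measure \<Rightarrow> bool" where
  "admissible \<mu> \<longleftrightarrow>
     sets \<mu> = sets (restrict_space borel {0..1}) \<and> finite_measure \<mu> \<and>
     (\<forall>r. 0 < r \<and> r < 1 \<longrightarrow> emeasure \<mu> {r<..1} > 0)"

definition radial_measure :: "real measure \<Rightarrow> (complex ^ 'd::finite) measure" where
  "radial_measure \<mu> = distr (\<mu> \<Otimes>\<^sub>M sphere_measure) borel (\<lambda>(r, w). r *\<^sub>R w)"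

text \<open>
  \<open>L\<^sup>\<infinity>\<close> is a condition up to null sets, hence the bounds hold only almost everywhere.
  Nonnegativity of \<open>u\<close> is forced by \<open>u(r) 2r dr d\<sigma>\<close> being a positive measure; it is
  spelled out because \<open>ennreal\<close> truncates negative values.
\<close>

definition weight_measure :: "(real \<Rightarrow> real) \<Rightarrow> real measure" where
  "weight_measure u = density (restrict_space lborel {0..1}) (\<lambda>r. ennreal (u r * (2 * r)))"

definition bounded_weight :: "(real \<Rightarrow> real) \<Rightarrow> bool" where
  "bounded_weight u \<longleftrightarrow>
     u \<in> borel_measurable (restrict_space lborel {0..1}) \<and>
     (\<exists>C. AE r in restrict_space lborel {0..1}. 0 \<le> u r \<and> u r \<le> C)"


section \<open>Analytic functions and polynomials in several complex variables\<close>

text \<open>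
  Functions on the open unit ball are represented by arbitrary extensions to the whole space;
  every notion below depends only on their values on the ball.

  A function is analytic on the ball if it is complex differentiable at each of its points,
  i.e. real differentiable with complex linear derivative.
\<close>

definition hol_ball :: "(complex ^ 'd::finite \<Rightarrow> complex) set" where
  "hol_ball = {f. \<forall>z\<in>ball 0 1. \<exists>D. (f has_derivative D) (at z) \<and> (\<forall>c v. D (c *s v) = c * D v)}"

definition partial_deriv ::
  "'d::finite \<Rightarrow> (complex ^ 'd \<Rightarrow> complex) \<Rightarrow> complex ^ 'd \<Rightarrow> complex" where
  "partial_deriv j f z = deriv (\<lambda>t. f (z + axis j t)) 0"

definition radial_deriv :: "(complex ^ 'd::finite \<Rightarrow> complex) \<Rightarrow> complex ^ 'd \<Rightarrow> complex" where
  "radial_deriv f z = (\<Sum>j\<in>UNIV. z $ j * partial_deriv j f z)"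

definition polynomials :: "(complex ^ 'd::finite \<Rightarrow> complex) set" where
  "polynomials = {p. \<exists>(A :: ('d \<Rightarrow> nat) set) c. finite A \<and>
     p = (\<lambda>z. \<Sum>\<alpha>\<in>A. c \<alpha> * (\<Prod>j\<in>UNIV. (z $ j) ^ \<alpha> j))}"

definition stable_polynomials :: "(complex ^ 'd::finite \<Rightarrow> complex) set" where
  "stable_polynomials = {p \<in> polynomials. \<forall>z\<in>ball 0 1. p z \<noteq> 0}"


section \<open>Radially weighted Besov spaces\<close>

definition hardy_sqnorm :: "(complex ^ 'd::finite \<Rightarrow> complex) \<Rightarrow> ennreal" where
  "hardy_sqnorm f =
     (SUP r\<in>{0<..<1}. \<integral>\<^sup>+w. ennreal ((cmod (f (r *\<^sub>R w)))\<^sup>2) \<partial>sphere_measure)"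

text \<open>The boundary term vanishes if \<open>\<mu>({1}) = 0\<close>, since \<open>0 * \<infinity> = 0\<close> in \<^typ>\<open>ennreal\<close>.\<close>

definition L2_sqnorm :: "real measure \<Rightarrow> (complex ^ 'd::finite \<Rightarrow> complex) \<Rightarrow> ennreal" where
  "L2_sqnorm \<mu> f =
     (\<integral>\<^sup>+z\<in>ball 0 1. ennreal ((cmod (f z))\<^sup>2) \<partial>radial_measure \<mu>) +
     emeasure \<mu> {1} * hardy_sqnorm f"

definition besov_space :: "nat \<Rightarrow> real measure \<Rightarrow> (complex ^ 'd::finite \<Rightarrow> complex) set" where
  "besov_space N \<mu> = {f \<in> hol_ball. L2_sqnorm \<mu> ((radial_deriv ^^ N) f) < \<infinity>}"

text \<open>This is the norm of the Besov space only for \<open>N \<ge> 1\<close>.\<close>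

definition besov_norm :: "nat \<Rightarrow> real measure \<Rightarrow> (complex ^ 'd::finite \<Rightarrow> complex) \<Rightarrow> real" where
  "besov_norm N \<mu> f =
     sqrt (measure \<mu> {0..1} * (cmod (f 0))\<^sup>2 + enn2real (L2_sqnorm \<mu> ((radial_deriv ^^ N) f)))"


section \<open>Multipliers, multiplier invariant subspaces and the classes \<open>C\<^sub>n\<close>\<close>

text \<open>
  A space of functions on a set \<open>X\<close> is given by the set \<open>H\<close> of its elements and
  its norm \<open>nrm\<close>.
\<close>

definition Mult :: "('a \<Rightarrow> complex) set \<Rightarrow> ('a \<Rightarrow> complex) set" where
  "Mult H = {\<phi>. \<forall>f\<in>H. (\<lambda>x. \<phi> x * f x) \<in> H}"

definition mult_closure ::
  "('a \<Rightarrow> complex) set \<Rightarrow> (('a \<Rightarrow> complex) \<Rightarrow> real) \<Rightarrow> ('a \<Rightarrow> complex) \<Rightarrow> ('a \<Rightarrow> complex) set" where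
  "mult_closure H nrm f =
     {g \<in> H. \<forall>\<epsilon>>0. \<exists>\<phi>\<in>Mult H. nrm (\<lambda>x. \<phi> x * f x - g x) < \<epsilon>}"

definition mult_class ::
  "'a set \<Rightarrow> ('a \<Rightarrow> complex) set \<Rightarrow> (('a \<Rightarrow> complex) \<Rightarrow> real) \<Rightarrow> nat \<Rightarrow> ('a \<Rightarrow> complex) set" where
  "mult_class X H nrm n =
     {\<phi> \<in> Mult H. (\<exists>x\<in>X. \<phi> x \<noteq> 0) \<and>
        mult_closure H nrm (\<lambda>x. \<phi> x ^ n) = mult_closure H nrm (\<lambda>x. \<phi> x ^ Suc n)}"

definition besov_class :: "nat \<Rightarrow> nat \<Rightarrow> real measure \<Rightarrow> (complex ^ 'd::finite \<Rightarrow> complex) set" where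
  "besov_class n N \<mu> = mult_class (ball 0 1) (besov_space N \<mu>) (besov_norm N \<mu>) n"

end

theory Submission
  imports Defs "HOL-Complex_Analysis.Complex_Analysis"
begin

text \<open>
  Let \<open>p\<close> be stable and let \<open>m\<close> be \<open>N\<close>, or \<open>N - 1\<close> for the second claim.  Since \<open>p\<close> is a
  multiplier, \<open>[p\<^sup>m\<^sup>+\<^sup>1] \<subseteq> [p\<^sup>m]\<close>, and what has to be shown is that \<open>\<phi> p\<^sup>m\<close> lies in \<open>[p\<^sup>m\<^sup>+\<^sup>1]\<close>
  for every multiplier \<open>\<phi>\<close>.  The approximants are \<open>\<psi> h p\<^sup>m\<^sup>+\<^sup>1\<close>, where \<open>\<psi>(z) = \<phi>(s z)\<close> with
  \<open>s < 1\<close> and \<open>h\<close> is an average of functions \<open>1 / p(r z)\<close> with \<open>r < 1\<close>.  Three things make this work.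

  Coefficients.  On the complex line through \<open>w\<close> a function has the Taylor coefficients
  \<open>c\<^sub>k(w)\<close> of \<open>x \<mapsto> f(x w)\<close>, and the radial derivative multiplies \<open>c\<^sub>k\<close> by \<open>k\<close>.  Rotation invariance of
  \<open>\<sigma>\<close> and Parseval's identity on circles turn every norm in sight into a sum over \<open>k\<close>
  of a weight times \<open>\<integral> |c\<^sub>k|\<^sup>2 d\<sigma>\<close> (\<open>L2_sqnorm_eq_suminf\<close>, \<open>besov_sqnorm_eq\<close>).  Hence the dilates of a
  Besov function converge to it, the radial derivatives of order at most \<open>N\<close> are controlled by the
  one of order \<open>N\<close>, and, by Leibniz' rule, a function whose radial derivatives up to order \<open>N\<close> are
  bounded acts on the Besov space as a bounded operator (\<open>smooth_multiplier_bounded\<close>).  Dilates of analytic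
  functions, polynomials and \<open>1 / p(r z)\<close> are of this kind.

  Boundedness.  The quotients \<open>p(z)\<^sup>m\<^sup>+\<^sup>1 / p(r z)\<close> stay bounded in the Besov space as \<open>r\<close> tends to 1.
  On a line \<open>p\<close> is a constant times a product of factors \<open>1 - a x\<close> with \<open>|a| \<le> 1\<close>.  With
  \<open>u = 1 - a x\<close> and \<open>v = 1 - r a x\<close> one has \<open>r u = v - (1 - r)\<close>, so \<open>u\<^sup>M / v\<close> is a polynomial in \<open>v\<close>
  plus a constant multiple of \<open>(1 - r)\<^sup>M / v\<close>.  As \<open>|v| \<ge> 1 - r\<close>, its derivatives of order below \<open>M\<close> are
  bounded, and the one of order \<open>M\<close> is at most a constant times \<open>1 + (1 - r) / |v|\<^sup>2\<close>, whose square has a bounded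
  integral over the disc (\<open>jet_bound_linear_factor\<close>, \<open>dilated_quotient_bound\<close>).  For \<open>M = N + 1\<close> the
  derivative of order \<open>N\<close> is therefore bounded, which suffices for every measure; for \<open>M = N\<close> it
  is bounded in the mean square with respect to a bounded density.

  Averages.  As \<open>r\<close> tends to 1 the differences \<open>p(z)\<^sup>m\<^sup>+\<^sup>1 / p(r z) - p(z)\<^sup>m\<close> are bounded in norm and
  their coefficients tend to 0.  A difference with \<open>r\<close> close to 1 is almost orthogonal to a given sum of
  earlier ones, so suitable sums of \<open>n\<close> of them have squared norm \<open>O(n)\<close>, and averages tend to 0 in
  norm, as in the theorem of Banach and Saks (\<open>averages_tendsto_0_besov\<close>).
\<close>

section \<open>The Euler operator in one variable\<close>

text \<open>
  In one variable the radial derivative is the Euler operator; its powers are what the radial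
  derivatives of a function of several variables become on a complex line through the origin.
\<close>

definition euler :: "(complex \<Rightarrow> complex) \<Rightarrow> complex \<Rightarrow> complex" where
  "euler f z = z * deriv f z"

lemma euler_cong:
  assumes "open S" "\<And>z. z \<in> S \<Longrightarrow> f z = g z" "z \<in> S"
  shows "euler f z = euler g z"
proof -
  have "eventually (\<lambda>x. f x = g x) (nhds z)"
    using assms by (auto simp: eventually_nhds)
  then show ?thesis by (simp add: euler_def deriv_cong_ev)
qed

lemma euler_pow_cong:
  assumes "open S" "\<And>z. z \<in> S \<Longrightarrow> f z = g z" "z \<in> S"
  shows "(euler ^^ k) f z = (euler ^^ k) g z"
  using assms(3)
proof (induction k arbitrary: z)
  case (Suc k)
  then show ?case using euler_cong[OF assms(1), of "(euler ^^ k) f" "(euler ^^ k) g" z] by simp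
qed (use assms in auto)

lemma holomorphic_on_euler_pow:
  assumes "open S" "f holomorphic_on S"
  shows "(euler ^^ k) f holomorphic_on S"
proof (induction k)
  case (Suc k)
  then show ?case
    using assms(1) by (auto simp: euler_def[abs_def] intro!: holomorphic_intros holomorphic_deriv)
qed (use assms in auto)

lemma euler_add:
  assumes "open S" "f holomorphic_on S" "g holomorphic_on S" "z \<in> S"
  shows "euler (\<lambda>x. f x + g x) z = euler f z + euler g z"
  using assms by (auto simp: euler_def algebra_simps holomorphic_on_imp_differentiable_at)

lemma euler_mult:
  assumes "open S" "f holomorphic_on S" "g holomorphic_on S" "z \<in> S"
  shows "euler (\<lambda>x. f x * g x) z = euler f z * g z + f z * euler g z"
  using assms by (auto simp: euler_def algebra_simps holomorphic_on_imp_differentiable_at)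

lemma euler_pow_add:
  assumes S: "open S" and f: "f holomorphic_on S" and g: "g holomorphic_on S" and "z \<in> S"
  shows "(euler ^^ k) (\<lambda>x. f x + g x) z = (euler ^^ k) f z + (euler ^^ k) g z"
  using assms(4)
proof (induction k arbitrary: z)
  case (Suc k)
  have "euler ((euler ^^ k) (\<lambda>x. f x + g x)) z
      = euler (\<lambda>x. (euler ^^ k) f x + (euler ^^ k) g x) z"
    using Suc by (intro euler_cong[OF S]) auto
  also have "\<dots> = euler ((euler ^^ k) f) z + euler ((euler ^^ k) g) z"
    using Suc by (intro euler_add[OF S] holomorphic_on_euler_pow S f g)
  finally show ?case by simp
qed auto

lemma euler_pow_cmult:
  assumes S: "open S" and f: "f holomorphic_on S" and "z \<in> S"
  shows "(euler ^^ k) (\<lambda>x. c * f x) z = c * (euler ^^ k) f z"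
  using assms(3)
proof (induction k arbitrary: z)
  case (Suc k)
  have "euler ((euler ^^ k) (\<lambda>x. c * f x)) z = euler (\<lambda>x. c * (euler ^^ k) f x) z"
    using Suc by (intro euler_cong[OF S]) auto
  also have "\<dots> = euler (\<lambda>x. c) z * (euler ^^ k) f z + c * euler ((euler ^^ k) f) z"
    using Suc by (intro euler_mult[OF S] holomorphic_on_euler_pow S f holomorphic_intros)
  finally show ?case by (simp add: euler_def[of "\<lambda>x. c"])
qed auto

lemma euler_pow_mult:
  assumes S: "open S" and "f holomorphic_on S" "g holomorphic_on S" and z: "z \<in> S"
  shows "(euler ^^ k) (\<lambda>x. f x * g x) z
    = (\<Sum>i\<le>k. of_nat (k choose i) * (euler ^^ i) f z * (euler ^^ (k - i)) g z)"
  using assms(2,3)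
proof (induction k arbitrary: f g)
  case (Suc k)
  let ?u = "\<lambda>i. (euler ^^ i) f z * (euler ^^ (Suc k - i)) g z"
  have hol: "euler f holomorphic_on S" "euler g holomorphic_on S"
    using holomorphic_on_euler_pow[OF S, of _ 1] Suc.prems by auto
  have "(euler ^^ Suc k) (\<lambda>x. f x * g x) z = (euler ^^ k) (euler (\<lambda>x. f x * g x)) z"
    by (simp add: funpow_Suc_right del: funpow.simps)
  also have "\<dots> = (euler ^^ k) (\<lambda>x. euler f x * g x + f x * euler g x) z"
    by (intro euler_pow_cong[OF S _ z] euler_mult[OF S] Suc.prems)
  also have "\<dots> = (euler ^^ k) (\<lambda>x. euler f x * g x) z + (euler ^^ k) (\<lambda>x. f x * euler g x) z"
    by (intro euler_pow_add[OF S] holomorphic_intros hol Suc.prems z)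
  also have "(euler ^^ k) (\<lambda>x. euler f x * g x) z = (\<Sum>i\<le>k. of_nat (k choose i) * ?u (Suc i))"
    by (subst Suc.IH[OF hol(1) Suc.prems(2)])
      (simp add: funpow_swap1 mult.assoc)
  also have "(euler ^^ k) (\<lambda>x. f x * euler g x) z = (\<Sum>i\<le>k. of_nat (k choose i) * ?u i)"
    by (subst Suc.IH[OF Suc.prems(1) hol(2)])
      (auto intro!: sum.cong simp: funpow_swap1 mult.assoc Suc_diff_le)
  also have "(\<Sum>i\<le>k. of_nat (k choose i) * ?u i) = (\<Sum>i\<le>Suc k. of_nat (k choose i) * ?u i)"
    by simp
  also have "\<dots> = ?u 0 + (\<Sum>i\<le>k. of_nat (k choose Suc i) * ?u (Suc i))"
    by (subst sum.atMost_Suc_shift) simp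
  also have "(\<Sum>i\<le>k. of_nat (k choose i) * ?u (Suc i)) + \<dots>
      = ?u 0 + (\<Sum>i\<le>k. of_nat (Suc k choose Suc i) * ?u (Suc i))"
    by (simp add: sum.distrib algebra_simps)
  also have "\<dots> = (\<Sum>i\<le>Suc k. of_nat (Suc k choose i) * ?u i)"
    by (subst sum.atMost_Suc_shift[of "\<lambda>i. of_nat (Suc k choose i) * ?u i"]) simp
  finally show ?case by (simp only: mult.assoc)
qed auto

section \<open>Bounds for Euler derivatives of products and linear quotients\<close>

text \<open>
  The last derivative is allowed an extra factor \<open>\<Psi>\<close>.  This shape is stable under products as
  soon as \<open>M > 0\<close>: in Leibniz' rule only one factor at a time carries a derivative of order \<open>M\<close>, so
  \<open>\<Psi>\<close> never gets squared.
\<close>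

definition jet_bound :: "nat \<Rightarrow> real \<Rightarrow> real \<Rightarrow> (complex \<Rightarrow> complex) \<Rightarrow> complex \<Rightarrow> bool" where
  "jet_bound M \<Psi> B g x \<longleftrightarrow>
     (\<forall>k<M. cmod ((euler ^^ k) g x) \<le> B) \<and> cmod ((euler ^^ M) g x) \<le> B * \<Psi>"

lemma jet_bound_le:
  assumes "jet_bound M \<Psi> B g x" "\<Psi> \<ge> 1" "k \<le> M" "B \<ge> 0"
  shows "cmod ((euler ^^ k) g x) \<le> B * \<Psi>"
proof (cases "k = M")
  case False
  then have "cmod ((euler ^^ k) g x) \<le> B * 1" using assms by (auto simp: jet_bound_def)
  also have "\<dots> \<le> B * \<Psi>" using assms by (intro mult_left_mono) auto
  finally show ?thesis .
qed (use assms in \<open>auto simp: jet_bound_def\<close>)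

lemma jet_bound_mono:
  assumes "jet_bound M \<Psi> B g x" "B \<le> B'" "\<Psi> \<le> \<Psi>'" "B \<ge> 0" "\<Psi> \<ge> 0"
  shows "jet_bound M \<Psi>' B' g x"
proof -
  have "B * \<Psi> \<le> B' * \<Psi>'" using assms by (intro mult_mono) auto
  then show ?thesis using assms by (force simp: jet_bound_def)
qed

lemma jet_bound_mult:
  assumes S: "open S" and hol: "f holomorphic_on S" "g holomorphic_on S" and x: "x \<in> S"
    and f: "jet_bound M \<Psi> A f x" and g: "jet_bound M \<Psi> B g x"
    and ge: "\<Psi> \<ge> 1" "A \<ge> 0" "B \<ge> 0" and M: "M > 0"
  shows "jet_bound M \<Psi> (2 ^ M * A * B) (\<lambda>y. f y * g y) x"
proof -
  have main: "cmod ((euler ^^ k) (\<lambda>y. f y * g y) x) \<le> 2 ^ M * A * B * C"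
    if k: "k \<le> M" and C: "C \<ge> 0" and C': "\<And>i. i \<le> k \<Longrightarrow>
        cmod ((euler ^^ i) f x) * cmod ((euler ^^ (k - i)) g x) \<le> A * B * C" for k C
  proof -
    have "cmod ((euler ^^ k) (\<lambda>y. f y * g y) x) \<le>
      (\<Sum>i\<le>k. cmod (of_nat (k choose i) * (euler ^^ i) f x * (euler ^^ (k - i)) g x))"
      unfolding euler_pow_mult[OF S hol x] by (rule norm_sum)
    also have "\<dots> \<le> (\<Sum>i\<le>k. real (k choose i) * (A * B * C))"
      using C' by (intro sum_mono) (auto simp: norm_mult mult.assoc intro!: mult_left_mono)
    also have "\<dots> = real (\<Sum>i\<le>k. k choose i) * (A * B * C)"
      by (simp add: sum_distrib_right)
    also have "\<dots> = 2 ^ k * (A * B * C)"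
      by (simp only: choose_row_sum) simp
    also have "\<dots> \<le> 2 ^ M * (A * B * C)"
      using k C ge by (intro mult_right_mono power_increasing) auto
    finally show ?thesis by (simp add: mult.assoc)
  qed
  have *: "cmod ((euler ^^ i) f x) * cmod ((euler ^^ j) g x) \<le> A * B" if "i < M" "j < M" for i j
    using that f g ge by (intro mult_mono) (auto simp: jet_bound_def)
  show ?thesis
    unfolding jet_bound_def
  proof (intro conjI allI impI)
    fix k assume "k < M"
    then show "cmod ((euler ^^ k) (\<lambda>y. f y * g y) x) \<le> 2 ^ M * A * B"
      using main[of k 1] * by auto
  next
    show "cmod ((euler ^^ M) (\<lambda>y. f y * g y) x) \<le> 2 ^ M * A * B * \<Psi>"
    proof (rule main)
      fix i assume i: "i \<le> M"
      show "cmod ((euler ^^ i) f x) * cmod ((euler ^^ (M - i)) g x) \<le> A * B * \<Psi>"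
      proof (cases "i = M")
        case True
        show ?thesis
        proof -
          have "cmod ((euler ^^ M) f x) * cmod (g x) \<le> (A * \<Psi>) * B"
            using f g ge M by (intro mult_mono) (force simp: jet_bound_def)+
          then show ?thesis using True by (simp add: mult_ac)
        qed
      next
        case False
        then have "cmod ((euler ^^ i) f x) * cmod ((euler ^^ (M - i)) g x) \<le> A * (B * \<Psi>)"
          using f i ge by (intro mult_mono jet_bound_le[OF g]) (auto simp: jet_bound_def)
        then show ?thesis by (simp add: mult_ac)
      qed
    qed (use ge in auto)
  qed
qed


lemma euler_pow_const: "(euler ^^ k) (\<lambda>_. c) = (\<lambda>_. if k = 0 then c else 0)"
  by (induction k) (auto simp: euler_def[abs_def])

lemma jet_bound_const: "jet_bound M \<Psi> (cmod c) (\<lambda>_. c) x" if "\<Psi> \<ge> 1"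
  using that mult_left_mono[of 1 \<Psi> "cmod c"] by (auto simp: jet_bound_def euler_pow_const)

lemma jet_bound_add:
  assumes "open S" "f holomorphic_on S" "g holomorphic_on S" "x \<in> S"
    and "jet_bound M \<Psi> A f x" "jet_bound M \<Psi> B g x"
  shows "jet_bound M \<Psi> (A + B) (\<lambda>y. f y + g y) x"
  unfolding jet_bound_def euler_pow_add[OF assms(1-4)] distrib_right
  using assms(5,6) by (auto simp: jet_bound_def intro!: norm_triangle_le add_mono)

lemma jet_bound_cmult:
  assumes "open S" "f holomorphic_on S" "x \<in> S" "jet_bound M \<Psi> A f x"
  shows "jet_bound M \<Psi> (cmod c * A) (\<lambda>y. c * f y) x"
  unfolding jet_bound_def euler_pow_cmult[OF assms(1-3)] norm_mult mult.assoc
  using assms(4) by (auto simp: jet_bound_def intro!: mult_left_mono)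

lemma jet_bound_sum:
  assumes S: "open S" and x: "x \<in> S" and "\<Psi> \<ge> 1" and "finite I"
    and "\<And>i. i \<in> I \<Longrightarrow> f i holomorphic_on S" "\<And>i. i \<in> I \<Longrightarrow> jet_bound M \<Psi> (A i) (f i) x"
  shows "jet_bound M \<Psi> (\<Sum>i\<in>I. A i) (\<lambda>y. \<Sum>i\<in>I. f i y) x"
  using assms(4-)
proof (induction I rule: finite_induct)
  case empty
  then show ?case using jet_bound_const[OF \<open>\<Psi> \<ge> 1\<close>, of M 0 x] by simp
next
  case (insert i I)
  have "jet_bound M \<Psi> (A i + (\<Sum>i\<in>I. A i)) (\<lambda>y. f i y + (\<Sum>i\<in>I. f i y)) x"
    using insert by (intro jet_bound_add[OF S _ _ x] holomorphic_intros) auto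
  then show ?case using insert by simp
qed

lemma jet_bound_prod:
  assumes S: "open S" and x: "x \<in> S" and "\<Psi> \<ge> 1" "B \<ge> 0" "M > 0" "finite I"
    and "\<And>i. i \<in> I \<Longrightarrow> f i holomorphic_on S" "\<And>i. i \<in> I \<Longrightarrow> jet_bound M \<Psi> B (f i) x"
  shows "jet_bound M \<Psi> ((2 ^ M * B) ^ card I) (\<lambda>y. \<Prod>i\<in>I. f i y) x"
  using assms(6-)
proof (induction I rule: finite_induct)
  case empty
  then show ?case using jet_bound_const[OF \<open>\<Psi> \<ge> 1\<close>, of M 1 x] by simp
next
  case (insert i I)
  have "jet_bound M \<Psi> (2 ^ M * B * (2 ^ M * B) ^ card I) (\<lambda>y. f i y * (\<Prod>i\<in>I. f i y)) x"
    using insert assms by (intro jet_bound_mult[OF S _ _ x] holomorphic_intros) auto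
  then show ?case using insert by simp
qed

text \<open>
  With \<open>v = 1 - b x\<close> the Euler operator maps \<open>v\<^sup>-\<^sup>m\<close> to \<open>m v\<^sup>-\<^sup>m\<^sup>-\<^sup>1 - m v\<^sup>-\<^sup>m\<close>, so each
  application costs one more power of \<open>1 / |v|\<close>; the term that keeps the exponent is absorbed by \<open>|v| \<le> 2\<close>.
\<close>

lemma euler_pow_inverse_linear_bound:
  "\<exists>C\<ge>0. \<forall>b x. cmod b \<le> 1 \<longrightarrow> x \<in> ball 0 1 \<longrightarrow>
     cmod ((euler ^^ k) (\<lambda>y. 1 / (1 - b * y) ^ m) x) \<le> C / cmod (1 - b * x) ^ (m + k)"
proof (induction k arbitrary: m)
  case 0
  show ?case by (rule exI[of _ 1]) (auto simp: norm_divide norm_power)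
next
  case (Suc k)
  obtain C where C: "C \<ge> 0" "\<And>b x. cmod b \<le> 1 \<Longrightarrow> x \<in> ball 0 1 \<Longrightarrow>
     cmod ((euler ^^ k) (\<lambda>y. 1 / (1 - b * y) ^ m) x) \<le> C / cmod (1 - b * x) ^ (m + k)"
    using Suc[of m] by auto
  obtain D where D: "D \<ge> 0" "\<And>b x. cmod b \<le> 1 \<Longrightarrow> x \<in> ball 0 1 \<Longrightarrow>
     cmod ((euler ^^ k) (\<lambda>y. 1 / (1 - b * y) ^ Suc m) x) \<le> D / cmod (1 - b * x) ^ (Suc m + k)"
    using Suc[of "Suc m"] by auto
  show ?case
  proof (rule exI[of _ "real m * D + real m * (2 * C)"], intro conjI allI impI)
    show "real m * D + real m * (2 * C) \<ge> 0" using C D by simp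
    fix b x :: complex assume b: "cmod b \<le> 1" and x: "x \<in> ball 0 1"
    have lt: "cmod (b * y) < 1" if "y \<in> ball 0 1" for y
      using that b mult_mono[OF b, of "cmod y" "cmod y"] by (auto simp: norm_mult)
    have nz: "1 - b * y \<noteq> 0" if "y \<in> ball 0 1" for y
      using lt[OF that] by auto
    let ?p = "\<lambda>m y. 1 / (1 - b * y) ^ m"
    have hol: "?p m holomorphic_on ball 0 1" for m
      using nz by (intro holomorphic_intros) auto
    have e: "euler (?p m) y = of_nat m * ?p (Suc m) y + (- of_nat m) * ?p m y"
      if y: "y \<in> ball 0 1" for y
    proof -
      have n: "1 - b * y \<noteq> 0" by (rule nz[OF y])
      have "(?p m has_field_derivative
          (of_nat m * b * (1 - b * y) ^ (m - 1)) / ((1 - b * y) ^ m)\<^sup>2) (at y)"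
        using n by (auto intro!: derivative_eq_intros simp: power2_eq_square)
      then have d: "deriv (?p m) y = (of_nat m * b * (1 - b * y) ^ (m - 1)) / ((1 - b * y) ^ m)\<^sup>2"
        by (rule DERIV_imp_deriv)
      show ?thesis
      proof (cases m)
        case (Suc l)
        define q where "q = 1 - b * y"
        have q: "q \<noteq> 0" "b * y = 1 - q" using n by (auto simp: q_def)
        have "y * ((of_nat m * b * q ^ (m - 1)) / (q ^ m)\<^sup>2)
            = of_nat m * (b * y) * q ^ (m - 1) / (q ^ m)\<^sup>2" by simp
        also have "\<dots> = of_nat m * (1 / q ^ Suc m) + (- of_nat m) * (1 / q ^ m)"
          unfolding q(2) using q(1) by (simp add: Suc power2_eq_square field_simps)
        finally show ?thesis unfolding euler_def d q_def .
      qed (simp add: euler_def)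
    qed
    have "(euler ^^ Suc k) (?p m) x = (euler ^^ k) (euler (?p m)) x"
      by (simp add: funpow_Suc_right del: funpow.simps)
    also have "\<dots> = (euler ^^ k) (\<lambda>y. of_nat m * ?p (Suc m) y + (- of_nat m) * ?p m y) x"
      by (intro euler_pow_cong[OF open_ball _ x] e)
    also have "\<dots> = of_nat m * (euler ^^ k) (?p (Suc m)) x + (- of_nat m) * (euler ^^ k) (?p m) x"
      by (subst euler_pow_add[OF open_ball _ _ x], (intro holomorphic_intros hol)+,
          subst (1 2) euler_pow_cmult[OF open_ball hol x]) rule
    also have "cmod \<dots> \<le> real m * (D / cmod (1 - b * x) ^ (Suc m + k))
        + real m * (C / cmod (1 - b * x) ^ (m + k))"
      using mult_left_mono[OF D(2)[OF b x] of_nat_0_le_iff[of m]]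
        mult_left_mono[OF C(2)[OF b x] of_nat_0_le_iff[of m]]
      by (intro norm_triangle_le add_mono) (simp_all only: norm_mult norm_minus_cancel norm_of_nat)
    also have "C / cmod (1 - b * x) ^ (m + k) \<le> 2 * C / cmod (1 - b * x) ^ (Suc m + k)"
    proof -
      have "cmod (1 - b * x) \<le> 1 + cmod (b * x)"
        by (rule order_trans[OF norm_triangle_ineq4]) simp
      then have "cmod (1 - b * x) \<le> 2" using lt[OF x] by simp
      then have "C * cmod (1 - b * x) \<le> C * 2" by (intro mult_left_mono C)
      moreover have "cmod (1 - b * x) > 0" using nz[OF x] by simp
      ultimately show ?thesis by (simp add: field_simps)
    qed
    finally show "cmod ((euler ^^ Suc k) (?p m) x)
        \<le> (real m * D + real m * (2 * C)) / cmod (1 - b * x) ^ (m + Suc k)"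
      by (simp add: add_divide_distrib mult_left_mono)
  qed
qed

text \<open>
  This is the estimate that carries the theorem.  Write \<open>u = 1 - a x\<close>, \<open>v = 1 - r a x\<close> and \<open>e = 1 - r\<close>.
  Expanding \<open>u\<^sup>M = ((v - e) / r)\<^sup>M\<close> by the binomial theorem and dividing by \<open>v\<close> leaves a
  polynomial in \<open>v\<close> with bounded coefficients and a multiple of \<open>e\<^sup>M / v\<close>.  The Euler derivative of order
  \<open>k\<close> of the latter is \<open>O(e\<^sup>M / |v|\<^sup>k\<^sup>+\<^sup>1)\<close>, and \<open>e \<le> |v|\<close> makes this \<open>O(1)\<close> for \<open>k < M\<close> and
  \<open>O(e / |v|\<^sup>2)\<close> for \<open>k = M\<close>.  The powers of \<open>u\<close> in the numerator thus cancel the singularity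
  of \<open>1 / v\<close> up to one order.
\<close>

lemma jet_bound_linear_factor:
  assumes M: "M > 0"
  shows "\<exists>B\<ge>0. \<forall>r a x. 1/2 \<le> r \<longrightarrow> r < 1 \<longrightarrow> cmod a \<le> 1 \<longrightarrow> x \<in> ball 0 1 \<longrightarrow>
     jet_bound M (1 + (1 - r) / (cmod (1 - of_real r * a * x))\<^sup>2) B
       (\<lambda>y. (1 - a * y) ^ M / (1 - of_real r * a * y)) x"
proof -
  have "\<forall>k. \<exists>C\<ge>0. \<forall>b x. cmod b \<le> 1 \<longrightarrow> x \<in> ball 0 1 \<longrightarrow>
     cmod ((euler ^^ k) (\<lambda>y. 1 / (1 - b * y) ^ 1) x) \<le> C / cmod (1 - b * x) ^ (1 + k)"
    using euler_pow_inverse_linear_bound by blast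
  then obtain C where C: "\<And>k. C k \<ge> 0" "\<And>k b x. cmod b \<le> 1 \<Longrightarrow> x \<in> ball 0 1 \<Longrightarrow>
     cmod ((euler ^^ k) (\<lambda>y. 1 / (1 - b * y) ^ 1) x) \<le> C k / cmod (1 - b * x) ^ (1 + k)"
    by metis
  define D where "D = (\<Sum>k\<le>M. C k)"
  have CD: "C k \<le> D" if "k \<le> M" for k
    unfolding D_def using that C(1) by (intro member_le_sum) auto
  define B where "B = (\<Sum>i<M. 4 ^ M * (2 ^ M * 2) ^ i) + 2 ^ M * D"
  have B: "B \<ge> 0" using C(1) by (auto simp: B_def D_def intro!: add_nonneg_nonneg sum_nonneg mult_nonneg_nonneg)
  show ?thesis
  proof (rule exI[of _ B], intro conjI allI impI B)
    fix r :: real and a x :: complex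
    assume r: "1/2 \<le> r" "r < 1" and a: "cmod a \<le> 1" and x: "x \<in> ball 0 1"
    define b where "b = of_real r * a"
    define e where "e = 1 - r"
    have bn: "cmod b \<le> r"
      using r mult_left_mono[OF a, of r] by (simp add: b_def norm_mult)
    have b: "cmod b \<le> 1" using bn r by simp
    have bx: "cmod (b * y) \<le> r" if "y \<in> ball 0 1" for y
      using mult_mono[OF bn, of "cmod y" 1] that r by (simp add: norm_mult)
    have ve: "e \<le> cmod (1 - b * y)" if "y \<in> ball 0 1" for y
      using norm_triangle_ineq2[of 1 "b * y"] bx[OF that] by (simp add: e_def)
    have e: "e > 0" "e \<le> 1" using r by (auto simp: e_def)
    have nz: "1 - b * y \<noteq> 0" if "y \<in> ball 0 1" for y using ve[OF that] e by auto
    define \<Psi> where "\<Psi> = 1 + e / (cmod (1 - b * x))\<^sup>2"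
    have \<Psi>: "\<Psi> \<ge> 1" using e by (simp add: \<Psi>_def)
    let ?v = "\<lambda>y. 1 - b * y"
    \<comment> \<open>the coefficients of \<open>v\<^sup>i\<close> in the polynomial part of \<open>u\<^sup>M / v\<close>; \<open>d\<close> is that of \<open>1 / v\<close>\<close>
    define cc where "cc i = of_nat (M choose Suc i) * (- of_real e) ^ (M - Suc i) / (of_real r ^ M :: complex)"
      for i :: nat
    define d where "d = (- of_real e) ^ M / (of_real r ^ M :: complex)"
    have ri: "1 / r ^ M \<le> 2 ^ M"
      using power_mono[of "1/r" 2 M] r by (simp add: power_divide field_simps)
    have ccn: "cmod (cc i) \<le> 4 ^ M" for i
    proof -
      have "cmod (cc i) = real (M choose Suc i) * e ^ (M - Suc i) * (1 / r ^ M)"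
        using e r by (simp add: cc_def norm_mult norm_divide norm_power)
      also have "\<dots> \<le> real (2 ^ M) * 1 * 2 ^ M"
        using e r ri binomial_le_pow2[of M "Suc i"]
        by (intro mult_mono power_le_one) (auto simp del: of_nat_power of_nat_numeral)
      finally show ?thesis by (simp flip: power_mult_distrib)
    qed
    have dn: "cmod d \<le> 2 ^ M * e ^ M"
      using mult_left_mono[OF ri, of "e ^ M"] e r
      by (simp add: d_def norm_divide norm_power mult_ac)
    have eq: "(1 - a * y) ^ M / (1 - of_real r * a * y) = (\<Sum>i<M. cc i * ?v y ^ i) + d * (1 / ?v y ^ 1)"
      if y: "y \<in> ball 0 1" for y
    proof -
      have r0: "(of_real r :: complex) \<noteq> 0" using r by auto
      have u: "1 - a * y = (?v y + (- of_real e)) / of_real r"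
        using r0 by (simp add: b_def e_def field_simps)
      have "(1 - a * y) ^ M = (\<Sum>i\<le>M. of_nat (M choose i) * ?v y ^ i * (- of_real e) ^ (M - i)) / of_real r ^ M"
        unfolding u power_divide by (subst binomial_ring) rule
      also have "(\<Sum>i\<le>M. of_nat (M choose i) * ?v y ^ i * (- of_real e) ^ (M - i)) =
        (- of_real e) ^ M + (\<Sum>i<M. of_nat (M choose Suc i) * ?v y ^ Suc i * (- of_real e) ^ (M - Suc i))"
        using M by (subst atMost_Suc_eq_insert_0 lessThan_Suc_atMost[symmetric], subst sum.lessThan_Suc_shift) simp
      also have "\<dots> / of_real r ^ M = d + ?v y * (\<Sum>i<M. cc i * ?v y ^ i)"
        by (simp add: d_def cc_def add_divide_distrib sum_divide_distrib sum_distrib_left mult_ac)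
      finally show ?thesis using nz[OF y] by (simp add: b_def add_divide_distrib)
    qed
    have holv: "?v holomorphic_on ball 0 1" by (intro holomorphic_intros)
    have ev: "(euler ^^ k) ?v y = (if k = 0 then 1 - b * y else - b * y)" for k y
    proof (induction k arbitrary: y)
      case (Suc k)
      have "(euler ^^ k) ?v = (if k = 0 then ?v else (\<lambda>y. - b * y))"
        using Suc.IH by auto
      moreover have "deriv ?v y = - b" "deriv (\<lambda>y. - b * y) y = - b"
        by (auto intro!: DERIV_imp_deriv derivative_eq_intros)
      ultimately have "y * deriv ((euler ^^ k) ?v) y = - b * y" by simp
      then show ?case by (simp add: euler_def[of "(euler ^^ k) ?v"])
    qed auto
    have jv: "jet_bound M \<Psi> 2 ?v x"
    proof -
      have "cmod (1 - b * x) \<le> 1 + cmod (b * x)"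
        by (rule order_trans[OF norm_triangle_ineq4]) simp
      then have "cmod ((euler ^^ k) ?v x) \<le> 2" for k
        using bx[OF x] r by (auto simp: ev)
      moreover have "2 \<le> 2 * \<Psi>" using \<Psi> by simp
      ultimately show ?thesis unfolding jet_bound_def using order_trans by blast
    qed
    have jvi: "jet_bound M \<Psi> ((2 ^ M * 2) ^ i) (\<lambda>y. ?v y ^ i) x" for i
      using jet_bound_prod[OF open_ball x \<Psi> _ M, of 2 "{..<i}" "\<lambda>_. ?v"] jv holv by simp
    have jc0: "jet_bound M \<Psi> (cmod (cc i) * (2 ^ M * 2) ^ i) (\<lambda>y. cc i * ?v y ^ i) x" for i
      by (intro jet_bound_cmult[OF open_ball _ x] jvi holomorphic_intros)
    have jc: "jet_bound M \<Psi> (4 ^ M * (2 ^ M * 2) ^ i) (\<lambda>y. cc i * ?v y ^ i) x" for i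
      using \<Psi> ccn by (intro jet_bound_mono[OF jc0]) (auto intro!: mult_right_mono)
    have j1: "jet_bound M \<Psi> (\<Sum>i<M. 4 ^ M * (2 ^ M * 2) ^ i) (\<lambda>y. \<Sum>i<M. cc i * ?v y ^ i) x"
      by (intro jet_bound_sum[OF open_ball x \<Psi>] jc holomorphic_intros) auto
    have holi: "(\<lambda>y. 1 / ?v y ^ 1) holomorphic_on ball 0 1"
      using nz by (intro holomorphic_intros) auto
    have d0: "cmod ((euler ^^ k) (\<lambda>y. d * (1 / ?v y ^ 1)) x)
        \<le> 2 ^ M * D * (e ^ M / cmod (1 - b * x) ^ (1 + k))" if k: "k \<le> M" for k
    proof -
      have "cmod ((euler ^^ k) (\<lambda>y. d * (1 / ?v y ^ 1)) x)
          = cmod d * cmod ((euler ^^ k) (\<lambda>y. 1 / ?v y ^ 1) x)"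
        by (subst euler_pow_cmult[OF open_ball holi x]) (rule norm_mult)
      also have "\<dots> \<le> (2 ^ M * e ^ M) * (D / cmod (1 - b * x) ^ (1 + k))"
        using CD[OF k] e
        by (intro mult_mono dn order_trans[OF C(2)[OF b x]] divide_right_mono) auto
      finally show ?thesis by (simp add: mult_ac)
    qed
    have v: "cmod (1 - b * x) > 0" using nz[OF x] by simp
    have D0: "D \<ge> 0" using C(1) by (auto simp: D_def intro: sum_nonneg)
    have j2: "jet_bound M \<Psi> (2 ^ M * D) (\<lambda>y. d * (1 / ?v y ^ 1)) x"
      unfolding jet_bound_def
    proof (intro conjI allI impI)
      fix k assume k: "k < M"
      have "e ^ M \<le> e ^ (1 + k)" using e k by (intro power_decreasing) auto
      also have "\<dots> \<le> cmod (1 - b * x) ^ (1 + k)" using e ve[OF x] by (intro power_mono) auto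
      finally have "e ^ M / cmod (1 - b * x) ^ (1 + k) \<le> 1"
        using v by simp
      then have "2 ^ M * D * (e ^ M / cmod (1 - b * x) ^ (1 + k)) \<le> 2 ^ M * D * 1"
        using D0 by (intro mult_left_mono) auto
      then show "cmod ((euler ^^ k) (\<lambda>y. d * (1 / ?v y ^ 1)) x) \<le> 2 ^ M * D"
        using d0[of k] k by simp
    next
      obtain l where l: "M = Suc l" using M by (cases M) auto
      have "e ^ l \<le> cmod (1 - b * x) ^ l" using e ve[OF x] by (intro power_mono) auto
      then have "e ^ l / cmod (1 - b * x) ^ l \<le> 1" using v by simp
      then have "e / (cmod (1 - b * x))\<^sup>2 * (e ^ l / cmod (1 - b * x) ^ l) \<le> e / (cmod (1 - b * x))\<^sup>2 * 1"
        using e by (intro mult_left_mono) auto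
      then have "e ^ M / cmod (1 - b * x) ^ (1 + M) \<le> \<Psi>"
        by (simp add: l \<Psi>_def power2_eq_square mult_ac)
      then have "2 ^ M * D * (e ^ M / cmod (1 - b * x) ^ (1 + M)) \<le> 2 ^ M * D * \<Psi>"
        using D0 by (intro mult_left_mono) auto
      then show "cmod ((euler ^^ M) (\<lambda>y. d * (1 / ?v y ^ 1)) x) \<le> 2 ^ M * D * \<Psi>"
        using d0[of M] by simp
    qed
    have j3: "jet_bound M \<Psi> B (\<lambda>y. (\<Sum>i<M. cc i * ?v y ^ i) + d * (1 / ?v y ^ 1)) x"
      unfolding B_def
      by (intro jet_bound_add[OF open_ball _ _ x] j1 j2 holomorphic_intros)
        (use nz in auto)
    have "jet_bound M \<Psi> B (\<lambda>y. (1 - a * y) ^ M / (1 - of_real r * a * y)) x"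
      using j3 unfolding jet_bound_def using euler_pow_cong[OF open_ball eq x] by simp
    then show "jet_bound M (1 + (1 - r) / (cmod (1 - of_real r * a * x))\<^sup>2) B
       (\<lambda>y. (1 - a * y) ^ M / (1 - of_real r * a * y)) x"
      by (simp add: \<Psi>_def e_def b_def)
  qed
qed

section \<open>Circle means of power series\<close>

lemma integral_cis_int:
  "(LINT t:{0..1}|lborel. cis (2 * pi * of_int m * t)) = (if m = 0 then 1 else 0)"
proof (cases "m = 0")
  case True
  then show ?thesis by (simp add: set_integral_const)
next
  case False
  let ?c = "2 * pi * of_int m"
  let ?F = "\<lambda>t::real. cis (?c * t) / (\<i> * of_real ?c)"
  have "(LINT t:{0..1}|lborel. cis (?c * t)) = ?F 1 - ?F 0"
    unfolding set_lebesgue_integral_def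
  proof (rule integral_FTC_atLeastAtMost)
    fix t :: real
    have "((\<lambda>z. exp (\<i> * of_real ?c * z) / (\<i> * of_real ?c)) has_field_derivative
        exp (\<i> * of_real ?c * of_real t)) (at (of_real t))"
      using False by (auto intro!: derivative_eq_intros)
    from has_vector_derivative_real_field[OF this, of "{0..1}"]
    have "((\<lambda>t. exp (\<i> * of_real ?c * of_real t) / (\<i> * of_real ?c)) has_vector_derivative
        exp (\<i> * of_real ?c * of_real t)) (at t within {0..1})" .
    then show "(?F has_vector_derivative cis (?c * t)) (at t within {0..1})"
      by (simp add: cis_conv_exp mult.assoc)
  qed (auto intro!: continuous_intros)
  also have "\<dots> = 0"
    using cis_multiple_2pi[of "of_int m"] by (simp add: mult.commute)
  finally show ?thesis using False by simp
qed

lemma integral_norm_trig_polynomial: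
  "set_integrable lborel {0..1} (\<lambda>t. (cmod (\<Sum>k<n. a k * cis (2 * pi * real k * t)))\<^sup>2)"
  "(LINT t:{0..1}|lborel. (cmod (\<Sum>k<n. a k * cis (2 * pi * real k * t)))\<^sup>2) = (\<Sum>k<n. (cmod (a k))\<^sup>2)"
proof -
  let ?e = "\<lambda>j k t. cis (2 * pi * of_int (int j - int k) * t)"
  have eq: "of_real ((cmod (\<Sum>k<n. a k * cis (2 * pi * real k * t)))\<^sup>2) =
      (\<Sum>j<n. \<Sum>k<n. (a j * cnj (a k)) * ?e j k t)" for t
  proof -
    have "of_real ((cmod (\<Sum>k<n. a k * cis (2 * pi * real k * t)))\<^sup>2) =
       (\<Sum>j<n. a j * cis (2 * pi * real j * t)) * cnj (\<Sum>k<n. a k * cis (2 * pi * real k * t))"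
      by (rule complex_norm_square)
    also have "\<dots> = (\<Sum>j<n. \<Sum>k<n. (a j * cis (2 * pi * real j * t)) * (cnj (a k) * cis (- (2 * pi * real k * t))))"
      by (simp add: sum_product cis_cnj)
    also have "\<dots> = (\<Sum>j<n. \<Sum>k<n. (a j * cnj (a k)) * ?e j k t)"
    proof (intro sum.cong refl)
      fix j k
      have "cis (2 * pi * real j * t) * cis (- (2 * pi * real k * t)) = ?e j k t"
        by (simp add: cis_mult algebra_simps)
      then show "(a j * cis (2 * pi * real j * t)) * (cnj (a k) * cis (- (2 * pi * real k * t)))
          = (a j * cnj (a k)) * ?e j k t"
        by (simp add: mult_ac)
    qed
    finally show ?thesis .
  qed
  show int: "set_integrable lborel {0..1} (\<lambda>t. (cmod (\<Sum>k<n. a k * cis (2 * pi * real k * t)))\<^sup>2)"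
    by (intro borel_integrable_atLeastAtMost' continuous_intros)
  have inte: "set_integrable lborel {0..1} (\<lambda>t. (a j * cnj (a k)) * ?e j k t)" for j k
    by (intro borel_integrable_atLeastAtMost' continuous_intros)
  have "of_real (LINT t:{0..1}|lborel. (cmod (\<Sum>k<n. a k * cis (2 * pi * real k * t)))\<^sup>2) =
    (LINT t:{0..1}|lborel. complex_of_real ((cmod (\<Sum>k<n. a k * cis (2 * pi * real k * t)))\<^sup>2))"
    by (rule set_integral_complex_of_real[symmetric])
  also have "\<dots> = (LINT t:{0..1}|lborel. \<Sum>j<n. \<Sum>k<n. (a j * cnj (a k)) * ?e j k t)"
    by (simp only: eq)
  also have "\<dots> = (\<Sum>j<n. \<Sum>k<n. LINT t:{0..1}|lborel. (a j * cnj (a k)) * ?e j k t)"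
  proof -
    have i: "integrable lborel (\<lambda>t. indicator {0..1} t *\<^sub>R ((a j * cnj (a k)) * ?e j k t))" for j k
      using inte unfolding set_integrable_def .
    show ?thesis
      unfolding set_lebesgue_integral_def scaleR_sum_right
      by (subst Bochner_Integration.integral_sum, intro Bochner_Integration.integrable_sum i,
          intro sum.cong refl, subst Bochner_Integration.integral_sum, rule i, rule refl)
  qed
  also have "\<dots> = (\<Sum>j<n. \<Sum>k<n. (a j * cnj (a k)) * (if j = k then 1 else 0))"
    by (intro sum.cong refl, subst set_integral_mult_right, subst integral_cis_int) auto
  also have "\<dots> = (\<Sum>j<n. a j * cnj (a j))"
    by (simp add: if_distrib cong: if_cong)
  also have "\<dots> = of_real (\<Sum>k<n. (cmod (a k))\<^sup>2)"
    by (simp add: complex_norm_square del: of_real_power)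
  finally show "(LINT t:{0..1}|lborel. (cmod (\<Sum>k<n. a k * cis (2 * pi * real k * t)))\<^sup>2)
      = (\<Sum>k<n. (cmod (a k))\<^sup>2)"
    by (simp only: of_real_eq_iff)
qed

text \<open>
  Partial sums are trigonometric polynomials, for which orthogonality gives the identity; on a circle
  inside the disc of convergence they converge boundedly, so the identity passes to the limit.
\<close>

lemma parseval_power_series:
  assumes F: "\<And>x. x \<in> ball 0 1 \<Longrightarrow> (\<lambda>k. c k * x ^ k) sums F x" and \<rho>: "0 \<le> \<rho>" "\<rho> < 1"
  shows "(\<integral>\<^sup>+t\<in>{0..1}. ennreal ((cmod (F (of_real \<rho> * cis (2 * pi * t))))\<^sup>2) \<partial>lborel)
    = (\<Sum>k. ennreal ((cmod (c k))\<^sup>2 * \<rho> ^ (2 * k)))"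
proof -
  define a where "a k = c k * of_real \<rho> ^ k" for k
  define S where "S n t = (\<Sum>k<n. a k * cis (2 * pi * real k * t))" for n t
  let ?F = "\<lambda>t. F (of_real \<rho> * cis (2 * pi * t))"
  have pt: "of_real \<rho> * cis (2 * pi * t) \<in> ball 0 1" for t using \<rho> by (simp add: norm_mult)
  have lim: "(\<lambda>n. S n t) \<longlonglongrightarrow> ?F t" for t
  proof -
    have "a k * cis (2 * pi * real k * t) = c k * (of_real \<rho> * cis (2 * pi * t)) ^ k" for k
      by (simp add: a_def power_mult_distrib Complex.DeMoivre mult_ac)
    then show ?thesis using F[OF pt] by (simp add: S_def sums_def)
  qed
  have suma: "summable (\<lambda>k. cmod (a k))"
  proof -
    obtain r where r: "\<rho> < r" "r < 1" using dense \<rho> by blast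
    have "summable (\<lambda>k. c k * of_real r ^ k)"
      using F[of "of_real r"] r \<rho> by (auto simp: sums_iff)
    then have "summable (\<lambda>k. cmod (c k * of_real \<rho> ^ k))"
      using r \<rho> by (intro powser_insidea[of _ "of_real r"]) auto
    then show ?thesis by (simp add: a_def)
  qed
  define K where "K = (\<Sum>k. cmod (a k))"
  have bound: "cmod (S n t) \<le> K" for n t
  proof -
    have "cmod (S n t) \<le> (\<Sum>k<n. cmod (a k))"
      unfolding S_def by (rule order_trans[OF norm_sum]) (simp add: norm_mult)
    also have "\<dots> \<le> K" unfolding K_def by (intro sum_le_suminf suma) auto
    finally show ?thesis .
  qed
  have m1: "(\<lambda>t. S n t) \<in> borel_measurable lborel" for n
  proof -
    have "continuous_on UNIV (\<lambda>t. S n t)" unfolding S_def by (intro continuous_intros)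
    then show ?thesis by (simp add: borel_measurable_continuous_onI)
  qed
  have m2: "?F \<in> borel_measurable lborel"
    by (rule borel_measurable_LIMSEQ_metric[OF m1 lim])
  have conv: "integrable lborel (\<lambda>t. indicator {0..1} t *\<^sub>R (cmod (?F t))\<^sup>2)"
    "(\<lambda>n. LINT t|lborel. indicator {0..1} t *\<^sub>R (cmod (S n t))\<^sup>2)
      \<longlonglongrightarrow> (LINT t|lborel. indicator {0..1} t *\<^sub>R (cmod (?F t))\<^sup>2)"
  proof -
    let ?w = "\<lambda>t::real. indicator {0..1} t *\<^sub>R K\<^sup>2"
    have w: "integrable lborel ?w"
      using borel_integrable_atLeastAtMost'[of 0 1 "\<lambda>_. K\<^sup>2"] by (auto simp: set_integrable_def)
    have ms: "(\<lambda>t. indicator {0..1} t *\<^sub>R (cmod (S n t))\<^sup>2) \<in> borel_measurable lborel" for n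
      using m1[of n] by measurable
    have mf: "(\<lambda>t. indicator {0..1} t *\<^sub>R (cmod (?F t))\<^sup>2) \<in> borel_measurable lborel"
      using m2 by measurable
    have l: "AE t in lborel. (\<lambda>n. indicator {0..1} t *\<^sub>R (cmod (S n t))\<^sup>2) \<longlonglongrightarrow> indicator {0..1} t *\<^sub>R (cmod (?F t))\<^sup>2"
      by (intro AE_I2 tendsto_intros lim)
    have b: "AE t in lborel. norm (indicator {0..1} t *\<^sub>R (cmod (S n t))\<^sup>2) \<le> ?w t" for n
      using bound by (intro AE_I2) (auto simp: indicator_def intro!: power_mono)
    show "integrable lborel (\<lambda>t. indicator {0..1} t *\<^sub>R (cmod (?F t))\<^sup>2)"
      by (rule integrable_dominated_convergence[OF mf ms w l b])
    show "(\<lambda>n. LINT t|lborel. indicator {0..1} t *\<^sub>R (cmod (S n t))\<^sup>2)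
      \<longlonglongrightarrow> (LINT t|lborel. indicator {0..1} t *\<^sub>R (cmod (?F t))\<^sup>2)"
      by (rule integral_dominated_convergence[OF mf ms w l b])
  qed
  have "(LINT t|lborel. indicator {0..1} t *\<^sub>R (cmod (S n t))\<^sup>2) = (\<Sum>k<n. (cmod (a k))\<^sup>2)" for n
    using integral_norm_trig_polynomial(2)[of a n] by (simp add: S_def set_lebesgue_integral_def)
  with conv(2) have sums: "(\<lambda>k. (cmod (a k))\<^sup>2) sums (LINT t|lborel. indicator {0..1} t *\<^sub>R (cmod (?F t))\<^sup>2)"
    by (simp add: sums_def)
  have "(\<integral>\<^sup>+t\<in>{0..1}. ennreal ((cmod (?F t))\<^sup>2) \<partial>lborel)
      = (\<integral>\<^sup>+t. ennreal (indicator {0..1} t *\<^sub>R (cmod (?F t))\<^sup>2) \<partial>lborel)"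
    by (intro nn_integral_cong) (auto simp: indicator_def)
  also have "\<dots> = ennreal (LINT t|lborel. indicator {0..1} t *\<^sub>R (cmod (?F t))\<^sup>2)"
    by (intro nn_integral_eq_integral conv(1)) auto
  also have "\<dots> = (\<Sum>k. ennreal ((cmod (a k))\<^sup>2))"
    using sums by (intro suminf_ennreal_eq[symmetric]) auto
  also have "\<dots> = (\<Sum>k. ennreal ((cmod (c k))\<^sup>2 * \<rho> ^ (2 * k)))"
    using \<rho> by (simp add: a_def norm_mult norm_power power_mult_distrib mult.commute flip: power_mult)
  finally show ?thesis .
qed

text \<open>
  Parseval for the geometric series; up to the factor \<open>1 - |b|\<^sup>2\<close> the integrand is the Poisson kernel.
\<close>

lemma poisson_circle_mean:
  assumes b: "cmod b < 1"
  shows "(\<integral>\<^sup>+t\<in>{0..1}. ennreal (1 / (cmod (1 - b * cis (2 * pi * t)))\<^sup>2) \<partial>lborel) = ennreal (1 / (1 - (cmod b)\<^sup>2))"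
proof (cases "b = 0")
  case True
  then show ?thesis by simp
next
  case False
  define F where "F x = 1 / (1 - (b / of_real (cmod b)) * x)" for x :: complex
  have sums: "(\<lambda>k. (b / of_real (cmod b)) ^ k * x ^ k) sums F x" if "x \<in> ball 0 1" for x
  proof -
    have "cmod ((b / of_real (cmod b)) * x) < 1"
      using that False by (simp add: norm_mult norm_divide)
    from geometric_sums[OF this] show ?thesis unfolding F_def power_mult_distrib[symmetric] .
  qed
  have "(\<integral>\<^sup>+t\<in>{0..1}. ennreal ((cmod (F (of_real (cmod b) * cis (2 * pi * t))))\<^sup>2) \<partial>lborel)
      = (\<Sum>k. ennreal ((cmod ((b / of_real (cmod b)) ^ k))\<^sup>2 * cmod b ^ (2 * k)))"
    by (rule parseval_power_series) (use b sums in \<open>simp_all del: mem_ball\<close>)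
  moreover have "(cmod ((b / of_real (cmod b)) ^ k))\<^sup>2 * cmod b ^ (2 * k) = ((cmod b)\<^sup>2) ^ k" for k
  proof -
    have "cmod (b / of_real (cmod b)) = 1" using False by (simp add: norm_divide)
    then show ?thesis by (simp only: norm_power power_one mult_1 power_mult)
  qed
  moreover have "(\<Sum>k. ennreal (((cmod b)\<^sup>2) ^ k)) = ennreal (1 / (1 - (cmod b)\<^sup>2))"
  proof (rule suminf_ennreal_eq)
    have "(cmod b)\<^sup>2 < 1" using b by (simp add: power_less_one_iff)
    then show "(\<lambda>k. ((cmod b)\<^sup>2) ^ k) sums (1 / (1 - (cmod b)\<^sup>2))"
      by (intro geometric_sums) simp
  qed simp
  moreover have "(cmod (F (of_real (cmod b) * cis (2 * pi * t))))\<^sup>2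
      = 1 / (cmod (1 - b * cis (2 * pi * t)))\<^sup>2" for t
  proof -
    have "b / of_real (cmod b) * (of_real (cmod b) * cis (2 * pi * t)) = b * cis (2 * pi * t)"
      using False by simp
    then show ?thesis by (simp only: F_def norm_divide norm_one power_divide power_one)
  qed
  ultimately show ?thesis by simp
qed

section \<open>Analytic functions on the ball and their slices\<close>

lemma norm_vector_scalar_mult: "norm (c *s v) = cmod c * norm (v :: complex ^ 'd)"
  by (simp add: norm_vec_def L2_set_def norm_mult power_mult_distrib real_sqrt_mult
      flip: sum_distrib_left)

lemma scaleR_eq_vector_scalar_mult: "r *\<^sub>R v = of_real r *s (v :: complex ^ 'd)"
  unfolding vec_eq_iff vector_scaleR_component vector_smult_component
  by (simp add: scaleR_conv_of_real)

lemma has_derivative_vector_scalar_mult: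
  "((\<lambda>y. y *s v) has_derivative (\<lambda>h. h *s (v :: complex ^ 'd))) F"
  by (intro bounded_linear_imp_has_derivative linear_conv_bounded_linear[THEN iffD1] linearI)
    (auto simp: vec_eq_iff algebra_simps)

definition complex_linear :: "(complex ^ 'd::finite \<Rightarrow> complex) \<Rightarrow> bool" where
  "complex_linear D \<longleftrightarrow> (\<forall>c v. D (c *s v) = c * D v)"

lemma hol_ball_iff:
  "f \<in> hol_ball \<longleftrightarrow> (\<forall>z\<in>ball 0 1. \<exists>D. (f has_derivative D) (at z) \<and> complex_linear D)"
  by (simp add: hol_ball_def complex_linear_def)

lemma hol_ballE:
  assumes "f \<in> hol_ball" "norm z < 1"
  obtains D where "(f has_derivative D) (at z)" "complex_linear D"
proof -
  have "z \<in> ball 0 1" using assms(2) by simp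
  then show ?thesis using assms(1) that unfolding hol_ball_iff by blast
qed

lemma hol_ball_continuous_on: "f \<in> hol_ball \<Longrightarrow> continuous_on (ball 0 1) f"
  unfolding hol_ball_iff
  by (intro continuous_at_imp_continuous_on ballI) (blast dest: has_derivative_continuous)

lemma hol_ball_const: "(\<lambda>_. c) \<in> hol_ball"
  by (auto simp: hol_ball_iff complex_linear_def intro!: exI[of _ "\<lambda>_. 0"])

lemma hol_ball_coord: "(\<lambda>z. z $ j) \<in> hol_ball"
  by (auto simp: hol_ball_iff complex_linear_def intro!: exI[of _ "\<lambda>h. h $ j"]
      bounded_linear_imp_has_derivative bounded_linear_vec_nth)

lemma hol_ball_add:
  assumes "f \<in> hol_ball" "g \<in> hol_ball"
  shows "(\<lambda>z. f z + g z) \<in> hol_ball"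
  unfolding hol_ball_iff
proof
  fix z :: "complex ^ 'a" assume z: "z \<in> ball 0 1"
  obtain D E where "(f has_derivative D) (at z)" "complex_linear D"
    "(g has_derivative E) (at z)" "complex_linear E"
    using assms z by (auto elim!: hol_ballE)
  then show "\<exists>D. ((\<lambda>z. f z + g z) has_derivative D) (at z) \<and> complex_linear D"
    by (intro exI[of _ "\<lambda>h. D h + E h"])
      (auto simp: complex_linear_def algebra_simps intro!: derivative_eq_intros)
qed

lemma hol_ball_mult:
  assumes "f \<in> hol_ball" "g \<in> hol_ball"
  shows "(\<lambda>z. f z * g z) \<in> hol_ball"
  unfolding hol_ball_iff
proof
  fix z :: "complex ^ 'a" assume z: "z \<in> ball 0 1"
  obtain D E where "(f has_derivative D) (at z)" "complex_linear D"
    "(g has_derivative E) (at z)" "complex_linear E"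
    using assms z by (auto elim!: hol_ballE)
  then show "\<exists>D. ((\<lambda>z. f z * g z) has_derivative D) (at z) \<and> complex_linear D"
    by (intro exI[of _ "\<lambda>h. f z * E h + D h * g z"])
      (auto simp: complex_linear_def algebra_simps intro!: derivative_eq_intros)
qed

lemma hol_ball_cmult: "f \<in> hol_ball \<Longrightarrow> (\<lambda>z. c * f z) \<in> hol_ball"
  by (intro hol_ball_mult hol_ball_const)

lemma hol_ball_diff:
  assumes "f \<in> hol_ball" "g \<in> hol_ball"
  shows "(\<lambda>z. f z - g z) \<in> hol_ball"
  using hol_ball_add[OF assms(1) hol_ball_cmult[OF assms(2), of "-1"]] by simp

lemma hol_ball_power: "f \<in> hol_ball \<Longrightarrow> (\<lambda>z. f z ^ n) \<in> hol_ball"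
  by (induction n) (auto intro!: hol_ball_const hol_ball_mult)

lemma hol_ball_sum: "(\<And>i. i \<in> I \<Longrightarrow> f i \<in> hol_ball) \<Longrightarrow> (\<lambda>z. \<Sum>i\<in>I. f i z) \<in> hol_ball"
  by (induction I rule: infinite_finite_induct) (auto intro!: hol_ball_const hol_ball_add)

lemma hol_ball_prod: "(\<And>i. i \<in> I \<Longrightarrow> f i \<in> hol_ball) \<Longrightarrow> (\<lambda>z. \<Prod>i\<in>I. f i z) \<in> hol_ball"
  by (induction I rule: infinite_finite_induct) (auto intro!: hol_ball_const hol_ball_mult)

lemma hol_ball_inverse:
  assumes "f \<in> hol_ball" "\<And>z. norm z < 1 \<Longrightarrow> f z \<noteq> 0"
  shows "(\<lambda>z. inverse (f z)) \<in> hol_ball"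
  unfolding hol_ball_iff
proof
  fix z :: "complex ^ 'a" assume z: "z \<in> ball 0 1"
  obtain D where "(f has_derivative D) (at z)" "complex_linear D"
    using assms(1) z by (auto elim!: hol_ballE)
  then show "\<exists>D. ((\<lambda>z. inverse (f z)) has_derivative D) (at z) \<and> complex_linear D"
    using assms(2)[of z] z
    by (intro exI[of _ "\<lambda>h. - (inverse (f z) * D h * inverse (f z))"])
      (auto simp: complex_linear_def intro!: has_derivative_inverse)
qed

lemma hol_ball_dilate:
  assumes "f \<in> hol_ball" "\<bar>s\<bar> \<le> 1"
  shows "(\<lambda>z. f (s *\<^sub>R z)) \<in> hol_ball"
  unfolding hol_ball_iff
proof
  fix z :: "complex ^ 'a" assume z: "z \<in> ball 0 1"
  have "norm (s *\<^sub>R z) < 1" using z assms(2) mult_right_mono[of "\<bar>s\<bar>" 1 "norm z"] by simp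
  then obtain D where D: "(f has_derivative D) (at (s *\<^sub>R z))" "complex_linear D"
    using assms(1) by (auto elim!: hol_ballE)
  have "((\<lambda>z. f (s *\<^sub>R z)) has_derivative (\<lambda>h. D (s *\<^sub>R h))) (at z)"
    by (rule has_derivative_compose[of "\<lambda>z. s *\<^sub>R z" _ z UNIV f D])
      (auto intro!: derivative_eq_intros D)
  moreover have "complex_linear (\<lambda>h. D (s *\<^sub>R h))"
    using D(2) by (auto simp: complex_linear_def scaleR_eq_vector_scalar_mult)
  ultimately show "\<exists>D. ((\<lambda>z. f (s *\<^sub>R z)) has_derivative D) (at z) \<and> complex_linear D"
    by blast
qed

lemma has_field_derivative_complex_line:
  fixes v :: "complex ^ 'd::finite"
  assumes "(f has_derivative D) (at (z + x *s v))" "complex_linear D"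
  shows "((\<lambda>y. f (z + y *s v)) has_field_derivative D v) (at x)"
proof -
  have "((\<lambda>y. f (z + y *s v)) has_derivative (\<lambda>h. D (h *s v))) (at x)"
    by (rule has_derivative_compose[of "\<lambda>y. z + y *s v" _ x UNIV f D])
      (auto intro!: derivative_eq_intros has_derivative_vector_scalar_mult assms)
  then show ?thesis
    using assms(2) unfolding has_field_derivative_def complex_linear_def
    by (simp add: mult.commute[of _ "D v"])
qed

text \<open>
  By complex linearity of the derivative, the radial derivative is the derivative at \<open>z\<close> in direction \<open>z\<close>.
\<close>

lemma radial_deriv_eq:
  assumes "(f has_derivative D) (at z)" "complex_linear D"
  shows "radial_deriv f z = D z"
proof -
  have "partial_deriv j f z = D (axis j 1)" for j
  proof -
    have "(\<lambda>t. f (z + axis j t)) = (\<lambda>t. f (z + t *s axis j 1))"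
      by (rule ext, rule arg_cong[where f = f]) (auto simp: vec_eq_iff axis_def)
    moreover have "deriv (\<lambda>t. f (z + t *s axis j 1)) 0 = D (axis j 1)"
      using assms by (intro DERIV_imp_deriv has_field_derivative_complex_line) auto
    ultimately show ?thesis by (simp add: partial_deriv_def)
  qed
  then have "radial_deriv f z = (\<Sum>j\<in>UNIV. D (z $ j *s axis j 1))"
    using assms(2) by (simp add: radial_deriv_def complex_linear_def)
  also have "\<dots> = D (\<Sum>j\<in>UNIV. z $ j *s axis j 1)"
    using has_derivative_linear[OF assms(1)] by (simp add: linear_sum)
  also have "\<dots> = D z" by (simp add: basis_expansion)
  finally show ?thesis .
qed

lemma hol_ball_slice_derivative:
  assumes "f \<in> hol_ball" "norm (x *s w) < 1"
  shows "((\<lambda>y. f (y *s w)) has_field_derivative deriv (\<lambda>y. f (y *s w)) x) (at x)"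
    and "radial_deriv f (x *s w) = euler (\<lambda>y. f (y *s w)) x"
proof -
  obtain D where D: "(f has_derivative D) (at (x *s w))" "complex_linear D"
    using assms by (auto elim!: hol_ballE)
  have d: "((\<lambda>y. f (y *s w)) has_field_derivative D w) (at x)"
    using has_field_derivative_complex_line[of f D 0 x w] D by simp
  then show "((\<lambda>y. f (y *s w)) has_field_derivative deriv (\<lambda>y. f (y *s w)) x) (at x)"
    using DERIV_imp_deriv by metis
  show "radial_deriv f (x *s w) = euler (\<lambda>y. f (y *s w)) x"
    unfolding radial_deriv_eq[OF D] euler_def DERIV_imp_deriv[OF d]
    using D(2) by (simp add: complex_linear_def)
qed

text \<open>
  The slice through \<open>w\<close> is taken on its whole natural domain instead of the unit disc.  Then a point
  \<open>z\<close> of the ball can be treated as the value of its own slice at the parameter 1, which also covers \<open>z = 0\<close>.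
\<close>

definition slice_domain :: "complex ^ 'd::finite \<Rightarrow> complex set" where
  "slice_domain w = {x. norm (x *s w) < 1}"

lemma open_slice_domain: "open (slice_domain w)"
  unfolding slice_domain_def norm_vector_scalar_mult
  by (intro open_Collect_less continuous_intros)

lemma holomorphic_on_slice:
  "f \<in> hol_ball \<Longrightarrow> (\<lambda>y. f (y *s w)) holomorphic_on slice_domain w"
  unfolding holomorphic_on_open[OF open_slice_domain]
  using hol_ball_slice_derivative(1)[of f _ w] by (auto simp: slice_domain_def)

lemma ball_subset_slice_domain: "norm w \<le> 1 \<Longrightarrow> ball 0 1 \<subseteq> slice_domain w"
  by (auto simp: slice_domain_def norm_vector_scalar_mult)
    (metis le_less_trans mult_left_le norm_ge_zero)

text \<open>
  Cauchy's inequality on the disc of radius \<open>(s' - s) / |h|\<close> in the complex line through \<open>z\<close> in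
  direction \<open>h\<close>, which stays in the ball of radius \<open>s'\<close>.
\<close>

lemma hol_ball_derivative_bound:
  assumes f: "f \<in> hol_ball" and s: "s < s'" "s' < 1"
    and B: "\<And>z. norm z \<le> s' \<Longrightarrow> cmod (f z) \<le> B"
    and z: "norm z \<le> s" and D: "(f has_derivative D) (at z)" "complex_linear D"
  shows "cmod (D h) \<le> B / (s' - s) * norm h"
proof (cases "h = 0")
  case True
  then show ?thesis using has_derivative_linear[OF D(1)] by (simp add: linear_0)
next
  case False
  define r where "r = (s' - s) / norm h"
  have r: "r > 0" using False s by (simp add: r_def)
  let ?F = "\<lambda>y. f (z + y *s h)"
  have n: "norm (z + y *s h) \<le> s'" if "cmod y \<le> r" for y
  proof -
    have "norm (z + y *s h) \<le> s + cmod y * norm h"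
      using norm_triangle_ineq[of z "y *s h"] z by (simp add: norm_vector_scalar_mult)
    also have "cmod y * norm h \<le> r * norm h" using that by (intro mult_right_mono) auto
    finally show ?thesis using False by (simp add: r_def)
  qed
  have der: "\<exists>d. (?F has_field_derivative d) (at y)" if "cmod y \<le> r" for y
  proof -
    have "norm (z + y *s h) < 1" using n[OF that] s by simp
    then obtain E where "(f has_derivative E) (at (z + y *s h))" "complex_linear E"
      using f by (auto elim!: hol_ballE)
    then show ?thesis using has_field_derivative_complex_line by blast
  qed
  have "?F holomorphic_on ball 0 r"
    using der by (auto simp: holomorphic_on_open)
  moreover have "continuous_on (cball 0 r) ?F"
    using der by (intro continuous_at_imp_continuous_on ballI) (metis DERIV_isCont mem_cball_0)
  ultimately have "cmod ((deriv ^^ 1) ?F 0) \<le> fact 1 * B / r ^ 1"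
  proof (rule Cauchy_inequality[OF _ _ r])
    show "cmod (?F y) \<le> B" if "cmod (0 - y) = r" for y
      using B[OF n[of y]] that by simp
  qed
  moreover have "deriv ?F 0 = D h"
    using D by (intro DERIV_imp_deriv has_field_derivative_complex_line) auto
  ultimately show ?thesis by (simp add: r_def)
qed

text \<open>
  Weierstrass' theorem.  By the preceding bound, uniform convergence of the functions on a larger ball
  makes their derivatives uniformly Cauchy on a smaller one.
\<close>

lemma hol_ball_uniform_limit:
  assumes f: "\<And>n. f n \<in> hol_ball"
    and lim: "\<And>s. 0 < s \<Longrightarrow> s < 1 \<Longrightarrow> uniform_limit (cball 0 s) f g sequentially"
  shows "g \<in> hol_ball"
  unfolding hol_ball_iff
proof
  fix z0 :: "complex ^ 'a" assume "z0 \<in> ball 0 1"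
  then have z0: "norm z0 < 1" by simp
  obtain s where s: "norm z0 < s" "s < 1" using dense[OF z0] by auto
  obtain s' where s': "s < s'" "s' < 1" using dense[OF s(2)] by auto
  have s0: "0 < s" using s norm_ge_zero[of z0] by linarith
  have "\<forall>n z. norm z < 1 \<longrightarrow> (\<exists>D. (f n has_derivative D) (at z) \<and> complex_linear D)"
    using f by (auto simp: hol_ball_iff)
  then obtain D where D: "\<And>n z. norm z < 1 \<Longrightarrow> (f n has_derivative D n z) (at z)"
    "\<And>n z. norm z < 1 \<Longrightarrow> complex_linear (D n z)"
    by metis
  have cauchy: "\<exists>N. \<forall>m\<ge>N. \<forall>n\<ge>N. \<forall>z\<in>ball 0 s. \<forall>h. cmod (D m z h - D n z h) \<le> e * norm h"
    if e: "e > 0" for e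
  proof -
    define e' where "e' = e * (s' - s)"
    have "e' > 0" using e s' by (simp add: e'_def)
    moreover have "uniform_limit (cball 0 s') f g sequentially" using lim s0 s' by simp
    ultimately have "\<forall>\<^sub>F n in sequentially. \<forall>z\<in>cball 0 s'. dist (f n z) (g z) < e' / 2"
      using uniform_limitD half_gt_zero by blast
    then obtain N where N: "\<And>n z. n \<ge> N \<Longrightarrow> z \<in> cball 0 s' \<Longrightarrow> dist (f n z) (g z) < e' / 2"
      unfolding eventually_sequentially by blast
    have "cmod (D m z h - D n z h) \<le> e * norm h" if mn: "m \<ge> N" "n \<ge> N" and z: "z \<in> ball 0 s" for m n z h
    proof -
      have z1: "norm z < 1" using z s by simp
      have "cmod (D m z h - D n z h) \<le> e' / (s' - s) * norm h"
      proof (rule hol_ball_derivative_bound[OF hol_ball_diff[OF f f] s'])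
        show "cmod (f m y - f n y) \<le> e'" if "norm y \<le> s'" for y
          using N[OF mn(1), of y] N[OF mn(2), of y] that
            dist_triangle_half_l[of "f m y" "g y" e' "f n y"]
          by (simp add: dist_norm norm_minus_commute)
        show "norm z \<le> s" using z by simp
        show "((\<lambda>z. f m z - f n z) has_derivative (\<lambda>h. D m z h - D n z h)) (at z)"
          by (intro has_derivative_diff D z1)
        show "complex_linear (\<lambda>h. D m z h - D n z h)"
          using D(2)[OF z1] by (simp add: complex_linear_def algebra_simps)
      qed
      then show ?thesis using s' by (simp add: e'_def)
    qed
    then show ?thesis by blast
  qed
  define E where "E z h = lim (\<lambda>n. D n z h)" for z h
  have conv: "(\<lambda>n. D n z h) \<longlonglongrightarrow> E z h" if z: "z \<in> ball 0 s" for z h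
  proof -
    have "Cauchy (\<lambda>n. D n z h)"
    proof (rule metric_CauchyI)
      fix e :: real assume e: "e > 0"
      obtain N where N: "\<And>m n. m \<ge> N \<Longrightarrow> n \<ge> N \<Longrightarrow> cmod (D m z h - D n z h) \<le> e / (norm h + 1) * norm h"
      proof -
        have "e / (norm h + 1) > 0" using e norm_ge_zero[of h] by (intro divide_pos_pos) linarith+
        from cauchy[OF this] show ?thesis using that z by blast
      qed
      have "e / (norm h + 1) * norm h < e"
      proof -
        have "norm h + 1 > 0" using norm_ge_zero[of h] by linarith
        then show ?thesis using e by (simp add: field_simps)
      qed
      then show "\<exists>M. \<forall>m\<ge>M. \<forall>n\<ge>M. dist (D m z h) (D n z h) < e"
        unfolding dist_norm by (intro exI[of _ N] allI impI le_less_trans[OF N])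
    qed
    then show ?thesis unfolding E_def using Cauchy_convergent convergent_LIMSEQ_iff by blast
  qed
  have "\<exists>G. \<forall>x\<in>ball 0 s. (\<lambda>n. f n x) \<longlonglongrightarrow> G x \<and> (G has_derivative E x) (at x within ball 0 s)"
  proof (rule has_derivative_sequence)
    show "convex (ball (0 :: complex ^ 'a) s)" by simp
    show "(f n has_derivative D n x) (at x within ball 0 s)" if "x \<in> ball 0 s" for n x
    proof -
      have "norm x < 1" using that s by simp
      then show ?thesis by (rule has_derivative_at_withinI[OF D(1)])
    qed
    show "\<forall>\<^sub>F n in sequentially. \<forall>x\<in>ball 0 s. \<forall>h. norm (D n x h - E x h) \<le> e * norm h" if e: "e > 0" for e
    proof -
      obtain N where N: "\<And>m n z h. m \<ge> N \<Longrightarrow> n \<ge> N \<Longrightarrow> z \<in> ball 0 s \<Longrightarrow> cmod (D m z h - D n z h) \<le> e * norm h"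
        using cauchy[OF e] by blast
      have "norm (D n x h - E x h) \<le> e * norm h" if "n \<ge> N" "x \<in> ball 0 s" for n x h
      proof (rule Lim_bounded)
        show "(\<lambda>m. norm (D n x h - D m x h)) \<longlonglongrightarrow> norm (D n x h - E x h)"
          by (intro tendsto_intros conv that)
        show "\<forall>m\<ge>N. norm (D n x h - D m x h) \<le> e * norm h"
          using N that by blast
      qed
      then show ?thesis unfolding eventually_sequentially by blast
    qed
    show "z0 \<in> ball 0 s" using s by simp
    have "uniform_limit (cball 0 s) f g sequentially" using lim s0 s by simp
    then show "(\<lambda>n. f n z0) \<longlonglongrightarrow> g z0"
      by (rule tendsto_uniform_limitI) (use s in auto)
  qed
  then obtain G where G: "\<And>x. x \<in> ball 0 s \<Longrightarrow> (\<lambda>n. f n x) \<longlonglongrightarrow> G x"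
    "\<And>x. x \<in> ball 0 s \<Longrightarrow> (G has_derivative E x) (at x within ball 0 s)"
    by blast
  have zs: "z0 \<in> ball 0 s" using s by simp
  have "G x = g x" if "x \<in> ball 0 s" for x
  proof -
    have "uniform_limit (cball 0 s) f g sequentially" using lim s0 s by simp
    then have "(\<lambda>n. f n x) \<longlonglongrightarrow> g x"
      by (rule tendsto_uniform_limitI) (use that in auto)
    with G(1)[OF that] show ?thesis by (rule LIMSEQ_unique)
  qed
  then have "(g has_derivative E z0) (at z0)"
    using G(2)[OF zs] zs has_derivative_transform_within_open[of G "E z0" z0 UNIV "ball 0 s" g]
    by (simp add: at_within_open[OF _ open_ball])
  moreover have "complex_linear (E z0)"
    unfolding complex_linear_def
  proof (intro allI)
    fix c h
    have "(\<lambda>n. D n z0 (c *s h)) \<longlonglongrightarrow> c * E z0 h"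
      using tendsto_mult[OF tendsto_const conv[OF zs, of h], of c] D(2)[OF z0]
      by (simp add: complex_linear_def)
    with conv[OF zs] show "E z0 (c *s h) = c * E z0 h" by (rule LIMSEQ_unique)
  qed
  ultimately show "\<exists>D. (g has_derivative D) (at z0) \<and> complex_linear D" by blast
qed


lemma hol_ball_bounded:
  assumes "f \<in> hol_ball" "s < 1"
  shows "\<exists>B. \<forall>z. norm z \<le> s \<longrightarrow> cmod (f z) \<le> B"
proof -
  have "compact (f ` cball 0 s)"
    using assms by (intro compact_continuous_image compact_cball continuous_on_subset[OF hol_ball_continuous_on]) auto
  then have "bounded (f ` cball 0 s)" by (rule compact_imp_bounded)
  then show ?thesis unfolding bounded_iff by (metis imageI mem_cball_0)
qed

text \<open>
  Analyticity is defined by the existence of one complex linear derivative, so the regularity of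
  \<open>R f\<close> needs an argument: \<open>R f\<close> is the locally uniform limit of the analytic difference quotients
  \<open>(f(z) - f((1 - t) z)) / t\<close>.  The rate comes from Taylor's formula of order 1 at the point 1 of the slice
  through \<open>z\<close>, with the second derivative estimated by Cauchy's inequality.
\<close>

lemma radial_deriv_hol_ball:
  assumes f: "f \<in> hol_ball"
  shows "radial_deriv f \<in> hol_ball"
proof -
  define t where "t n = 1 / real (n + 2)" for n
  have t: "0 < t n" "t n < 1" for n by (auto simp: t_def)
  define g where "g n z = of_real (1 / t n) * (f z - f ((1 - t n) *\<^sub>R z))" for n z
  have "uniform_limit (cball 0 s) g (radial_deriv f) sequentially" if s: "0 < s" "s < 1" for s
  proof -
    define s' where "s' = (1 + s) / 2"
    have s': "s < s'" "s' < 1" using s by (auto simp: s'_def)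
    \<comment> \<open>chosen such that \<open>(1 + 2 \<delta>) s = s'\<close>, which keeps discs of radius \<open>\<delta>\<close> around points of \<open>ball 1 \<delta>\<close> inside the slice\<close>
    define \<delta> where "\<delta> = (s' / s - 1) / 2"
    have d: "\<delta> > 0" using s s' by (simp add: \<delta>_def)
    obtain B where B: "\<And>z. norm z \<le> s' \<Longrightarrow> cmod (f z) \<le> B"
      using hol_ball_bounded[OF f s'(2)] by blast
    define K where "K = 2 * B / \<delta>\<^sup>2"
    have est: "cmod (g n z - radial_deriv f z) \<le> K * t n" if tn: "t n < \<delta>" and z: "z \<in> cball 0 s" for n z
    proof -
      let ?F = "\<lambda>y. f (y *s z)"
      have n: "norm (y *s z) \<le> s'" if "cmod (y - 1) \<le> 2 * \<delta>" for y
      proof -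
        have "cmod y \<le> 1 + 2 * \<delta>" using that norm_triangle_ineq2[of y 1] by simp
        then have "cmod y * norm z \<le> (1 + 2 * \<delta>) * s" using z d by (intro mult_mono) auto
        also have "\<dots> = s'" using s by (simp add: \<delta>_def field_simps)
        finally show ?thesis by (simp add: norm_vector_scalar_mult)
      qed
      then have sub: "{y. cmod (y - 1) \<le> 2 * \<delta>} \<subseteq> slice_domain z"
        using s' by (force simp: slice_domain_def)
      have hol: "?F holomorphic_on slice_domain z" using f by (rule holomorphic_on_slice)
      have close: "cmod (y - 1) \<le> 2 * \<delta>" if "x \<in> ball 1 \<delta>" "cmod (x - y) \<le> \<delta>" for x y
        using that norm_triangle_ineq[of "y - x" "x - 1"] by (simp add: dist_norm norm_minus_commute)
      have in_dom: "x \<in> slice_domain z" if "x \<in> ball 1 \<delta>" for x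
        using close[OF that, of x] d sub by auto
      have der2: "cmod ((deriv ^^ 2) ?F x) \<le> K" if x: "x \<in> ball 1 \<delta>" for x
      proof -
        have sub2: "cball x \<delta> \<subseteq> slice_domain z"
          using close[OF x] sub by (auto simp: dist_norm)
        have "cmod ((deriv ^^ 2) ?F x) \<le> fact 2 * B / \<delta> ^ 2"
        proof (rule Cauchy_inequality[OF _ _ d])
          show "?F holomorphic_on ball x \<delta>"
            using sub2 by (intro holomorphic_on_subset[OF hol]) auto
          show "continuous_on (cball x \<delta>) ?F"
            using sub2 by (intro holomorphic_on_imp_continuous_on holomorphic_on_subset[OF hol])
          show "cmod (?F y) \<le> B" if "cmod (x - y) = \<delta>" for y
            using close[OF x, of y] that by (intro B n) auto
        qed
        then show ?thesis by (simp add: K_def fact_2)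
      qed
      let ?y = "1 - of_real (t n) :: complex"
      have "cmod ((deriv ^^ 0) ?F ?y - (\<Sum>i\<le>1. (deriv ^^ i) ?F 1 * (?y - 1) ^ i / fact i))
          \<le> K * cmod (?y - 1) ^ Suc 1 / fact 1"
      proof (rule complex_Taylor[of "ball 1 \<delta>"])
        show "((deriv ^^ i) ?F has_field_derivative (deriv ^^ Suc i) ?F x) (at x within ball 1 \<delta>)"
          if "x \<in> ball 1 \<delta>" for i x
          using has_field_derivative_higher_deriv[OF hol open_slice_domain in_dom[OF that], of i]
          by (simp add: has_field_derivative_at_within)
        show "cmod ((deriv ^^ Suc 1) ?F x) \<le> K" if "x \<in> ball 1 \<delta>" for x
          using der2[OF that] by (simp add: numeral_2_eq_2)
        show "?y \<in> ball 1 \<delta>" using tn t[of n] by (simp add: dist_norm)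
      qed (use d in auto)
      then have e: "cmod (?F ?y - (?F 1 - deriv ?F 1 * of_real (t n))) \<le> K * (t n)\<^sup>2"
        using t[of n] by (simp add: power2_eq_square)
      have "radial_deriv f z = deriv ?F 1"
        using hol_ball_slice_derivative(2)[OF f, of 1 z] z s by (simp add: euler_def)
      moreover have "?F ?y = f ((1 - t n) *\<^sub>R z)"
        by (simp add: scaleR_eq_vector_scalar_mult)
      ultimately have eq: "g n z - radial_deriv f z = - (?F ?y - (?F 1 - deriv ?F 1 * of_real (t n))) / of_real (t n)"
        using t[of n] by (simp add: g_def field_simps)
      have "cmod (g n z - radial_deriv f z) \<le> K * (t n)\<^sup>2 / t n"
        unfolding eq norm_divide norm_minus_cancel using e t[of n] by (simp add: divide_right_mono)
      then show ?thesis using t[of n] by (simp add: power2_eq_square)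
    qed
    have tlim: "t \<longlonglongrightarrow> 0"
      unfolding t_def using LIMSEQ_ignore_initial_segment[OF lim_1_over_n, of 2] by simp
    have "\<forall>\<^sub>F n in sequentially. t n < \<delta>"
      using order_tendstoD(2)[OF tlim d] .
    then have ev: "\<forall>\<^sub>F n in sequentially. \<forall>z\<in>cball 0 s. norm (g n z - radial_deriv f z) \<le> K * t n"
      by eventually_elim (use est in blast)
    have Kt: "(\<lambda>n. K * t n) \<longlonglongrightarrow> 0" using tendsto_mult[OF tendsto_const tlim, of K] by simp
    show ?thesis
    proof (rule uniform_limitI)
      fix e :: real assume "e > 0"
      from order_tendstoD(2)[OF Kt this] ev
      show "\<forall>\<^sub>F n in sequentially. \<forall>z\<in>cball 0 s. dist (g n z) (radial_deriv f z) < e"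
        by eventually_elim (auto simp: dist_norm intro: le_less_trans)
    qed
  qed
  moreover have "g n \<in> hol_ball" for n
    unfolding g_def using t[of n]
    by (intro hol_ball_cmult hol_ball_diff f hol_ball_dilate) auto
  ultimately show ?thesis using hol_ball_uniform_limit[of g] by blast
qed

lemma radial_deriv_pow_hol_ball: "f \<in> hol_ball \<Longrightarrow> (radial_deriv ^^ k) f \<in> hol_ball"
  by (induction k) (auto intro: radial_deriv_hol_ball)

lemma radial_deriv_pow_slice:
  assumes f: "f \<in> hol_ball" and "x \<in> slice_domain w"
  shows "(radial_deriv ^^ k) f (x *s w) = (euler ^^ k) (\<lambda>y. f (y *s w)) x"
  using assms(2)
proof (induction k arbitrary: x)
  case (Suc k)
  have "(radial_deriv ^^ Suc k) f (x *s w) = euler (\<lambda>y. (radial_deriv ^^ k) f (y *s w)) x"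
  proof -
    have "norm (x *s w) < 1" using Suc.prems by (simp add: slice_domain_def)
    from hol_ball_slice_derivative(2)[OF radial_deriv_pow_hol_ball[OF f] this]
    show ?thesis by simp
  qed
  also have "\<dots> = euler ((euler ^^ k) (\<lambda>y. f (y *s w))) x"
    using Suc by (intro euler_cong[OF open_slice_domain]) auto
  finally show ?case by simp
qed simp

lemma one_in_slice_domain: "norm z < 1 \<Longrightarrow> 1 \<in> slice_domain z"
  by (simp add: slice_domain_def)

lemma radial_deriv_pow_eq_euler_pow:
  "f \<in> hol_ball \<Longrightarrow> norm z < 1 \<Longrightarrow> (radial_deriv ^^ k) f z = (euler ^^ k) (\<lambda>y. f (y *s z)) 1"
  using radial_deriv_pow_slice[of f 1 z k] one_in_slice_domain[of z] by simp

lemma radial_deriv_pow_cong: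
  assumes "f \<in> hol_ball" "g \<in> hol_ball" "\<And>z. norm z < 1 \<Longrightarrow> f z = g z" "norm z < 1"
  shows "(radial_deriv ^^ k) f z = (radial_deriv ^^ k) g z"
  unfolding radial_deriv_pow_eq_euler_pow[OF assms(1,4)] radial_deriv_pow_eq_euler_pow[OF assms(2,4)]
  using assms by (intro euler_pow_cong[OF open_slice_domain _ one_in_slice_domain])
    (auto simp: slice_domain_def)

lemma radial_deriv_pow_mult:
  assumes "f \<in> hol_ball" "g \<in> hol_ball" "norm z < 1"
  shows "(radial_deriv ^^ k) (\<lambda>z. f z * g z) z
    = (\<Sum>i\<le>k. of_nat (k choose i) * (radial_deriv ^^ i) f z * (radial_deriv ^^ (k - i)) g z)"
  unfolding radial_deriv_pow_eq_euler_pow[OF assms(1,3)] radial_deriv_pow_eq_euler_pow[OF assms(2,3)]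
    radial_deriv_pow_eq_euler_pow[OF hol_ball_mult[OF assms(1,2)] assms(3)]
  by (rule euler_pow_mult[OF open_slice_domain holomorphic_on_slice[OF assms(1)] holomorphic_on_slice[OF assms(2)] one_in_slice_domain[OF assms(3)]])

lemma radial_deriv_pow_dilate:
  assumes f: "f \<in> hol_ball" and s: "0 \<le> s" "s \<le> 1" and z: "norm z < 1"
  shows "(radial_deriv ^^ k) (\<lambda>z. f (s *\<^sub>R z)) z = (radial_deriv ^^ k) f (s *\<^sub>R z)"
  using z
proof (induction k arbitrary: z)
  case (Suc k)
  let ?g = "(radial_deriv ^^ k) f" and ?fs = "\<lambda>z. f (s *\<^sub>R z)"
  have fs: "?fs \<in> hol_ball" using s by (intro hol_ball_dilate f) auto
  have sz: "norm (s *\<^sub>R z) < 1"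
    using s Suc.prems mult_right_mono[of s 1 "norm z"] by simp
  have "(radial_deriv ^^ Suc k) ?fs z = radial_deriv (\<lambda>z. ?g (s *\<^sub>R z)) z"
  proof -
    have "\<bar>s\<bar> \<le> 1" using s by simp
    then have "(\<lambda>z. ?g (s *\<^sub>R z)) \<in> hol_ball"
      by (intro hol_ball_dilate radial_deriv_pow_hol_ball f)
    from radial_deriv_pow_cong[of "(radial_deriv ^^ k) ?fs" "\<lambda>z. ?g (s *\<^sub>R z)" z 1,
        OF radial_deriv_pow_hol_ball[OF fs] this Suc.IH Suc.prems]
    show ?thesis by simp
  qed
  also have "\<dots> = radial_deriv ?g (s *\<^sub>R z)"
  proof -
    obtain D where D: "(?g has_derivative D) (at (s *\<^sub>R z))" "complex_linear D"
      by (rule hol_ballE[OF radial_deriv_pow_hol_ball[OF f] sz])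
    have "((\<lambda>z. ?g (s *\<^sub>R z)) has_derivative (\<lambda>h. D (s *\<^sub>R h))) (at z)"
      by (rule has_derivative_compose[of "\<lambda>z. s *\<^sub>R z" _ z UNIV ?g D])
        (auto intro!: derivative_eq_intros D)
    moreover have "complex_linear (\<lambda>h. D (s *\<^sub>R h))"
      using D(2) by (auto simp: complex_linear_def scaleR_eq_vector_scalar_mult)
    ultimately show ?thesis using radial_deriv_eq D by metis
  qed
  finally show ?case by simp
qed simp

section \<open>Taylor coefficients of slices and radial norms\<close>

text \<open>
  As a function of \<open>w\<close> this is the homogeneous component of degree \<open>k\<close> of \<open>f\<close>.
\<close>

definition slice_coeff :: "(complex ^ 'd::finite \<Rightarrow> complex) \<Rightarrow> nat \<Rightarrow> complex ^ 'd \<Rightarrow> complex" where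
  "slice_coeff f k w = (deriv ^^ k) (\<lambda>y. f (y *s w)) 0 / fact k"

lemma zero_in_slice_domain: "0 \<in> slice_domain w"
  by (simp add: slice_domain_def)

lemma slice_coeff_sums:
  assumes "f \<in> hol_ball" "norm (x *s w) < 1"
  shows "(\<lambda>k. slice_coeff f k w * x ^ k) sums f (x *s w)"
proof -
  obtain r where r: "cmod x < r" "ball 0 r \<subseteq> slice_domain w"
  proof (cases "w = 0")
    case True
    then show ?thesis using that[of "cmod x + 1"] by (auto simp: slice_domain_def)
  next
    case False
    then have "norm w > 0" by simp
    then have "cmod x < 1 / norm w" "ball 0 (1 / norm w) \<subseteq> slice_domain w"
      using assms(2) by (auto simp: slice_domain_def norm_vector_scalar_mult field_simps)
    then show ?thesis by (rule that)
  qed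
  have "(\<lambda>y. f (y *s w)) holomorphic_on ball 0 r"
    using r(2) by (intro holomorphic_on_subset[OF holomorphic_on_slice[OF assms(1)]])
  from holomorphic_power_series[OF this, of x] r(1)
  show ?thesis by (simp add: slice_coeff_def)
qed

lemma slice_coeff_0: "slice_coeff f 0 w = f 0"
  by (simp add: slice_coeff_def)

lemma slice_coeff_cmult: "f \<in> hol_ball \<Longrightarrow> slice_coeff (\<lambda>z. c * f z) k w = c * slice_coeff f k w"
  unfolding slice_coeff_def
  by (subst higher_deriv_cmult[OF holomorphic_on_slice zero_in_slice_domain open_slice_domain]) auto

lemma slice_coeff_add:
  "f \<in> hol_ball \<Longrightarrow> g \<in> hol_ball \<Longrightarrow>
    slice_coeff (\<lambda>z. f z + g z) k w = slice_coeff f k w + slice_coeff g k w"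
  unfolding slice_coeff_def
  by (subst higher_deriv_add[OF holomorphic_on_slice holomorphic_on_slice open_slice_domain zero_in_slice_domain])
    (auto simp: add_divide_distrib)

lemma slice_coeff_diff:
  "f \<in> hol_ball \<Longrightarrow> g \<in> hol_ball \<Longrightarrow>
    slice_coeff (\<lambda>z. f z - g z) k w = slice_coeff f k w - slice_coeff g k w"
  using slice_coeff_add[of f "\<lambda>z. - 1 * g z" k w] slice_coeff_cmult[of g "-1" k w]
    hol_ball_cmult[of g "-1"] by simp

lemma slice_coeff_dilate:
  assumes f: "f \<in> hol_ball" and s: "0 \<le> s" "s \<le> 1"
  shows "slice_coeff (\<lambda>z. f (s *\<^sub>R z)) k w = of_real s ^ k * slice_coeff f k w"
proof -
  have sub: "of_real s * y \<in> slice_domain w" if "y \<in> slice_domain w" for y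
    using that s mult_right_mono[of s 1 "cmod y * norm w"]
    by (simp add: slice_domain_def norm_vector_scalar_mult norm_mult mult.assoc)
  have "(deriv ^^ k) (\<lambda>y. (\<lambda>x. f (x *s w)) (of_real s * y)) 0
      = of_real s ^ k * (deriv ^^ k) (\<lambda>y. f (y *s w)) (of_real s * 0)"
    by (rule higher_deriv_compose_linear[OF holomorphic_on_slice[OF f] open_slice_domain open_slice_domain zero_in_slice_domain sub])
  then show ?thesis
    by (simp add: slice_coeff_def scaleR_eq_vector_scalar_mult)
qed

lemma slice_coeff_radial_deriv:
  assumes f: "f \<in> hol_ball"
  shows "slice_coeff (radial_deriv f) k w = of_nat k * slice_coeff f k w"
proof -
  let ?F = "\<lambda>y. f (y *s w)"
  have hol: "?F holomorphic_on slice_domain w" "deriv ?F holomorphic_on slice_domain w"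
    using holomorphic_on_slice[OF f] by (auto intro: holomorphic_deriv open_slice_domain)
  have "eventually (\<lambda>y. y \<in> slice_domain w) (nhds 0)"
    using open_slice_domain zero_in_slice_domain by (rule eventually_nhds_in_open)
  then have "eventually (\<lambda>y. radial_deriv f (y *s w) = y * deriv ?F y) (nhds 0)"
    by eventually_elim (use hol_ball_slice_derivative(2)[OF f] in \<open>auto simp: slice_domain_def euler_def\<close>)
  then have "(deriv ^^ k) (\<lambda>y. radial_deriv f (y *s w)) 0 = (deriv ^^ k) (\<lambda>y. y * deriv ?F y) 0"
    by (simp add: higher_deriv_cong_ev)
  also have "\<dots> = (\<Sum>i = 0..k. of_nat (k choose i) * (deriv ^^ i) (\<lambda>y. y) 0 * (deriv ^^ (k - i)) (deriv ?F) 0)"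
    by (intro higher_deriv_mult[OF _ hol(2) open_slice_domain zero_in_slice_domain] holomorphic_intros)
  also have "\<dots> = (\<Sum>i = 0..k. if i = 1 then of_nat k * (deriv ^^ k) ?F 0 else 0)"
  proof (intro sum.cong refl)
    fix i assume i: "i \<in> {0..k}"
    show "of_nat (k choose i) * (deriv ^^ i) (\<lambda>y. y) 0 * (deriv ^^ (k - i)) (deriv ?F) 0
        = (if i = 1 then of_nat k * (deriv ^^ k) ?F 0 else 0)"
    proof (cases "i = 1")
      case True
      then obtain l where "k = Suc l" using i by (cases k) auto
      then show ?thesis using True by (simp add: funpow_swap1)
    qed (simp add: higher_deriv_ident)
  qed
  also have "\<dots> = of_nat k * (deriv ^^ k) ?F 0" by (cases k) auto
  finally show ?thesis by (simp add: slice_coeff_def)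
qed

lemma slice_coeff_radial_deriv_pow:
  "f \<in> hol_ball \<Longrightarrow> slice_coeff ((radial_deriv ^^ N) f) k w = of_nat k ^ N * slice_coeff f k w"
  by (induction N) (auto simp: slice_coeff_radial_deriv radial_deriv_pow_hol_ball)

text \<open>
  Functions on the ball are represented with arbitrary values outside of it; cutting them off there makes
  them Borel measurable on the whole space.
\<close>

definition cut_ball :: "(complex ^ 'd::finite \<Rightarrow> complex) \<Rightarrow> complex ^ 'd \<Rightarrow> complex" where
  "cut_ball f z = indicator (ball 0 1) z *\<^sub>R f z"

lemma cut_ball_eq: "norm z < 1 \<Longrightarrow> cut_ball f z = f z"
  by (simp add: cut_ball_def)

lemma cut_ball_measurable: "f \<in> hol_ball \<Longrightarrow> cut_ball f \<in> borel_measurable borel"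
  unfolding cut_ball_def[abs_def]
  by (intro borel_measurable_continuous_on_indicator hol_ball_continuous_on) auto

text \<open>
  The coefficient of order \<open>k\<close> is the limit, as \<open>y\<close> tends to 0, of the function minus the
  partial sum of order below \<open>k\<close>, divided by \<open>y\<^sup>k\<close>; along the sequence \<open>y = 1 / (n + 1)\<close> this exhibits
  it as a pointwise limit of measurable functions, by induction on \<open>k\<close>.
\<close>

lemma slice_coeff_measurable:
  assumes f: "f \<in> hol_ball"
  shows "slice_coeff f k \<in> borel_measurable borel"
proof (induction k rule: less_induct)
  case (less k)
  define x where "x n = complex_of_real (inverse (real (Suc n)))" for n
  define q where "q y w = (f (y *s w) - (\<Sum>i<k. slice_coeff f i w * y ^ i)) / y ^ k" for y w
  define q' where "q' n w = (cut_ball f (x n *s w) - (\<Sum>i<k. slice_coeff f i w * x n ^ i)) / x n ^ k" for n w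
  have x: "x \<longlonglongrightarrow> 0" "x n \<noteq> 0" for n
  proof -
    have "(\<lambda>n. of_real (inverse (real (Suc n))) :: complex) \<longlonglongrightarrow> of_real 0"
      by (intro tendsto_of_real LIMSEQ_inverse_real_of_nat)
    then show "x \<longlonglongrightarrow> 0" by (simp add: x_def[abs_def])
    show "x n \<noteq> 0" unfolding x_def by (simp del: of_nat_Suc)
  qed
  show ?case
  proof (rule borel_measurable_LIMSEQ_metric)
    show "q' n \<in> borel_measurable borel" for n
    proof -
      have "continuous_on UNIV (\<lambda>w :: complex ^ 'a. x n *s w)"
        unfolding vector_scalar_mult_def by (intro continuous_on_vec_lambda continuous_intros)
      then have [measurable]: "(\<lambda>w :: complex ^ 'a. x n *s w) \<in> borel_measurable borel"
        by (rule borel_measurable_continuous_onI)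
      note cut_ball_measurable[OF f, measurable]
      have [measurable]: "i \<in> {..<k} \<Longrightarrow> slice_coeff f i \<in> borel_measurable borel" for i
        using less by simp
      show ?thesis unfolding q'_def[abs_def] by measurable
    qed
    show "(\<lambda>n. q' n w) \<longlonglongrightarrow> slice_coeff f k w" for w
    proof -
      define s where "s = 1 / (norm w + 1)"
      have nw: "norm w + 1 > 0" using norm_ge_zero[of w] by linarith
      then have s: "s > 0" by (simp add: s_def)
      have small: "norm (y *s w) < 1" if "cmod y < s" for y
      proof -
        have "cmod y * norm w \<le> cmod y * (norm w + 1)" by (intro mult_left_mono) auto
        also have "\<dots> < 1" using that nw by (simp add: s_def field_simps)
        finally show ?thesis by (simp add: norm_vector_scalar_mult)
      qed
      have "((\<lambda>y. q y w) \<longlongrightarrow> slice_coeff f (0 + k) w) (at 0)"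
      proof (rule powser_limit_0_strong[OF s])
        fix y assume y: "y \<noteq> 0" "cmod y < s"
        have "(\<lambda>i. slice_coeff f (i + k) w * y ^ (i + k)) sums
            (f (y *s w) - (\<Sum>i<k. slice_coeff f i w * y ^ i))"
          by (rule sums_split_initial_segment[OF slice_coeff_sums[OF f small[OF y(2)]]])
        from sums_divide[OF this, of "y ^ k"]
        show "(\<lambda>i. slice_coeff f (i + k) w * y ^ i) sums q y w"
          using y(1) by (simp add: q_def power_add)
      qed
      then have "((\<lambda>n. q (x n) w) \<longlonglongrightarrow> slice_coeff f k w)"
        using x by (auto intro!: filterlim_compose[of "\<lambda>y. q y w" _ "at 0" x] simp: filterlim_at)
      moreover have "\<forall>\<^sub>F n in sequentially. q (x n) w = q' n w"
      proof -
        have "\<forall>\<^sub>F n in sequentially. cmod (x n) < s"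
          using order_tendstoD(2)[OF tendsto_norm[OF x(1)], of s] s by simp
        then show ?thesis
          by eventually_elim (simp add: q_def q'_def cut_ball_eq small)
      qed
      ultimately show ?thesis by (rule Lim_transform_eventually)
    qed
  qed
qed

lemma orthogonal_transformation_cis: "orthogonal_transformation (\<lambda>w :: complex ^ 'd::finite. cis t *s w)"
  unfolding orthogonal_transformation
  by (auto simp: norm_vector_scalar_mult vec_eq_iff algebra_simps intro!: linearI)

text \<open>
  Rotation by a complex number of modulus 1 preserves the sphere measure; averaging over these rotations
  reduces integrals over the sphere to integrals over circles in complex lines.
\<close>

lemma nn_integral_sphere_rotation_mean:
  fixes g :: "complex ^ 'd::finite \<Rightarrow> ennreal"
  assumes [measurable]: "g \<in> borel_measurable borel"
  shows "(\<integral>\<^sup>+w. g w \<partial>sphere_measure) =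
    (\<integral>\<^sup>+w. (\<integral>\<^sup>+t\<in>{0..1}. g (cis (2 * pi * t) *s w) \<partial>lborel) \<partial>sphere_measure)"
proof -
  interpret S: prob_space "sphere_measure :: (complex ^ 'd) measure" by (rule prob_space_sphere_measure)
  interpret P: pair_sigma_finite "sphere_measure :: (complex ^ 'd) measure" "lborel :: real measure" ..
  have "continuous_on UNIV (\<lambda>(w :: complex ^ 'd, t :: real). cis (2 * pi * t) *s w)"
    unfolding vector_scalar_mult_def split_def
    by (intro continuous_on_vec_lambda continuous_intros)
  then have "(\<lambda>(w :: complex ^ 'd, t :: real). cis (2 * pi * t) *s w) \<in> borel_measurable (borel \<Otimes>\<^sub>M borel)"
    by (simp add: borel_prod borel_measurable_continuous_onI)
  then have T [measurable]: "(\<lambda>x :: (complex ^ 'd) \<times> real. cis (2 * pi * snd x) *s fst x) \<in> borel_measurable (sphere_measure \<Otimes>\<^sub>M lborel)"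
    by (simp add: split_def cong: measurable_cong_sets sets_pair_measure_cong)
  have [measurable]: "(\<lambda>x. g (cis (2 * pi * snd x) *s fst x)) \<in> borel_measurable (sphere_measure \<Otimes>\<^sub>M lborel)"
    using measurable_compose[OF T assms] .
  have m: "(\<lambda>(w, t). g (cis (2 * pi * t) *s w) * indicator {0..1} t) \<in> borel_measurable (sphere_measure \<Otimes>\<^sub>M lborel)"
    unfolding split_def by measurable
  have "(\<integral>\<^sup>+w. (\<integral>\<^sup>+t\<in>{0..1}. g (cis (2 * pi * t) *s w) \<partial>lborel) \<partial>sphere_measure)
     = (\<integral>\<^sup>+t. (\<integral>\<^sup>+w. g (cis (2 * pi * t) *s w) * indicator {0..1} t \<partial>sphere_measure) \<partial>lborel)"
    by (rule P.Fubini'[symmetric, OF m])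
  also have "\<dots> = (\<integral>\<^sup>+t. (\<integral>\<^sup>+w. g w \<partial>sphere_measure) * indicator {0..1} (t :: real) \<partial>lborel)"
  proof (rule nn_integral_cong)
    fix t :: real
    have T: "orthogonal_transformation (\<lambda>w :: complex ^ 'd. cis (2 * pi * t) *s w)"
      by (rule orthogonal_transformation_cis)
    have "continuous_on UNIV (\<lambda>w :: complex ^ 'd. cis (2 * pi * t) *s w)"
      unfolding vector_scalar_mult_def by (intro continuous_on_vec_lambda continuous_intros)
    then have Tm [measurable]: "(\<lambda>w :: complex ^ 'd. cis (2 * pi * t) *s w) \<in> borel_measurable borel"
      by (rule borel_measurable_continuous_onI)
    have Tm' [measurable]: "(\<lambda>w :: complex ^ 'd. cis (2 * pi * t) *s w) \<in> measurable sphere_measure borel"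
      by (simp cong: measurable_cong_sets)
    have "(\<integral>\<^sup>+w. g w \<partial>sphere_measure)
        = (\<integral>\<^sup>+w. g w \<partial>distr sphere_measure borel (\<lambda>w. cis (2 * pi * t) *s w))"
      by (simp only: sphere_measure_rotation_invariant[OF T])
    also have "\<dots> = (\<integral>\<^sup>+w. g (cis (2 * pi * t) *s w) \<partial>sphere_measure)"
      by (rule nn_integral_distr) measurable
    finally show "(\<integral>\<^sup>+w. g (cis (2 * pi * t) *s w) * indicator {0..1} t \<partial>sphere_measure)
        = (\<integral>\<^sup>+w. g w \<partial>sphere_measure) * indicator {0..1} t"
      by (subst nn_integral_multc) (auto simp: measurable_compose[OF Tm'])
  qed
  also have "\<dots> = (\<integral>\<^sup>+w. g w \<partial>sphere_measure)"
    by (subst nn_integral_cmult) auto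
  finally show ?thesis ..
qed

definition coeff_energy :: "(complex ^ 'd::finite \<Rightarrow> complex) \<Rightarrow> nat \<Rightarrow> ennreal" where
  "coeff_energy f k = (\<integral>\<^sup>+w. ennreal ((cmod (slice_coeff f k w))\<^sup>2) \<partial>sphere_measure)"

definition sphere_mean :: "(complex ^ 'd::finite \<Rightarrow> complex) \<Rightarrow> real \<Rightarrow> ennreal" where
  "sphere_mean f \<rho> = (\<integral>\<^sup>+w. ennreal ((cmod (f (\<rho> *\<^sub>R w)))\<^sup>2) \<partial>sphere_measure)"

lemma sphere_mean_cut_ball:
  assumes "0 \<le> \<rho>" "\<rho> < 1"
  shows "sphere_mean f \<rho> = (\<integral>\<^sup>+w. ennreal ((cmod (cut_ball f (\<rho> *\<^sub>R w)))\<^sup>2) \<partial>sphere_measure)"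
  unfolding sphere_mean_def
  by (rule nn_integral_cong_AE, rule AE_mp[OF sphere_measure_sphere])
    (use assms in \<open>auto simp: cut_ball_eq intro!: AE_I2\<close>)

lemma sphere_mean_circle_mean:
  assumes f: "f \<in> hol_ball" and \<rho>: "0 \<le> \<rho>" "\<rho> < 1"
  shows "sphere_mean f \<rho> = (\<integral>\<^sup>+w. (\<integral>\<^sup>+t\<in>{0..1}.
    ennreal ((cmod (f ((of_real \<rho> * cis (2 * pi * t)) *s w)))\<^sup>2) \<partial>lborel) \<partial>sphere_measure)"
proof -
  note cut_ball_measurable[OF f, measurable]
  have "sphere_mean f \<rho> = (\<integral>\<^sup>+w. (\<integral>\<^sup>+t\<in>{0..1}.
      ennreal ((cmod (cut_ball f (\<rho> *\<^sub>R (cis (2 * pi * t) *s w))))\<^sup>2) \<partial>lborel) \<partial>sphere_measure)"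
    unfolding sphere_mean_cut_ball[OF \<rho>]
    by (rule nn_integral_sphere_rotation_mean) measurable
  also have "\<dots> = (\<integral>\<^sup>+w. (\<integral>\<^sup>+t\<in>{0..1}.
    ennreal ((cmod (f ((of_real \<rho> * cis (2 * pi * t)) *s w)))\<^sup>2) \<partial>lborel) \<partial>sphere_measure)"
  proof (rule nn_integral_cong_AE, rule AE_mp[OF sphere_measure_sphere], intro AE_I2 impI nn_integral_cong)
    fix w :: "complex ^ 'a" and t :: real
    assume w: "norm w = 1"
    have "\<rho> *\<^sub>R (cis (2 * pi * t) *s w) = (of_real \<rho> * cis (2 * pi * t)) *s w"
      by (simp only: scaleR_eq_vector_scalar_mult vector_smult_assoc)
    moreover have "norm ((of_real \<rho> * cis (2 * pi * t)) *s w) < 1"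
      using w \<rho> by (simp add: norm_vector_scalar_mult norm_mult)
    ultimately show "ennreal ((cmod (cut_ball f (\<rho> *\<^sub>R (cis (2 * pi * t) *s w))))\<^sup>2) * indicator {0..1} t
        = ennreal ((cmod (f ((of_real \<rho> * cis (2 * pi * t)) *s w)))\<^sup>2) * indicator {0..1} t"
      by (simp only: cut_ball_eq)
  qed
  finally show ?thesis .
qed

lemma sphere_mean_eq_suminf:
  assumes f: "f \<in> hol_ball" and \<rho>: "0 \<le> \<rho>" "\<rho> < 1"
  shows "sphere_mean f \<rho> = (\<Sum>k. coeff_energy f k * ennreal (\<rho> ^ (2 * k)))"
proof -
  note slice_coeff_measurable[OF f, measurable]
  have "sphere_mean f \<rho> = (\<integral>\<^sup>+w. (\<Sum>k. ennreal ((cmod (slice_coeff f k w))\<^sup>2 * \<rho> ^ (2 * k))) \<partial>sphere_measure)"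
    unfolding sphere_mean_circle_mean[OF f \<rho>]
  proof (rule nn_integral_cong_AE, rule AE_mp[OF sphere_measure_sphere], intro AE_I2 impI)
    fix w :: "complex ^ 'a" assume w: "norm w = 1"
    show "(\<integral>\<^sup>+t\<in>{0..1}. ennreal ((cmod (f ((of_real \<rho> * cis (2 * pi * t)) *s w)))\<^sup>2) \<partial>lborel)
        = (\<Sum>k. ennreal ((cmod (slice_coeff f k w))\<^sup>2 * \<rho> ^ (2 * k)))"
      by (rule parseval_power_series[where F = "\<lambda>x. f (x *s w)"])
        (use w \<rho> in \<open>auto intro!: slice_coeff_sums f simp: norm_vector_scalar_mult\<close>)
  qed
  also have "\<dots> = (\<Sum>k. \<integral>\<^sup>+w. ennreal ((cmod (slice_coeff f k w))\<^sup>2 * \<rho> ^ (2 * k)) \<partial>sphere_measure)"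
    by (rule nn_integral_suminf) measurable
  also have "\<dots> = (\<Sum>k. coeff_energy f k * ennreal (\<rho> ^ (2 * k)))"
  proof (intro suminf_cong)
    fix k
    have "(\<integral>\<^sup>+w. ennreal ((cmod (slice_coeff f k w))\<^sup>2 * \<rho> ^ (2 * k)) \<partial>sphere_measure)
        = (\<integral>\<^sup>+w. ennreal ((cmod (slice_coeff f k w))\<^sup>2) * ennreal (\<rho> ^ (2 * k)) \<partial>sphere_measure)"
      using \<rho> by (intro nn_integral_cong) (simp add: ennreal_mult)
    also have "\<dots> = coeff_energy f k * ennreal (\<rho> ^ (2 * k))"
      unfolding coeff_energy_def by (rule nn_integral_multc) measurable
    finally show "(\<integral>\<^sup>+w. ennreal ((cmod (slice_coeff f k w))\<^sup>2 * \<rho> ^ (2 * k)) \<partial>sphere_measure)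
        = coeff_energy f k * ennreal (\<rho> ^ (2 * k))" .
  qed
  finally show ?thesis .
qed

lemma exists_sequence_to_one:
  obtains r :: "nat \<Rightarrow> real" where "\<And>n. 1/2 \<le> r n" "\<And>n. r n < 1" "incseq r" "r \<longlonglongrightarrow> 1"
proof
  let ?r = "\<lambda>n. 1 - 1 / real (n + 2)"
  show "1/2 \<le> ?r n" "?r n < 1" for n by (auto simp: field_simps)
  show "incseq ?r" by (auto simp: incseq_def field_simps)
  have "(\<lambda>n. 1 / real (n + 2)) \<longlonglongrightarrow> 0"
    using LIMSEQ_ignore_initial_segment[OF lim_1_over_n, of 2] by simp
  from tendsto_diff[OF tendsto_const this, of 1] show "?r \<longlonglongrightarrow> 1" by simp
qed

text \<open>
  The spherical means are power series in \<open>\<rho>\<^sup>2\<close> with nonnegative coefficients, hence increasing, and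
  monotone convergence gives their supremum as the value at \<open>\<rho> = 1\<close>.
\<close>

lemma hardy_sqnorm_eq_suminf:
  assumes f: "f \<in> hol_ball"
  shows "hardy_sqnorm f = (\<Sum>k. coeff_energy f k)"
proof -
  have "hardy_sqnorm f = (SUP r\<in>{0<..<1}. \<Sum>k. coeff_energy f k * ennreal (r ^ (2 * k)))"
    unfolding hardy_sqnorm_def
    by (intro SUP_cong refl) (simp add: sphere_mean_eq_suminf[OF f, symmetric] sphere_mean_def)
  also have "\<dots> = (\<Sum>k. coeff_energy f k)"
  proof (rule antisym)
    show "(SUP r\<in>{0<..<1}. \<Sum>k. coeff_energy f k * ennreal (r ^ (2 * k))) \<le> (\<Sum>k. coeff_energy f k)"
    proof (intro SUP_least suminf_le)
      fix r :: real and k assume "r \<in> {0<..<1}"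
      then have "ennreal (r ^ (2 * k)) \<le> 1" by (simp add: power_le_one)
      then show "coeff_energy f k * ennreal (r ^ (2 * k)) \<le> coeff_energy f k"
        using mult_left_mono[of "ennreal (r ^ (2 * k))" 1 "coeff_energy f k"] by simp
    qed auto
    obtain r :: "nat \<Rightarrow> real" where r': "\<And>n. 1/2 \<le> r n" "\<And>n. r n < 1"
      and rinc: "incseq r" and rlim: "r \<longlonglongrightarrow> 1"
      by (rule exists_sequence_to_one) (rule that)
    have r: "r n \<in> {0<..<1}" for n using r'[of n] by auto
    have inc: "incseq (\<lambda>n. ennreal (r n ^ (2 * k)))" for k
      unfolding incseq_def
    proof (intro allI impI ennreal_leI power_mono)
      show "0 \<le> r m" for m using r[of m] by simp
    qed (rule incseqD[OF rinc])
    have sup1: "(SUP n. ennreal (r n ^ (2 * k))) = 1" for k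
    proof (rule LIMSEQ_unique[OF LIMSEQ_SUP[OF inc]])
      have "(\<lambda>n. ennreal (r n ^ (2 * k))) \<longlonglongrightarrow> ennreal (1 ^ (2 * k))"
        by (intro tendsto_intros rlim)
      then show "(\<lambda>n. ennreal (r n ^ (2 * k))) \<longlonglongrightarrow> 1" by simp
    qed
    have "(\<Sum>k. coeff_energy f k) = (\<Sum>k. SUP n. coeff_energy f k * ennreal (r n ^ (2 * k)))"
      by (simp add: SUP_mult_left_ennreal[symmetric] sup1)
    also have "\<dots> = (SUP n. \<Sum>k. coeff_energy f k * ennreal (r n ^ (2 * k)))"
      using inc by (intro ennreal_suminf_SUP_eq) (auto simp: incseq_def intro!: mult_left_mono)
    also have "\<dots> \<le> (SUP r\<in>{0<..<1}. \<Sum>k. coeff_energy f k * ennreal (r ^ (2 * k)))"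
      using r by (intro SUP_least SUP_upper2[of "r _"]) auto
    finally show "(\<Sum>k. coeff_energy f k) \<le> (SUP r\<in>{0<..<1}. \<Sum>k. coeff_energy f k * ennreal (r ^ (2 * k)))" .
  qed
  finally show ?thesis .
qed

lemma measurable_scaleR_pair:
  assumes "sets \<mu> = sets (restrict_space borel {0..1 :: real})"
  shows "(\<lambda>(r, w). r *\<^sub>R w) \<in> borel_measurable (\<mu> \<Otimes>\<^sub>M (sphere_measure :: (complex ^ 'd::finite) measure))"
proof -
  have "fst \<in> measurable (\<mu> \<Otimes>\<^sub>M (sphere_measure :: (complex ^ 'd) measure)) \<mu>" by measurable
  moreover have "(\<lambda>r. r) \<in> borel_measurable \<mu>"
    using assms by (simp cong: measurable_cong_sets add: measurable_restrict_space1)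
  ultimately have [measurable]: "fst \<in> borel_measurable (\<mu> \<Otimes>\<^sub>M (sphere_measure :: (complex ^ 'd) measure))"
    using measurable_compose by blast
  have [measurable]: "snd \<in> borel_measurable (\<mu> \<Otimes>\<^sub>M (sphere_measure :: (complex ^ 'd) measure))"
    using measurable_snd[of \<mu> "sphere_measure :: (complex ^ 'd) measure"]
    by (simp cong: measurable_cong_sets)
  show ?thesis unfolding split_def by measurable
qed

lemma nn_integral_radial_measure:
  fixes g :: "complex ^ 'd::finite \<Rightarrow> ennreal"
  assumes s: "sets \<mu> = sets (restrict_space borel {0..1 :: real})"
    and [measurable]: "g \<in> borel_measurable borel"
  shows "(\<integral>\<^sup>+z. g z \<partial>radial_measure \<mu>) = (\<integral>\<^sup>+r. (\<integral>\<^sup>+w. g (r *\<^sub>R w) \<partial>sphere_measure) \<partial>\<mu>)"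
    and "(\<lambda>r. \<integral>\<^sup>+w. g (r *\<^sub>R w) \<partial>sphere_measure) \<in> borel_measurable \<mu>"
proof -
  interpret S: prob_space "sphere_measure :: (complex ^ 'd) measure" by (rule prob_space_sphere_measure)
  note m [measurable] = measurable_scaleR_pair[OF s, where 'd='d]
  have g: "(\<lambda>(r, w). g (r *\<^sub>R w)) \<in> borel_measurable (\<mu> \<Otimes>\<^sub>M sphere_measure)"
    using measurable_compose[OF m assms(2)] by (simp add: split_def)
  have "(\<integral>\<^sup>+z. g z \<partial>radial_measure \<mu>) = (\<integral>\<^sup>+x. g (case x of (r, w) \<Rightarrow> r *\<^sub>R w) \<partial>(\<mu> \<Otimes>\<^sub>M sphere_measure))"
    unfolding radial_measure_def by (rule nn_integral_distr) measurable
  also have "\<dots> = (\<integral>\<^sup>+r. (\<integral>\<^sup>+w. g (r *\<^sub>R w) \<partial>sphere_measure) \<partial>\<mu>)"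
    using S.nn_integral_fst[OF g] by (simp add: split_def)
  finally show "(\<integral>\<^sup>+z. g z \<partial>radial_measure \<mu>) = (\<integral>\<^sup>+r. (\<integral>\<^sup>+w. g (r *\<^sub>R w) \<partial>sphere_measure) \<partial>\<mu>)" .
  show "(\<lambda>r. \<integral>\<^sup>+w. g (r *\<^sub>R w) \<partial>sphere_measure) \<in> borel_measurable \<mu>"
    using S.borel_measurable_nn_integral_fst[OF g] by simp
qed

lemma nn_integral_ball_radial_measure:
  fixes f :: "complex ^ 'd::finite \<Rightarrow> complex"
  assumes s: "sets \<mu> = sets (restrict_space borel {0..1 :: real})" and f: "f \<in> hol_ball"
  shows "(\<integral>\<^sup>+z\<in>ball 0 1. ennreal ((cmod (f z))\<^sup>2) \<partial>radial_measure \<mu>)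
    = (\<integral>\<^sup>+r. sphere_mean f r * indicator {..<1} r \<partial>\<mu>)"
proof -
  note cut_ball_measurable[OF f, measurable]
  have "(\<integral>\<^sup>+z\<in>ball 0 1. ennreal ((cmod (f z))\<^sup>2) \<partial>radial_measure \<mu>)
      = (\<integral>\<^sup>+z. ennreal ((cmod (cut_ball f z))\<^sup>2) \<partial>radial_measure \<mu>)"
    by (intro nn_integral_cong) (auto simp: cut_ball_def indicator_def)
  also have "\<dots> = (\<integral>\<^sup>+r. (\<integral>\<^sup>+w. ennreal ((cmod (cut_ball f (r *\<^sub>R w)))\<^sup>2) \<partial>sphere_measure) \<partial>\<mu>)"
    by (rule nn_integral_radial_measure[OF s]) measurable
  also have "\<dots> = (\<integral>\<^sup>+r. sphere_mean f r * indicator {..<1} r \<partial>\<mu>)"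
  proof (rule nn_integral_cong)
    fix r assume "r \<in> space \<mu>"
    then have r: "0 \<le> r" "r \<le> 1"
      using sets_eq_imp_space_eq[OF s] by (auto simp: space_restrict_space)
    show "(\<integral>\<^sup>+w. ennreal ((cmod (cut_ball f (r *\<^sub>R w)))\<^sup>2) \<partial>sphere_measure)
        = sphere_mean f r * indicator {..<1} r"
    proof (cases "r < 1")
      case True
      then show ?thesis using r by (simp add: sphere_mean_cut_ball)
    next
      case False
      have "(\<integral>\<^sup>+w. ennreal ((cmod (cut_ball f (r *\<^sub>R w)))\<^sup>2) \<partial>sphere_measure)
          = (\<integral>\<^sup>+w. 0 \<partial>(sphere_measure :: (complex ^ 'd) measure))"
      proof (intro nn_integral_cong_AE, rule AE_mp[OF sphere_measure_sphere], intro AE_I2 impI)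
        fix w :: "complex ^ 'd" assume "norm w = 1"
        then show "ennreal ((cmod (cut_ball f (r *\<^sub>R w)))\<^sup>2) = 0"
          using False r by (simp add: cut_ball_def)
      qed
      then show ?thesis using False by simp
    qed
  qed
  finally show ?thesis .
qed

definition radial_moment :: "real measure \<Rightarrow> nat \<Rightarrow> ennreal" where
  "radial_moment \<mu> k = (\<integral>\<^sup>+r. ennreal (r ^ (2 * k)) \<partial>\<mu>)"

text \<open>
  In polar coordinates both parts of the norm become sums over \<open>k\<close>: the integral over the open ball
  supplies the moments of \<open>\<mu>\<close> on \<open>[0, 1)\<close>, and the Hardy term supplies exactly the contribution of a
  point mass at 1.
\<close>

lemma L2_sqnorm_eq_suminf:
  fixes f :: "complex ^ 'd::finite \<Rightarrow> complex"
  assumes s: "sets \<mu> = sets (restrict_space borel {0..1 :: real})" and f: "f \<in> hol_ball"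
  shows "L2_sqnorm \<mu> f = (\<Sum>k. radial_moment \<mu> k * coeff_energy f k)"
proof -
  have id: "(\<lambda>r. r) \<in> borel_measurable \<mu>"
    using s by (simp cong: measurable_cong_sets add: measurable_restrict_space1)
  have space: "space \<mu> = {0..1}"
    using sets_eq_imp_space_eq[OF s] by (auto simp: space_restrict_space)
  have s1: "{1} \<in> sets \<mu>" "{..<1} \<inter> space \<mu> \<in> sets \<mu>"
    unfolding s space by (subst sets_restrict_space_iff; auto)+
  have pm [measurable]: "(\<lambda>r. ennreal (r ^ (2 * k))) \<in> borel_measurable \<mu>" for k
    using id by measurable
  let ?h = "\<lambda>r. \<Sum>k. coeff_energy f k * ennreal (r ^ (2 * k))"
  have im [measurable]: "(\<lambda>r. indicator {..<1} r :: ennreal) \<in> borel_measurable \<mu>"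
    using measurable_compose[OF id, of "indicator {..<1}" borel] by simp
  have "L2_sqnorm \<mu> f = (\<integral>\<^sup>+r. ?h r * indicator {..<1} r \<partial>\<mu>) + emeasure \<mu> {1} * ?h 1"
    unfolding L2_sqnorm_def nn_integral_ball_radial_measure[OF s f] hardy_sqnorm_eq_suminf[OF f]
    by (intro arg_cong2[where f="(+)"] nn_integral_cong)
      (auto simp: space sphere_mean_eq_suminf[OF f] indicator_def)
  also have "emeasure \<mu> {1} * ?h 1 = (\<integral>\<^sup>+r. ?h 1 * indicator {1} r \<partial>\<mu>)"
    using s1(1) by (simp add: nn_integral_cmult_indicator mult.commute)
  also have "(\<integral>\<^sup>+r. ?h r * indicator {..<1} r \<partial>\<mu>) + \<dots>
      = (\<integral>\<^sup>+r. ?h r * indicator {..<1} r + ?h 1 * indicator {1} r \<partial>\<mu>)"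
    by (intro nn_integral_add[symmetric] borel_measurable_times_ennreal borel_measurable_suminf_order
        im pm borel_measurable_const borel_measurable_indicator s1)
  also have "\<dots> = (\<integral>\<^sup>+r. ?h r \<partial>\<mu>)"
    by (intro nn_integral_cong) (auto simp: space indicator_def)
  also have "\<dots> = (\<Sum>k. \<integral>\<^sup>+r. coeff_energy f k * ennreal (r ^ (2 * k)) \<partial>\<mu>)"
    by (intro nn_integral_suminf borel_measurable_times_ennreal pm borel_measurable_const)
  also have "\<dots> = (\<Sum>k. radial_moment \<mu> k * coeff_energy f k)"
    unfolding radial_moment_def by (simp only: nn_integral_cmult[OF pm] mult.commute[of _ "coeff_energy f _"])
  finally show ?thesis .
qed

section \<open>Besov norms as weighted coefficient sums\<close>

abbreviation unit_interval_measure :: "real measure \<Rightarrow> bool" where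
  "unit_interval_measure \<mu> \<equiv> sets \<mu> = sets (restrict_space borel {0..1 :: real})"

lemma space_unit_interval_measure: "unit_interval_measure \<mu> \<Longrightarrow> space \<mu> = {0..1}"
  by (drule sets_eq_imp_space_eq) (simp add: space_restrict_space)

lemma sets_radial_measure [measurable_cong, simp]: "sets (radial_measure \<mu>) = sets borel"
  by (simp add: radial_measure_def)

lemma coeff_energy_0: "coeff_energy f 0 = ennreal ((cmod (f 0))\<^sup>2)"
proof -
  interpret S: prob_space "sphere_measure :: (complex ^ 'a) measure" by (rule prob_space_sphere_measure)
  show ?thesis by (simp add: coeff_energy_def slice_coeff_0 S.emeasure_space_1)
qed

lemma coeff_energy_radial_deriv_pow:
  assumes "f \<in> hol_ball"
  shows "coeff_energy ((radial_deriv ^^ N) f) k = ennreal (real k ^ (2 * N)) * coeff_energy f k"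
proof -
  note slice_coeff_measurable[OF assms, measurable]
  have "ennreal ((cmod (slice_coeff ((radial_deriv ^^ N) f) k w))\<^sup>2)
      = ennreal (real k ^ (2 * N)) * ennreal ((cmod (slice_coeff f k w))\<^sup>2)" for w
    by (simp add: slice_coeff_radial_deriv_pow[OF assms] norm_mult norm_power power_mult_distrib
        power_mult[symmetric] mult.commute ennreal_mult)
  then show ?thesis unfolding coeff_energy_def by (simp add: nn_integral_cmult)
qed

lemma coeff_energy_dilate_diff:
  assumes f: "f \<in> hol_ball" and s: "0 \<le> s" "s \<le> 1"
  shows "coeff_energy (\<lambda>z. f (s *\<^sub>R z) - f z) k = ennreal ((1 - s ^ k)\<^sup>2) * coeff_energy f k"
proof -
  note slice_coeff_measurable[OF f, measurable]
  have fs: "(\<lambda>z. f (s *\<^sub>R z)) \<in> hol_ball" using s by (intro hol_ball_dilate f) auto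
  have "ennreal ((cmod (slice_coeff (\<lambda>z. f (s *\<^sub>R z) - f z) k w))\<^sup>2)
      = ennreal ((1 - s ^ k)\<^sup>2) * ennreal ((cmod (slice_coeff f k w))\<^sup>2)" for w
  proof -
    have "slice_coeff (\<lambda>z. f (s *\<^sub>R z) - f z) k w = of_real (s ^ k - 1) * slice_coeff f k w"
      by (simp add: slice_coeff_diff[OF fs f] slice_coeff_dilate[OF f s] algebra_simps)
    then have "(cmod (slice_coeff (\<lambda>z. f (s *\<^sub>R z) - f z) k w))\<^sup>2 = (1 - s ^ k)\<^sup>2 * (cmod (slice_coeff f k w))\<^sup>2"
      by (simp only: norm_mult norm_of_real power_mult_distrib power2_abs power2_commute[of 1])
    then show ?thesis by (simp add: ennreal_mult)
  qed
  then show ?thesis unfolding coeff_energy_def by (simp add: nn_integral_cmult)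
qed

text \<open>
  The free parameter \<open>\<delta>\<close> is what replaces inner products later on: if one of the two energies is
  small, choosing on which side to put \<open>1 / \<delta>\<close> shows that squared norms are almost additive.
\<close>

lemma coeff_energy_add_le:
  assumes f: "f \<in> hol_ball" and g: "g \<in> hol_ball" and d: "\<delta> > 0"
  shows "coeff_energy (\<lambda>z. f z + g z) k
    \<le> ennreal (1 + \<delta>) * coeff_energy f k + ennreal (1 + 1 / \<delta>) * coeff_energy g k"
proof -
  note slice_coeff_measurable[OF f, measurable] slice_coeff_measurable[OF g, measurable]
  have *: "(cmod (a + b))\<^sup>2 \<le> (1 + \<delta>) * (cmod a)\<^sup>2 + (1 + 1 / \<delta>) * (cmod b)\<^sup>2" for a b
  proof -
    define x y where "x = sqrt \<delta> * cmod a" and "y = cmod b / sqrt \<delta>"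
    have "2 * (x * y) \<le> x\<^sup>2 + y\<^sup>2" using sum_squares_bound[of x y] by simp
    moreover have "x * y = cmod a * cmod b" "x\<^sup>2 = \<delta> * (cmod a)\<^sup>2" "y\<^sup>2 = (cmod b)\<^sup>2 / \<delta>"
      using d by (auto simp: x_def y_def power_mult_distrib power_divide)
    moreover have "(cmod (a + b))\<^sup>2 \<le> (cmod a + cmod b)\<^sup>2"
      by (intro power_mono norm_triangle_ineq) auto
    ultimately show ?thesis by (simp add: power2_sum algebra_simps)
  qed
  have "coeff_energy (\<lambda>z. f z + g z) k \<le>
    (\<integral>\<^sup>+w. ennreal (1 + \<delta>) * ennreal ((cmod (slice_coeff f k w))\<^sup>2)
      + ennreal (1 + 1 / \<delta>) * ennreal ((cmod (slice_coeff g k w))\<^sup>2) \<partial>sphere_measure)"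
    unfolding coeff_energy_def
  proof (rule nn_integral_mono)
    fix w
    have "ennreal ((cmod (slice_coeff (\<lambda>z. f z + g z) k w))\<^sup>2)
        \<le> ennreal ((1 + \<delta>) * (cmod (slice_coeff f k w))\<^sup>2 + (1 + 1 / \<delta>) * (cmod (slice_coeff g k w))\<^sup>2)"
      unfolding slice_coeff_add[OF f g] by (intro ennreal_leI *)
    also have "\<dots> = ennreal (1 + \<delta>) * ennreal ((cmod (slice_coeff f k w))\<^sup>2)
      + ennreal (1 + 1 / \<delta>) * ennreal ((cmod (slice_coeff g k w))\<^sup>2)"
      using d by (subst ennreal_plus) (auto simp: ennreal_mult)
    finally show "ennreal ((cmod (slice_coeff (\<lambda>z. f z + g z) k w))\<^sup>2) \<le> \<dots>" .
  qed
  also have "\<dots> = ennreal (1 + \<delta>) * coeff_energy f k + ennreal (1 + 1 / \<delta>) * coeff_energy g k"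
    unfolding coeff_energy_def by (subst nn_integral_add) (auto simp: nn_integral_cmult)
  finally show ?thesis .
qed

lemma coeff_energy_le_sphere_mean:
  assumes f: "f \<in> hol_ball"
  shows "coeff_energy f k \<le> ennreal (4 ^ k) * sphere_mean f (1/2)"
proof -
  have "coeff_energy f k * ennreal ((1/2) ^ (2 * k)) \<le> sphere_mean f (1/2)"
    unfolding sphere_mean_eq_suminf[OF f, of "1/2", simplified]
    using sum_le_suminf[of "\<lambda>k. coeff_energy f k * ennreal ((1/2) ^ (2 * k))" "{k}"] by simp
  then have "ennreal (4 ^ k) * (coeff_energy f k * ennreal ((1/2) ^ (2 * k))) \<le> ennreal (4 ^ k) * sphere_mean f (1/2)"
    by (rule mult_left_mono) simp
  moreover have "ennreal (4 ^ k) * (coeff_energy f k * ennreal ((1/2) ^ (2 * k))) = coeff_energy f k"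
  proof -
    have "(4 :: real) ^ k * (1/2) ^ (2 * k) = 1"
      by (simp add: power_mult power_mult_distrib[symmetric] power2_eq_square)
    then have "ennreal (4 ^ k) * ennreal ((1/2) ^ (2 * k)) = 1"
      by (subst ennreal_mult[symmetric]) auto
    then show ?thesis by (metis mult.commute mult.left_commute mult.right_neutral)
  qed
  ultimately show ?thesis by simp
qed

lemma sphere_mean_le:
  assumes B: "\<And>z. norm z = r \<Longrightarrow> cmod (f z) \<le> B" and "0 \<le> r"
  shows "sphere_mean f r \<le> ennreal (B\<^sup>2)"
proof -
  interpret S: prob_space "sphere_measure :: (complex ^ 'a) measure" by (rule prob_space_sphere_measure)
  have "sphere_mean f r \<le> (\<integral>\<^sup>+w. ennreal (B\<^sup>2) \<partial>(sphere_measure :: (complex ^ 'a) measure))"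
    unfolding sphere_mean_def
  proof (rule nn_integral_mono_AE, rule AE_mp[OF sphere_measure_sphere], intro AE_I2 impI ennreal_leI power_mono)
    fix w :: "complex ^ 'a" assume "norm w = 1"
    then show "cmod (f (r *\<^sub>R w)) \<le> B" using assms by (intro B) auto
  qed auto
  also have "\<dots> = ennreal (B\<^sup>2)" by (simp add: S.emeasure_space_1)
  finally show ?thesis .
qed

lemma coeff_energy_finite: "f \<in> hol_ball \<Longrightarrow> coeff_energy f k < \<infinity>"
proof -
  assume f: "f \<in> hol_ball"
  obtain B where "\<And>z. norm z \<le> 1/2 \<Longrightarrow> cmod (f z) \<le> B"
    using hol_ball_bounded[OF f, of "1/2"] by auto
  then have "sphere_mean f (1/2) \<le> ennreal (B\<^sup>2)" by (intro sphere_mean_le) auto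
  then have "ennreal (4 ^ k) * sphere_mean f (1/2) \<le> ennreal (4 ^ k) * ennreal (B\<^sup>2)"
    by (intro mult_left_mono) auto
  also have "\<dots> < \<infinity>" by (simp add: ennreal_mult_less_top)
  finally show ?thesis using coeff_energy_le_sphere_mean[OF f, of k] by (rule le_less_trans[rotated])
qed

lemma hardy_sqnorm_sphere_mean: "hardy_sqnorm f = (SUP r\<in>{0<..<1}. sphere_mean f r)"
  by (simp add: hardy_sqnorm_def sphere_mean_def)

text \<open>
  A pointwise comparison of squares on the open ball suffices, because the boundary part of the norm is
  itself a supremum of means over smaller spheres.
\<close>

lemma L2_sqnorm_le_sum:
  assumes f: "f \<in> hol_ball" and g: "\<And>i. i \<in> I \<Longrightarrow> g i \<in> hol_ball" and I: "finite I"
    and K: "K \<ge> 0"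
    and le: "\<And>z. norm z < 1 \<Longrightarrow> (cmod (f z))\<^sup>2 \<le> K * (\<Sum>i\<in>I. (cmod (g i z))\<^sup>2)"
  shows "L2_sqnorm \<mu> f \<le> ennreal K * (\<Sum>i\<in>I. L2_sqnorm \<mu> (g i))"
proof -
  have gm [measurable]: "i \<in> I \<Longrightarrow> cut_ball (g i) \<in> borel_measurable borel" for i
    by (intro cut_ball_measurable g)
  have pt: "ennreal ((cmod (cut_ball f z))\<^sup>2) \<le> ennreal K * (\<Sum>i\<in>I. ennreal ((cmod (cut_ball (g i) z))\<^sup>2))" for z
  proof (cases "norm z < 1")
    case True
    have "ennreal ((cmod (cut_ball f z))\<^sup>2) \<le> ennreal (K * (\<Sum>i\<in>I. (cmod (g i z))\<^sup>2))"
      using le[OF True] True by (intro ennreal_leI) (simp add: cut_ball_eq)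
    also have "\<dots> = ennreal K * (\<Sum>i\<in>I. ennreal ((cmod (cut_ball (g i) z))\<^sup>2))"
      using K True by (simp add: ennreal_mult sum_nonneg cut_ball_eq)
    finally show ?thesis .
  qed (simp add: cut_ball_def)
  have ball: "(\<integral>\<^sup>+z\<in>ball 0 1. ennreal ((cmod (h z))\<^sup>2) \<partial>radial_measure \<mu>)
      = (\<integral>\<^sup>+z. ennreal ((cmod (cut_ball h z))\<^sup>2) \<partial>radial_measure \<mu>)" for h :: "complex ^ 'a \<Rightarrow> complex"
    by (intro nn_integral_cong) (auto simp: cut_ball_def indicator_def)
  have 1: "(\<integral>\<^sup>+z\<in>ball 0 1. ennreal ((cmod (f z))\<^sup>2) \<partial>radial_measure \<mu>)
      \<le> ennreal K * (\<Sum>i\<in>I. \<integral>\<^sup>+z\<in>ball 0 1. ennreal ((cmod (g i z))\<^sup>2) \<partial>radial_measure \<mu>)"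
  proof -
    have "(\<integral>\<^sup>+z. ennreal ((cmod (cut_ball f z))\<^sup>2) \<partial>radial_measure \<mu>)
        \<le> (\<integral>\<^sup>+z. ennreal K * (\<Sum>i\<in>I. ennreal ((cmod (cut_ball (g i) z))\<^sup>2)) \<partial>radial_measure \<mu>)"
      by (intro nn_integral_mono pt)
    also have "\<dots> = ennreal K * (\<integral>\<^sup>+z. (\<Sum>i\<in>I. ennreal ((cmod (cut_ball (g i) z))\<^sup>2)) \<partial>radial_measure \<mu>)"
      by (rule nn_integral_cmult) measurable
    also have "(\<integral>\<^sup>+z. (\<Sum>i\<in>I. ennreal ((cmod (cut_ball (g i) z))\<^sup>2)) \<partial>radial_measure \<mu>)
        = (\<Sum>i\<in>I. \<integral>\<^sup>+z. ennreal ((cmod (cut_ball (g i) z))\<^sup>2) \<partial>radial_measure \<mu>)"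
      by (rule nn_integral_sum) measurable
    finally show ?thesis unfolding ball .
  qed
  have 2: "hardy_sqnorm f \<le> ennreal K * (\<Sum>i\<in>I. hardy_sqnorm (g i))"
    unfolding hardy_sqnorm_sphere_mean[of f]
  proof (rule SUP_least)
    fix r :: real assume r: "r \<in> {0<..<1}"
    have m [measurable]: "i \<in> I \<Longrightarrow> (\<lambda>w. ennreal ((cmod (cut_ball (g i) (r *\<^sub>R w)))\<^sup>2)) \<in> borel_measurable sphere_measure" for i
      using gm[of i] by measurable
    have "sphere_mean f r \<le> (\<integral>\<^sup>+w. ennreal K * (\<Sum>i\<in>I. ennreal ((cmod (cut_ball (g i) (r *\<^sub>R w)))\<^sup>2)) \<partial>sphere_measure)"
    proof -
      have "0 \<le> r" "r < 1" using r by auto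
      then show ?thesis unfolding sphere_mean_cut_ball[OF \<open>0 \<le> r\<close> \<open>r < 1\<close>]
        by (intro nn_integral_mono pt)
    qed
    also have "\<dots> = ennreal K * (\<integral>\<^sup>+w. (\<Sum>i\<in>I. ennreal ((cmod (cut_ball (g i) (r *\<^sub>R w)))\<^sup>2)) \<partial>sphere_measure)"
      by (rule nn_integral_cmult) measurable
    also have "(\<integral>\<^sup>+w. (\<Sum>i\<in>I. ennreal ((cmod (cut_ball (g i) (r *\<^sub>R w)))\<^sup>2)) \<partial>sphere_measure)
       = (\<Sum>i\<in>I. sphere_mean (g i) r)"
      using r by (subst nn_integral_sum) (auto intro!: sum.cong simp: sphere_mean_cut_ball)
    also have "\<dots> \<le> (\<Sum>i\<in>I. hardy_sqnorm (g i))"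
      unfolding hardy_sqnorm_sphere_mean using r by (intro sum_mono SUP_upper)
    finally show "sphere_mean f r \<le> ennreal K * (\<Sum>i\<in>I. hardy_sqnorm (g i))"
      by (simp add: mult_left_mono)
  qed
  have "L2_sqnorm \<mu> f \<le> ennreal K * (\<Sum>i\<in>I. \<integral>\<^sup>+z\<in>ball 0 1. ennreal ((cmod (g i z))\<^sup>2) \<partial>radial_measure \<mu>)
      + emeasure \<mu> {1} * (ennreal K * (\<Sum>i\<in>I. hardy_sqnorm (g i)))"
    unfolding L2_sqnorm_def by (intro add_mono 1 mult_left_mono 2) auto
  also have "\<dots> = ennreal K * (\<Sum>i\<in>I. L2_sqnorm \<mu> (g i))"
    unfolding L2_sqnorm_def by (simp add: sum.distrib distrib_left sum_distrib_left mult_ac)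
  finally show ?thesis .
qed

lemma radial_moment_le:
  assumes "unit_interval_measure \<mu>"
  shows "radial_moment \<mu> k \<le> emeasure \<mu> {0..1}" and "radial_moment \<mu> 0 = emeasure \<mu> {0..1}"
proof -
  have "radial_moment \<mu> k \<le> (\<integral>\<^sup>+r. 1 \<partial>\<mu>)"
    unfolding radial_moment_def
    using space_unit_interval_measure[OF assms] by (intro nn_integral_mono) (auto intro!: power_le_one)
  then show "radial_moment \<mu> k \<le> emeasure \<mu> {0..1}"
    using space_unit_interval_measure[OF assms] by simp
  show "radial_moment \<mu> 0 = emeasure \<mu> {0..1}"
    using space_unit_interval_measure[OF assms] by (simp add: radial_moment_def)
qed

lemma coeff_energy_const: "coeff_energy (\<lambda>_. c) k = (if k = 0 then ennreal ((cmod c)\<^sup>2) else 0)"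
proof -
  have sc: "slice_coeff (\<lambda>_. c) k w = (if k = 0 then c else 0)" for k and w :: "complex ^ 'a"
    by (simp add: slice_coeff_def higher_deriv_const)
  show ?thesis
    using coeff_energy_0[of "\<lambda>_ :: complex ^ 'a. c"] by (cases "k = 0") (simp_all add: coeff_energy_def sc)
qed

lemma suminf_coeff_energy_const:
  fixes W :: "nat \<Rightarrow> ennreal"
  shows "(\<Sum>k. W k * coeff_energy (\<lambda>_. c) k) = W 0 * ennreal ((cmod c)\<^sup>2)"
  by (subst suminf_finite[of "{0}"]) (auto simp: coeff_energy_const)

lemma L2_sqnorm_const:
  assumes "unit_interval_measure \<mu>"
  shows "L2_sqnorm \<mu> (\<lambda>_ :: complex ^ 'd::finite. c) = emeasure \<mu> {0..1} * ennreal ((cmod c)\<^sup>2)"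
  unfolding L2_sqnorm_eq_suminf[OF assms hol_ball_const] suminf_coeff_energy_const
  by (simp add: radial_moment_le(2)[OF assms])

lemma L2_sqnorm_bounded:
  assumes "unit_interval_measure \<mu>" "f \<in> hol_ball" "\<And>z. norm z < 1 \<Longrightarrow> cmod (f z) \<le> B"
  shows "L2_sqnorm \<mu> f \<le> ennreal (B\<^sup>2) * emeasure \<mu> {0..1}"
proof -
  have "L2_sqnorm \<mu> f \<le> ennreal (B\<^sup>2) * (\<Sum>i\<in>{()}. L2_sqnorm \<mu> (\<lambda>_ :: complex ^ 'a. 1))"
    using assms by (intro L2_sqnorm_le_sum) (auto intro!: hol_ball_const power_mono)
  then show ?thesis by (simp add: L2_sqnorm_const[OF assms(1)])
qed

text \<open>
  The maximum with 1 accounts for the term with \<open>f(0)\<close> in the norm, whose weight at \<open>k = 0\<close> is the total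
  mass of \<open>\<mu>\<close>.
\<close>

definition besov_weight :: "nat \<Rightarrow> real measure \<Rightarrow> nat \<Rightarrow> ennreal" where
  "besov_weight N \<mu> k = radial_moment \<mu> k * ennreal (real (max 1 k) ^ (2 * N))"

definition besov_sqnorm :: "nat \<Rightarrow> real measure \<Rightarrow> (complex ^ 'd::finite \<Rightarrow> complex) \<Rightarrow> ennreal" where
  "besov_sqnorm N \<mu> f = (\<Sum>k. besov_weight N \<mu> k * coeff_energy f k)"

lemma besov_sqnorm_eq:
  assumes \<mu>: "unit_interval_measure \<mu>" and f: "f \<in> hol_ball" and N: "N \<ge> 1"
  shows "besov_sqnorm N \<mu> f
    = emeasure \<mu> {0..1} * ennreal ((cmod (f 0))\<^sup>2) + L2_sqnorm \<mu> ((radial_deriv ^^ N) f)"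
proof -
  let ?a = "\<lambda>k. besov_weight N \<mu> k * coeff_energy f k"
  let ?b = "\<lambda>k. radial_moment \<mu> k * coeff_energy ((radial_deriv ^^ N) f) k"
  have b: "?b 0 = 0" "?b (Suc k) = ?a (Suc k)" for k
    using N by (auto simp: coeff_energy_radial_deriv_pow[OF f] besov_weight_def mult.assoc)
  have "besov_sqnorm N \<mu> f = ?a 0 + (\<Sum>k. ?a (Suc k))"
    unfolding besov_sqnorm_def using suminf_offset[of ?a 1] by (simp add: add.commute)
  also have "(\<Sum>k. ?a (Suc k)) = (\<Sum>k. ?b k)"
    using suminf_offset[of ?b 1] b by simp
  finally show ?thesis
    by (simp add: L2_sqnorm_eq_suminf[OF \<mu> radial_deriv_pow_hol_ball[OF f]] besov_weight_def
        radial_moment_le(2)[OF \<mu>] coeff_energy_0)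
qed

lemma L2_sqnorm_radial_deriv_pow_le:
  assumes \<mu>: "unit_interval_measure \<mu>" and f: "f \<in> hol_ball" and "j \<le> N"
  shows "L2_sqnorm \<mu> ((radial_deriv ^^ j) f) \<le> besov_sqnorm N \<mu> f"
  unfolding L2_sqnorm_eq_suminf[OF \<mu> radial_deriv_pow_hol_ball[OF f]] besov_sqnorm_def
proof (intro suminf_le)
  fix k
  have "real k ^ (2 * j) \<le> real (max 1 k) ^ (2 * j)" by (intro power_mono) auto
  also have "\<dots> \<le> real (max 1 k) ^ (2 * N)" using assms(3) by (intro power_increasing) auto
  finally show "radial_moment \<mu> k * coeff_energy ((radial_deriv ^^ j) f) k
      \<le> besov_weight N \<mu> k * coeff_energy f k"
    unfolding coeff_energy_radial_deriv_pow[OF f] besov_weight_def mult.assoc[symmetric]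
    by (intro mult_left_mono mult_right_mono ennreal_leI) auto
qed auto

lemma besov_weight_finite:
  assumes "unit_interval_measure \<mu>" "finite_measure \<mu>"
  shows "besov_weight N \<mu> k < \<infinity>"
proof -
  have "radial_moment \<mu> k < \<infinity>"
    using radial_moment_le(1)[OF assms(1), of k] finite_measure.emeasure_finite[OF assms(2), of "{0..1}"]
    by (auto simp: less_top intro: le_less_trans)
  then show ?thesis by (simp add: besov_weight_def ennreal_mult_less_top)
qed

lemma besov_space_iff:
  assumes "unit_interval_measure \<mu>" "finite_measure \<mu>" "N \<ge> 1"
  shows "f \<in> besov_space N \<mu> \<longleftrightarrow> f \<in> hol_ball \<and> besov_sqnorm N \<mu> f < \<infinity>"
  using finite_measure.emeasure_finite[OF assms(2), of "{0..1}"]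
  by (auto simp: besov_space_def besov_sqnorm_eq[OF assms(1) _ assms(3)] ennreal_mult_less_top less_top)

lemma besov_norm_less_iff:
  assumes \<mu>: "unit_interval_measure \<mu>" "finite_measure \<mu>" and N: "N \<ge> 1"
    and f: "f \<in> besov_space N \<mu>" and e: "\<epsilon> > 0"
  shows "besov_norm N \<mu> f < \<epsilon> \<longleftrightarrow> besov_sqnorm N \<mu> f < ennreal (\<epsilon>\<^sup>2)"
proof -
  have fin: "f \<in> hol_ball" "besov_sqnorm N \<mu> f < \<infinity>" using f besov_space_iff[OF \<mu> N] by auto
  have L: "L2_sqnorm \<mu> ((radial_deriv ^^ N) f) < \<infinity>" using f by (simp add: besov_space_def)
  have "enn2real (besov_sqnorm N \<mu> f)
      = measure \<mu> {0..1} * (cmod (f 0))\<^sup>2 + enn2real (L2_sqnorm \<mu> ((radial_deriv ^^ N) f))"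
    unfolding besov_sqnorm_eq[OF \<mu>(1) fin(1) N]
    using finite_measure.emeasure_finite[OF \<mu>(2), of "{0..1}"] L
    by (subst enn2real_plus) (auto simp: enn2real_mult measure_def ennreal_mult_less_top less_top)
  then have "besov_norm N \<mu> f = sqrt (enn2real (besov_sqnorm N \<mu> f))"
    by (simp add: besov_norm_def)
  moreover have "sqrt x < \<epsilon> \<longleftrightarrow> x < \<epsilon>\<^sup>2" if "x \<ge> 0" for x
    using e that by (metis real_sqrt_less_iff real_sqrt_unique less_imp_le)
  moreover have "enn2real x < \<epsilon>\<^sup>2 \<longleftrightarrow> x < ennreal (\<epsilon>\<^sup>2)" if "x < \<infinity>" for x
    using that e by (cases x) (auto simp: ennreal_less_iff)
  ultimately show ?thesis using fin by simp
qed

lemma besov_sqnorm_add_le: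
  assumes f: "f \<in> hol_ball" and g: "g \<in> hol_ball"
  shows "besov_sqnorm N \<mu> (\<lambda>z. f z + g z) \<le> 2 * besov_sqnorm N \<mu> f + 2 * besov_sqnorm N \<mu> g"
proof -
  have "besov_sqnorm N \<mu> (\<lambda>z. f z + g z) \<le>
     (\<Sum>k. 2 * (besov_weight N \<mu> k * coeff_energy f k) + 2 * (besov_weight N \<mu> k * coeff_energy g k))"
    unfolding besov_sqnorm_def
  proof (intro suminf_le)
    fix k
    have "coeff_energy (\<lambda>z. f z + g z) k \<le> 2 * coeff_energy f k + 2 * coeff_energy g k"
      using coeff_energy_add_le[OF f g, of 1 k] by simp
    then have "besov_weight N \<mu> k * coeff_energy (\<lambda>z. f z + g z) k
        \<le> besov_weight N \<mu> k * (2 * coeff_energy f k + 2 * coeff_energy g k)"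
      by (rule mult_left_mono) simp
    then show "besov_weight N \<mu> k * coeff_energy (\<lambda>z. f z + g z) k
        \<le> 2 * (besov_weight N \<mu> k * coeff_energy f k) + 2 * (besov_weight N \<mu> k * coeff_energy g k)"
      by (simp add: distrib_left mult_ac)
  qed auto
  also have "\<dots> = 2 * besov_sqnorm N \<mu> f + 2 * besov_sqnorm N \<mu> g"
    unfolding besov_sqnorm_def by (subst suminf_add[symmetric]) (auto simp: ennreal_suminf_cmult)
  finally show ?thesis .
qed

lemma coeff_energy_cmult:
  assumes f: "f \<in> hol_ball"
  shows "coeff_energy (\<lambda>z. c * f z) k = ennreal ((cmod c)\<^sup>2) * coeff_energy f k"
proof -
  note slice_coeff_measurable[OF f, measurable]
  have "ennreal ((cmod (slice_coeff (\<lambda>z. c * f z) k w))\<^sup>2)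
      = ennreal ((cmod c)\<^sup>2) * ennreal ((cmod (slice_coeff f k w))\<^sup>2)" for w
    by (simp add: slice_coeff_cmult[OF f] norm_mult power_mult_distrib ennreal_mult)
  then show ?thesis unfolding coeff_energy_def by (simp add: nn_integral_cmult)
qed

lemma besov_sqnorm_cmult:
  assumes f: "f \<in> hol_ball"
  shows "besov_sqnorm N \<mu> (\<lambda>z. c * f z) = ennreal ((cmod c)\<^sup>2) * besov_sqnorm N \<mu> f"
  unfolding besov_sqnorm_def coeff_energy_cmult[OF f]
  by (subst ennreal_suminf_cmult[symmetric]) (simp add: mult_ac)

section \<open>Dilations, averages and bounded multipliers\<close>

lemma suminf_dominated_tendsto_0:
  fixes u :: "nat \<Rightarrow> nat \<Rightarrow> ennreal"
  assumes le: "\<And>n k. u n k \<le> w k" and w: "(\<Sum>k. w k) < \<infinity>" and lim: "\<And>k. (\<lambda>n. u n k) \<longlonglongrightarrow> 0"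
  shows "(\<lambda>n. \<Sum>k. u n k) \<longlonglongrightarrow> 0"
proof -
  have "(\<lambda>n. \<integral>\<^sup>+k. u n k \<partial>count_space UNIV) \<longlonglongrightarrow> (\<integral>\<^sup>+k. 0 \<partial>count_space (UNIV :: nat set))"
    using w by (intro nn_integral_dominated_convergence[where w = w] AE_I2 le lim)
      (auto simp: nn_integral_count_space_nat)
  then show ?thesis by (simp add: nn_integral_count_space_nat)
qed

text \<open>
  Dilation by \<open>s\<close> multiplies the coefficient of order \<open>k\<close> by \<open>s\<^sup>k\<close>, so the squared norm of the
  difference is dominated termwise by that of \<open>f\<close>.
\<close>

lemma dilate_tendsto_besov:
  assumes f: "f \<in> hol_ball" and fin: "besov_sqnorm N \<mu> f < \<infinity>" and e: "\<epsilon> > 0"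
  shows "\<exists>s. 0 < s \<and> s < 1 \<and> besov_sqnorm N \<mu> (\<lambda>z. f (s *\<^sub>R z) - f z) < \<epsilon>"
proof -
  obtain s :: "nat \<Rightarrow> real" where s': "\<And>n. 1/2 \<le> s n" "\<And>n. s n < 1" and "incseq s" and slim: "s \<longlonglongrightarrow> 1"
    by (rule exists_sequence_to_one) (rule that)
  have s: "0 < s n" "s n < 1" for n using s'[of n] by auto
  let ?a = "\<lambda>k. besov_weight N \<mu> k * coeff_energy f k"
  have fink: "?a k < \<infinity>" for k
    using fin sum_le_suminf[of ?a "{k}"] by (auto simp: besov_sqnorm_def intro: le_less_trans)
  have "(\<lambda>n. \<Sum>k. ennreal ((1 - s n ^ k)\<^sup>2) * ?a k) \<longlonglongrightarrow> 0"
  proof (rule suminf_dominated_tendsto_0[where w = ?a])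
    show "(\<Sum>k. ?a k) < \<infinity>" using fin by (simp add: besov_sqnorm_def)
    show "ennreal ((1 - s n ^ k)\<^sup>2) * ?a k \<le> ?a k" for n k
    proof -
      have "0 \<le> s n ^ k" "s n ^ k \<le> 1" using s[of n] by (auto intro!: power_le_one)
      then have "(1 - s n ^ k)\<^sup>2 \<le> 1" by (intro power_le_one) auto
      then have "ennreal ((1 - s n ^ k)\<^sup>2) \<le> 1" by simp
      from mult_right_mono[OF this, of "?a k"] show ?thesis by simp
    qed
    show "(\<lambda>n. ennreal ((1 - s n ^ k)\<^sup>2) * ?a k) \<longlonglongrightarrow> 0" for k
    proof -
      have "(\<lambda>n. ennreal ((1 - s n ^ k)\<^sup>2)) \<longlonglongrightarrow> ennreal ((1 - 1 ^ k)\<^sup>2)"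
        by (intro tendsto_intros slim)
      then have "(\<lambda>n. ?a k * ennreal ((1 - s n ^ k)\<^sup>2)) \<longlonglongrightarrow> ?a k * 0"
        using fink[of k] by (intro ennreal_tendsto_cmult) auto
      then show ?thesis by (simp add: mult.commute)
    qed
  qed
  from order_tendstoD(2)[OF this e]
  obtain n where n: "(\<Sum>k. ennreal ((1 - s n ^ k)\<^sup>2) * ?a k) < \<epsilon>"
    unfolding eventually_sequentially by blast
  have "besov_sqnorm N \<mu> (\<lambda>z. f (s n *\<^sub>R z) - f z) = (\<Sum>k. ennreal ((1 - s n ^ k)\<^sup>2) * ?a k)"
    unfolding besov_sqnorm_def using s[of n]
    by (intro suminf_cong) (simp add: coeff_energy_dilate_diff[OF f] mult_ac)
  then show ?thesis using n s[of n] by metis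
qed

text \<open>
  Write \<open>a\<^sub>k\<close> and \<open>b\<^sub>k\<close> for the terms of the squared norms of \<open>S\<close> and \<open>e n\<close>.  Using the inequality for
  sums in one order or the other, the terms for \<open>S + e n\<close> are at most
  \<open>a\<^sub>k + b\<^sub>k + \<delta> (a\<^sub>k + b\<^sub>k) + min(a\<^sub>k, b\<^sub>k) / \<delta>\<close>.  The minimum is dominated by \<open>a\<^sub>k\<close> and tends to
  0 for each \<open>k\<close>, so its sum tends to 0.
\<close>

lemma besov_sqnorm_almost_orthogonal:
  assumes S: "S \<in> hol_ball" "besov_sqnorm N \<mu> S < \<infinity>" and e: "\<And>n. e n \<in> hol_ball"
    and w: "\<And>k. besov_weight N \<mu> k < \<infinity>"
    and C: "\<And>n. besov_sqnorm N \<mu> (e n) \<le> ennreal C" and lim: "\<And>k. (\<lambda>n. coeff_energy (e n) k) \<longlonglongrightarrow> 0"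
  shows "\<exists>n. besov_sqnorm N \<mu> (\<lambda>z. S z + e n z) \<le> besov_sqnorm N \<mu> S + ennreal C + 1"
proof -
  let ?W = "besov_weight N \<mu>" and ?Q = "besov_sqnorm N \<mu>"
  define a where "a k = ?W k * coeff_energy S k" for k
  define b where "b n k = ?W k * coeff_energy (e n) k" for n k
  obtain q where q: "?Q S = ennreal q" "q \<ge> 0" using S(2) by (cases "?Q S") auto
  \<comment> \<open>\<open>\<delta>\<close> makes the two error terms at most \<open>1/2\<close> each: \<open>\<delta> (q + C) \<le> 1/2\<close>, and the sum of the minima is below \<open>\<delta>/2\<close>\<close>
  define \<delta> where "\<delta> = 1 / (2 * (q + max C 0 + 1))"
  have d: "\<delta> > 0" using q by (auto simp: \<delta>_def)
  have dq: "\<delta> * (q + max C 0) \<le> 1 / 2" using q by (simp add: \<delta>_def field_simps)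
  have Cm: "ennreal C = ennreal (max C 0)" by (cases "C \<ge> 0") (auto simp: max_def ennreal_neg)
  have fina: "a k < \<infinity>" for k
    using coeff_energy_finite[OF S(1), of k] w[of k] by (simp add: a_def ennreal_mult_less_top)
  have minlim: "(\<lambda>n. \<Sum>k. min (a k) (b n k)) \<longlonglongrightarrow> 0"
  proof (rule suminf_dominated_tendsto_0[where w = a])
    show "(\<Sum>k. a k) < \<infinity>" using S(2) by (simp add: besov_sqnorm_def a_def)
    show "(\<lambda>n. min (a k) (b n k)) \<longlonglongrightarrow> 0" for k
    proof -
      have "(\<lambda>n. b n k) \<longlonglongrightarrow> ?W k * 0"
        unfolding b_def using w[of k] by (intro ennreal_tendsto_cmult lim) auto
      then have "(\<lambda>n. min (a k) (b n k)) \<longlonglongrightarrow> min (a k) 0"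
        by (intro tendsto_min) auto
      then show ?thesis by simp
    qed
  qed auto
  have "ennreal (\<delta> / 2) > 0" using d by simp
  from order_tendstoD(2)[OF minlim this]
  obtain n where n: "(\<Sum>k. min (a k) (b n k)) < ennreal (\<delta> / 2)"
    unfolding eventually_sequentially by blast
  have le_term: "?W k * coeff_energy (\<lambda>z. S z + e n z) k
      \<le> a k + b n k + ennreal \<delta> * (a k + b n k) + ennreal (1 / \<delta>) * min (a k) (b n k)" for k
  proof -
    have "?W k * coeff_energy (\<lambda>z. S z + e n z) k
        \<le> ?W k * (ennreal (1 + \<delta>) * coeff_energy S k + ennreal (1 + 1 / \<delta>) * coeff_energy (e n) k)"
      using coeff_energy_add_le[OF S(1) e d] by (intro mult_left_mono) auto
    also have "\<dots> = ennreal (1 + \<delta>) * a k + ennreal (1 + 1 / \<delta>) * b n k"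
      by (simp add: a_def b_def distrib_left mult_ac)
    also have "\<dots> = a k + b n k + ennreal \<delta> * a k + ennreal (1 / \<delta>) * b n k"
      using d by (simp add: ennreal_plus distrib_right add_ac)
    finally have 1: "?W k * coeff_energy (\<lambda>z. S z + e n z) k \<le> a k + b n k + ennreal \<delta> * a k + ennreal (1 / \<delta>) * b n k" .
    have comm: "(\<lambda>z. S z + e n z) = (\<lambda>z. e n z + S z)" by (simp add: add.commute)
    have "?W k * coeff_energy (\<lambda>z. S z + e n z) k
        \<le> ?W k * (ennreal (1 + \<delta>) * coeff_energy (e n) k + ennreal (1 + 1 / \<delta>) * coeff_energy S k)"
      unfolding comm using coeff_energy_add_le[OF e S(1) d] by (intro mult_left_mono) auto
    also have "\<dots> = ennreal (1 + \<delta>) * b n k + ennreal (1 + 1 / \<delta>) * a k"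
      by (simp add: a_def b_def distrib_left mult_ac)
    also have "\<dots> = a k + b n k + ennreal \<delta> * b n k + ennreal (1 / \<delta>) * a k"
      using d by (simp add: ennreal_plus distrib_right add_ac)
    finally have 2: "?W k * coeff_energy (\<lambda>z. S z + e n z) k \<le> a k + b n k + ennreal \<delta> * b n k + ennreal (1 / \<delta>) * a k" .
    show ?thesis
    proof (cases "a k \<le> b n k")
      case True
      then show ?thesis
        by (intro order_trans[OF 2] add_mono mult_left_mono) (auto simp: min_def intro: order_trans)
    next
      case False
      then show ?thesis
        by (intro order_trans[OF 1] add_mono mult_left_mono) (auto simp: min_def intro: order_trans)
    qed
  qed
  have sumb: "(\<Sum>k. b n k) = ?Q (e n)" and suma: "(\<Sum>k. a k) = ?Q S"
    by (simp_all add: besov_sqnorm_def a_def b_def)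
  have "?Q (\<lambda>z. S z + e n z)
      \<le> (\<Sum>k. a k + b n k + ennreal \<delta> * (a k + b n k) + ennreal (1 / \<delta>) * min (a k) (b n k))"
    unfolding besov_sqnorm_def by (intro suminf_le le_term) auto
  also have "\<dots> = ?Q S + ?Q (e n) + ennreal \<delta> * (?Q S + ?Q (e n)) + ennreal (1 / \<delta>) * (\<Sum>k. min (a k) (b n k))"
    by (simp add: suminf_add[symmetric] ennreal_suminf_cmult suma sumb)
  also have "\<dots> \<le> ?Q S + ennreal C + ennreal \<delta> * (?Q S + ennreal C) + ennreal (1 / \<delta>) * ennreal (\<delta> / 2)"
    using n C[of n] by (intro add_mono mult_left_mono) auto
  also have "ennreal (1 / \<delta>) * ennreal (\<delta> / 2) = ennreal (1 / 2)"
    using d by (subst ennreal_mult[symmetric]) auto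
  also have "ennreal \<delta> * (?Q S + ennreal C) = ennreal (\<delta> * (q + max C 0))"
    unfolding q(1) Cm using q(2) d by (subst ennreal_plus[symmetric]) (auto simp: ennreal_mult)
  also have "?Q S + ennreal C + ennreal (\<delta> * (q + max C 0)) + ennreal (1 / 2)
      \<le> ?Q S + ennreal C + ennreal (1 / 2) + ennreal (1 / 2)"
    using dq by (intro add_mono ennreal_leI) auto
  also have "\<dots> = ?Q S + ennreal C + 1"
  proof -
    have "ennreal (1 / 2) + ennreal (1 / 2) = ennreal (1 / 2 + 1 / 2)"
      by (rule ennreal_plus[symmetric]) auto
    then show ?thesis by (simp only: add.assoc) simp
  qed
  finally show ?thesis by blast
qed

text \<open>
  By almost orthogonality the members of the sequence can be chosen one after another so that each
  adds at most \<open>C + 1\<close> to the squared norm of the sum.  Dividing the sum of \<open>m\<close> members by \<open>m\<close> leaves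
  at most \<open>(C + 1) / m\<close>.
\<close>

lemma averages_tendsto_0_besov:
  assumes e: "\<And>n. e n \<in> hol_ball" and w: "\<And>k. besov_weight N \<mu> k < \<infinity>"
    and C: "\<And>n. besov_sqnorm N \<mu> (e n) \<le> ennreal C" and lim: "\<And>k. (\<lambda>n. coeff_energy (e n) k) \<longlonglongrightarrow> 0"
    and \<epsilon>: "\<epsilon> > 0"
  shows "\<exists>ns. ns \<noteq> [] \<and> besov_sqnorm N \<mu> (\<lambda>z. 1 / of_nat (length ns) * (\<Sum>n\<leftarrow>ns. e n z)) < ennreal \<epsilon>"
proof -
  define C' where "C' = max C 0"
  have C': "C' \<ge> 0" "ennreal C = ennreal C'"
    by (auto simp: C'_def max_def ennreal_neg)
  have sum_hol: "(\<lambda>z. \<Sum>n\<leftarrow>ns. e n z) \<in> hol_ball" for ns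
    by (induction ns) (auto intro!: hol_ball_const hol_ball_add e)
  have ind: "\<exists>ns. length ns = m \<and> besov_sqnorm N \<mu> (\<lambda>z. \<Sum>n\<leftarrow>ns. e n z) \<le> ennreal (real m * (C' + 1))" for m
  proof (induction m)
    case 0
    have "besov_sqnorm N \<mu> (\<lambda>z. 0) = 0"
      using besov_sqnorm_cmult[OF hol_ball_const, of N \<mu> 0 0] by simp
    then show ?case by simp
  next
    case (Suc m)
    then obtain ns where ns: "length ns = m"
      "besov_sqnorm N \<mu> (\<lambda>z. \<Sum>n\<leftarrow>ns. e n z) \<le> ennreal (real m * (C' + 1))" by blast
    have "besov_sqnorm N \<mu> (\<lambda>z. \<Sum>n\<leftarrow>ns. e n z) < \<infinity>"
      using ns(2) by (rule le_less_trans) simp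
    from besov_sqnorm_almost_orthogonal[OF sum_hol this e w C lim]
    obtain n where n: "besov_sqnorm N \<mu> (\<lambda>z. (\<Sum>n\<leftarrow>ns. e n z) + e n z)
        \<le> besov_sqnorm N \<mu> (\<lambda>z. \<Sum>n\<leftarrow>ns. e n z) + ennreal C + 1" by blast
    also have "\<dots> \<le> ennreal (real m * (C' + 1)) + ennreal C' + ennreal 1"
      using ns(2) C' by (intro add_mono) auto
    also have "\<dots> = ennreal (real (Suc m) * (C' + 1))"
      using C' by (subst ennreal_plus[symmetric]; (subst ennreal_plus[symmetric])?) (auto simp: algebra_simps)
    finally show ?case
      using ns(1) by (intro exI[of _ "n # ns"]) (simp add: add.commute)
  qed
  obtain m where m: "real m > (C' + 1) / \<epsilon>" using reals_Archimedean2 by blast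
  have m0: "m > 0" using m C' \<epsilon> by (cases m) (auto simp: field_simps)
  from ind[of m] obtain ns where ns: "length ns = m"
    "besov_sqnorm N \<mu> (\<lambda>z. \<Sum>n\<leftarrow>ns. e n z) \<le> ennreal (real m * (C' + 1))" by blast
  have "besov_sqnorm N \<mu> (\<lambda>z. 1 / of_nat (length ns) * (\<Sum>n\<leftarrow>ns. e n z))
      = ennreal ((1 / real m)\<^sup>2) * besov_sqnorm N \<mu> (\<lambda>z. \<Sum>n\<leftarrow>ns. e n z)"
    unfolding besov_sqnorm_cmult[OF sum_hol] ns(1) by (simp add: norm_divide power_divide)
  also have "\<dots> \<le> ennreal ((1 / real m)\<^sup>2) * ennreal (real m * (C' + 1))"
    by (intro mult_left_mono ns) auto
  also have "\<dots> = ennreal ((C' + 1) / real m)"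
    using C' m0 by (subst ennreal_mult[symmetric]) (auto simp: power2_eq_square)
  also have "\<dots> < ennreal \<epsilon>"
    using m m0 \<epsilon> C' by (intro ennreal_lessI) (auto simp: field_simps)
  finally show ?thesis using ns(1) m0 by (intro exI[of _ ns]) auto
qed

definition smooth_multiplier :: "nat \<Rightarrow> (complex ^ 'd::finite \<Rightarrow> complex) \<Rightarrow> bool" where
  "smooth_multiplier N \<psi> \<longleftrightarrow> \<psi> \<in> hol_ball \<and>
     (\<exists>A. \<forall>k\<le>N. \<forall>z. norm z < 1 \<longrightarrow> cmod ((radial_deriv ^^ k) \<psi> z) \<le> A)"

text \<open>
  Leibniz' rule expresses the derivative of order \<open>N\<close> of the product through derivatives of \<open>f\<close> of order
  at most \<open>N\<close>, all of which are bounded by the Besov norm.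
\<close>

lemma smooth_multiplier_bounded:
  fixes \<psi> :: "complex ^ 'd::finite \<Rightarrow> complex"
  assumes \<psi>: "smooth_multiplier N \<psi>" and \<mu>: "unit_interval_measure \<mu>" and N: "N \<ge> 1"
  shows "\<exists>C>0. \<forall>f\<in>hol_ball. besov_sqnorm N \<mu> (\<lambda>z. \<psi> z * f z) \<le> ennreal C * besov_sqnorm N \<mu> f"
proof -
  obtain A0 where A0: "\<And>k z. k \<le> N \<Longrightarrow> norm z < 1 \<Longrightarrow> cmod ((radial_deriv ^^ k) \<psi> z) \<le> A0"
    and hol: "\<psi> \<in> hol_ball" using \<psi> by (auto simp: smooth_multiplier_def)
  have "0 \<le> cmod ((radial_deriv ^^ 0) \<psi> 0)" by simp
  also have "\<dots> \<le> A0" by (intro A0) auto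
  finally have A00: "A0 \<ge> 0" .
  define A where "A = 2 ^ N * A0"
  define K where "K = A\<^sup>2 * real (Suc N)"
  have K0: "K \<ge> 0" by (simp add: K_def)
  have main: "besov_sqnorm N \<mu> (\<lambda>z. \<psi> z * f z) \<le> ennreal (A0\<^sup>2 + K * real (Suc N) + 1) * besov_sqnorm N \<mu> f"
    if f: "f \<in> hol_ball" for f
  proof -
    have pf: "(\<lambda>z. \<psi> z * f z) \<in> hol_ball" by (intro hol_ball_mult hol f)
    have "L2_sqnorm \<mu> ((radial_deriv ^^ N) (\<lambda>z. \<psi> z * f z))
        \<le> ennreal K * (\<Sum>i\<in>{..N}. L2_sqnorm \<mu> ((radial_deriv ^^ (N - i)) f))"
    proof (rule L2_sqnorm_le_sum)
      fix z :: "complex ^ 'd" assume z: "norm z < 1"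
      let ?g = "\<lambda>i. cmod ((radial_deriv ^^ (N - i)) f z)"
      have "cmod ((radial_deriv ^^ N) (\<lambda>z. \<psi> z * f z) z) \<le> (\<Sum>i\<le>N. A * ?g i)"
        unfolding radial_deriv_pow_mult[OF hol f z]
      proof (intro order_trans[OF norm_sum] sum_mono)
        fix i assume i: "i \<in> {..N}"
        have "real (N choose i) * cmod ((radial_deriv ^^ i) \<psi> z) \<le> real (2 ^ N) * A0"
          using i A0[of i z] z binomial_le_pow2[of N i] by (intro mult_mono) (auto simp del: of_nat_power of_nat_numeral)
        then show "cmod (of_nat (N choose i) * (radial_deriv ^^ i) \<psi> z * (radial_deriv ^^ (N - i)) f z) \<le> A * ?g i"
          unfolding norm_mult A_def by (intro mult_right_mono) auto
      qed
      also have "\<dots> = A * (\<Sum>i\<le>N. ?g i)" by (simp add: sum_distrib_left)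
      finally have "(cmod ((radial_deriv ^^ N) (\<lambda>z. \<psi> z * f z) z))\<^sup>2 \<le> (A * (\<Sum>i\<le>N. ?g i))\<^sup>2"
        by (intro power_mono) auto
      also have "\<dots> = A\<^sup>2 * (\<Sum>i\<le>N. ?g i)\<^sup>2" by (simp add: power_mult_distrib)
      also have "(\<Sum>i\<le>N. ?g i)\<^sup>2 \<le> real (Suc N) * (\<Sum>i\<le>N. (?g i)\<^sup>2)"
        using sum_squared_le_sum_of_squares[of "?g" "{..N}"] by (simp add: mult.commute)
      finally show "(cmod ((radial_deriv ^^ N) (\<lambda>z. \<psi> z * f z) z))\<^sup>2 \<le> K * (\<Sum>i\<in>{..N}. (?g i)\<^sup>2)"
        by (simp add: K_def mult.assoc mult_left_mono)
    qed (auto intro!: radial_deriv_pow_hol_ball pf f K0)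
    also have "(\<Sum>i\<in>{..N}. L2_sqnorm \<mu> ((radial_deriv ^^ (N - i)) f)) \<le> (\<Sum>i\<in>{..N}. besov_sqnorm N \<mu> f)"
      by (intro sum_mono L2_sqnorm_radial_deriv_pow_le \<mu> f) auto
    also have "\<dots> = ennreal (real (Suc N)) * besov_sqnorm N \<mu> f"
      by (simp add: ennreal_of_nat_eq_real_of_nat)
    finally have 1: "L2_sqnorm \<mu> ((radial_deriv ^^ N) (\<lambda>z. \<psi> z * f z))
        \<le> ennreal (K * real (Suc N)) * besov_sqnorm N \<mu> f"
      using K0 by (simp add: mult_left_mono ennreal_mult mult.assoc)
    have "(cmod (\<psi> 0 * f 0))\<^sup>2 \<le> A0\<^sup>2 * (cmod (f 0))\<^sup>2"
      using A0[of 0 0] by (auto simp: norm_mult power_mult_distrib intro!: mult_right_mono power_mono)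
    then have "ennreal ((cmod (\<psi> 0 * f 0))\<^sup>2) \<le> ennreal (A0\<^sup>2) * ennreal ((cmod (f 0))\<^sup>2)"
      by (subst ennreal_mult[symmetric]) (auto intro: ennreal_leI)
    then have "emeasure \<mu> {0..1} * ennreal ((cmod (\<psi> 0 * f 0))\<^sup>2)
        \<le> emeasure \<mu> {0..1} * (ennreal (A0\<^sup>2) * ennreal ((cmod (f 0))\<^sup>2))"
      by (rule mult_left_mono) simp
    also have "\<dots> = ennreal (A0\<^sup>2) * (emeasure \<mu> {0..1} * ennreal ((cmod (f 0))\<^sup>2))"
      by (simp add: mult_ac)
    also have "\<dots> \<le> ennreal (A0\<^sup>2) * besov_sqnorm N \<mu> f"
      unfolding besov_sqnorm_eq[OF \<mu> f N] by (intro mult_left_mono) auto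
    finally have "besov_sqnorm N \<mu> (\<lambda>z. \<psi> z * f z)
        \<le> ennreal (A0\<^sup>2) * besov_sqnorm N \<mu> f + ennreal (K * real (Suc N)) * besov_sqnorm N \<mu> f"
      unfolding besov_sqnorm_eq[OF \<mu> pf N] using 1 by (rule add_mono)
    also have "\<dots> = ennreal (A0\<^sup>2 + K * real (Suc N)) * besov_sqnorm N \<mu> f"
      using K0 by (simp add: ennreal_plus distrib_right)
    also have "\<dots> \<le> ennreal (A0\<^sup>2 + K * real (Suc N) + 1) * besov_sqnorm N \<mu> f"
      by (intro mult_right_mono ennreal_leI) auto
    finally show ?thesis .
  qed
  have "A0\<^sup>2 + K * real (Suc N) + 1 > 0" using K0 by (intro add_nonneg_pos) auto
  then show ?thesis using main by blast
qed

lemma smooth_multiplier_Mult: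
  fixes \<psi> :: "complex ^ 'd::finite \<Rightarrow> complex"
  assumes \<psi>: "smooth_multiplier N \<psi>" and \<mu>: "unit_interval_measure \<mu>" "finite_measure \<mu>" and N: "N \<ge> 1"
  shows "\<psi> \<in> Mult (besov_space N \<mu>)"
proof -
  obtain C where C: "C > 0" "\<And>f. f \<in> hol_ball \<Longrightarrow> besov_sqnorm N \<mu> (\<lambda>z. \<psi> z * f z) \<le> ennreal C * besov_sqnorm N \<mu> f"
    using smooth_multiplier_bounded[OF \<psi> \<mu>(1) N] by blast
  have hol: "\<psi> \<in> hol_ball" using \<psi> by (simp add: smooth_multiplier_def)
  show ?thesis
    unfolding Mult_def
  proof (intro CollectI ballI)
    fix f :: "complex ^ 'd \<Rightarrow> complex" assume "f \<in> besov_space N \<mu>"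
    then have f: "f \<in> hol_ball" "besov_sqnorm N \<mu> f < \<infinity>" by (auto simp: besov_space_iff[OF \<mu> N])
    have "ennreal C * besov_sqnorm N \<mu> f < \<infinity>" using f(2) by (simp add: ennreal_mult_less_top)
    then show "(\<lambda>z. \<psi> z * f z) \<in> besov_space N \<mu>"
      using C(2)[OF f(1)] hol f(1) by (auto simp: besov_space_iff[OF \<mu> N] intro: hol_ball_mult le_less_trans)
  qed
qed

text \<open>
  The derivatives of a dilate are dilates of derivatives, hence only see a compact part of the ball.
\<close>

lemma smooth_multiplier_dilate:
  assumes f: "f \<in> hol_ball" and s: "0 \<le> s" "s < 1"
  shows "smooth_multiplier N (\<lambda>z. f (s *\<^sub>R z))"
proof -
  have "\<exists>B. \<forall>z. norm z < 1 \<longrightarrow> cmod ((radial_deriv ^^ k) (\<lambda>z. f (s *\<^sub>R z)) z) \<le> B" for k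
  proof -
    obtain B where B: "\<And>z. norm z \<le> s \<Longrightarrow> cmod ((radial_deriv ^^ k) f z) \<le> B"
      using hol_ball_bounded[OF radial_deriv_pow_hol_ball[OF f] s(2)] by blast
    have "cmod ((radial_deriv ^^ k) (\<lambda>z. f (s *\<^sub>R z)) z) \<le> B" if "norm z < 1" for z
    proof -
      have "norm (s *\<^sub>R z) \<le> s" using that s by (simp add: mult_left_le)
      then show ?thesis using radial_deriv_pow_dilate[OF f, of s z k] s that B by simp
    qed
    then show ?thesis by blast
  qed
  then obtain B where B: "\<And>k z. norm z < 1 \<Longrightarrow> cmod ((radial_deriv ^^ k) (\<lambda>z. f (s *\<^sub>R z)) z) \<le> B k"
    by metis
  have B0: "B k \<ge> 0" for k using B[of 0 k] norm_ge_zero by (rule order_trans[rotated]) simp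
  have "cmod ((radial_deriv ^^ k) (\<lambda>z. f (s *\<^sub>R z)) z) \<le> (\<Sum>k\<le>N. B k)" if "k \<le> N" "norm z < 1" for k z
  proof -
    have "B k \<le> (\<Sum>k\<le>N. B k)" using that B0 by (intro member_le_sum) auto
    then show ?thesis using B[OF that(2), of k] by linarith
  qed
  moreover have "(\<lambda>z. f (s *\<^sub>R z)) \<in> hol_ball" using s by (intro hol_ball_dilate f) auto
  ultimately show ?thesis unfolding smooth_multiplier_def by blast
qed

section \<open>Quotients of a stable polynomial by its dilates\<close>

lemma polynomials_scale_hol_ball:
  assumes "p \<in> polynomials"
  shows "(\<lambda>z. p (r *\<^sub>R z)) \<in> hol_ball"
proof -
  obtain A :: "('a \<Rightarrow> nat) set" and c where p: "p = (\<lambda>z. \<Sum>\<alpha>\<in>A. c \<alpha> * (\<Prod>j\<in>UNIV. (z $ j) ^ \<alpha> j))"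
    using assms by (auto simp: polynomials_def)
  have "(\<lambda>z :: complex ^ 'a. (r *\<^sub>R z) $ j) \<in> hol_ball" for j
  proof -
    have "(\<lambda>z :: complex ^ 'a. (r *\<^sub>R z) $ j) = (\<lambda>z. of_real r * z $ j)"
      by (rule ext) (simp only: scaleR_eq_vector_scalar_mult vector_smult_component)
    then show ?thesis using hol_ball_cmult[OF hol_ball_coord, of "of_real r" j] by simp
  qed
  then show ?thesis
    unfolding p by (intro hol_ball_sum hol_ball_cmult hol_ball_prod hol_ball_power)
qed

lemma polynomials_hol_ball: "p \<in> polynomials \<Longrightarrow> p \<in> hol_ball"
  using polynomials_scale_hol_ball[of p 1] by simp

text \<open>
  A polynomial is the dilate by \<open>1/2\<close> of the polynomial \<open>z \<mapsto> p(2 z)\<close>.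
\<close>

lemma polynomials_smooth_multiplier:
  assumes "p \<in> polynomials"
  shows "smooth_multiplier N p"
  using smooth_multiplier_dilate[OF polynomials_scale_hol_ball[OF assms, of 2], of "1/2" N] by simp

lemma polynomials_power_smooth_multiplier:
  assumes "p \<in> polynomials"
  shows "smooth_multiplier N (\<lambda>z. p z ^ m)"
  using smooth_multiplier_dilate[OF hol_ball_power[OF polynomials_scale_hol_ball[OF assms, of 2]], of "1/2" N m] by simp

lemma polynomials_slice:
  assumes "p \<in> polynomials"
  shows "\<exists>n. \<forall>w. \<exists>P :: complex poly. degree P \<le> n \<and> (\<forall>x. p (x *s w) = poly P x)"
proof -
  obtain A :: "('a \<Rightarrow> nat) set" and c where A: "finite A" and
    p: "p = (\<lambda>z. \<Sum>\<alpha>\<in>A. c \<alpha> * (\<Prod>j\<in>UNIV. (z $ j) ^ \<alpha> j))"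
    using assms by (auto simp: polynomials_def)
  define n where "n = (\<Sum>\<alpha>\<in>A. \<Sum>j\<in>UNIV. \<alpha> j)"
  show ?thesis
  proof (intro exI[of _ n] allI)
    fix w :: "complex ^ 'a"
    define P where "P = (\<Sum>\<alpha>\<in>A. monom (c \<alpha> * (\<Prod>j\<in>UNIV. (w $ j) ^ \<alpha> j)) (\<Sum>j\<in>UNIV. \<alpha> j))"
    have "degree P \<le> n"
      unfolding P_def
    proof (intro degree_sum_le A order_trans[OF degree_monom_le])
      fix \<alpha> assume "\<alpha> \<in> A"
      then show "(\<Sum>j\<in>UNIV. \<alpha> j) \<le> n" unfolding n_def using A by (intro member_le_sum) auto
    qed
    moreover have "p (x *s w) = poly P x" for x
      by (simp add: p P_def poly_sum poly_monom power_mult_distrib prod.distrib power_sum mult_ac)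
    ultimately show "\<exists>P. degree P \<le> n \<and> (\<forall>x. p (x *s w) = poly P x)" by blast
  qed
qed

text \<open>
  The numbers \<open>a i\<close> are the inverses of the roots.  Padding with zeros lets the number of factors depend
  only on the degree bound, which is uniform over all lines, and not on the line.
\<close>

lemma poly_factor_no_zero_in_disc:
  fixes P :: "complex poly"
  assumes "degree P \<le> n" "\<And>x. x \<in> ball 0 1 \<Longrightarrow> poly P x \<noteq> 0"
  shows "\<exists>a. (\<forall>i. cmod (a i) \<le> 1) \<and> (\<forall>x. poly P x = poly P 0 * (\<Prod>i<n. 1 - a i * x))"
  using assms
proof (induction n arbitrary: P)
  case 0
  then obtain c where "P = [:c:]" by (auto elim: degree_eq_zeroE)
  then show ?case by (intro exI[of _ "\<lambda>_. 0"]) simp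
next
  case (Suc n)
  show ?case
  proof (cases "degree P = 0")
    case True
    then obtain c where "P = [:c:]" by (auto elim: degree_eq_zeroE)
    then show ?thesis by (intro exI[of _ "\<lambda>_. 0"]) simp
  next
    case False
    then have "\<exists>i\<in>{1..degree P}. coeff P i \<noteq> 0"
      by (intro bexI[of _ "degree P"]) auto
    then obtain z where "(\<Sum>i\<le>degree P. coeff P i * z ^ i) = 0"
      using fundamental_theorem_of_algebra[of "coeff P" "degree P"] by blast
    then have z: "poly P z = 0" by (simp add: poly_altdef)
    then have z1: "cmod z \<ge> 1" using Suc.prems(2)[of z] by force
    then have z0: "z \<noteq> 0" by auto
    obtain Q where Q: "P = [:- z, 1:] * Q" using z by (auto simp: poly_eq_0_iff_dvd elim: dvdE)
    define Q' where "Q' = smult (- z) Q"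
    have Qnz: "Q \<noteq> 0" using Q False by auto
    have "degree P = Suc (degree Q)" unfolding Q by (subst degree_mult_eq) (use Qnz in auto)
    then have dQ: "degree Q' \<le> n" using Suc.prems(1) by (simp add: Q'_def)
    have PQ: "poly P x = (1 - 1 / z * x) * poly Q' x" for x
      using z0 by (simp add: Q Q'_def field_simps)
    have "poly Q' x \<noteq> 0" if "x \<in> ball 0 1" for x
      using Suc.prems(2)[OF that] PQ by auto
    from Suc.IH[OF dQ this] obtain a where a: "\<And>i. cmod (a i) \<le> 1"
      "\<And>x. poly Q' x = poly Q' 0 * (\<Prod>i<n. 1 - a i * x)" by blast
    define b where "b i = (if i = n then 1 / z else a i)" for i
    have "1 / cmod z \<le> 1" using z1 by (subst divide_le_eq_1_pos) auto
    then have "cmod (b i) \<le> 1" for i using a(1) by (auto simp: b_def norm_divide)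
    moreover have "poly P x = poly P 0 * (\<Prod>i<Suc n. 1 - b i * x)" for x
    proof -
      have "(\<Prod>i<n. 1 - b i * x) = (\<Prod>i<n. 1 - a i * x)" by (intro prod.cong) (auto simp: b_def)
      then show ?thesis using PQ[of x] PQ[of 0] a(2)[of x] by (simp add: b_def mult_ac)
    qed
    ultimately show ?thesis by blast
  qed
qed

definition dilated_quotient :: "nat \<Rightarrow> (complex ^ 'd::finite \<Rightarrow> complex) \<Rightarrow> real \<Rightarrow> complex ^ 'd \<Rightarrow> complex" where
  "dilated_quotient M p r z = p z ^ M * inverse (p (r *\<^sub>R z))"

lemma stable_inverse_hol_ball:
  assumes "p \<in> stable_polynomials"
  shows "(\<lambda>z. inverse (p z)) \<in> hol_ball"
  using assms by (intro hol_ball_inverse polynomials_hol_ball) (auto simp: stable_polynomials_def)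

lemma dilated_quotient_hol_ball:
  assumes "p \<in> stable_polynomials" "0 \<le> r" "r \<le> 1"
  shows "dilated_quotient M p r \<in> hol_ball"
proof -
  have "p \<in> hol_ball" using assms(1) by (auto simp: stable_polynomials_def polynomials_hol_ball)
  moreover have "(\<lambda>z. inverse (p (r *\<^sub>R z))) \<in> hol_ball"
    using hol_ball_dilate[OF stable_inverse_hol_ball[OF assms(1)], of r] assms by simp
  ultimately show ?thesis
    unfolding dilated_quotient_def[abs_def] by (intro hol_ball_mult hol_ball_power)
qed

text \<open>
  In the application the \<open>a i\<close> are the inverse roots of \<open>p\<close> on the line through \<open>w\<close>; they depend on the
  line, whereas \<open>n\<close> and \<open>B\<close> do not.
\<close>

definition slice_estimate ::
  "nat \<Rightarrow> (complex ^ 'd::finite \<Rightarrow> complex) \<Rightarrow> nat \<Rightarrow> real \<Rightarrow> complex ^ 'd \<Rightarrow> (nat \<Rightarrow> complex) \<Rightarrow> bool" where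
  "slice_estimate M p n B w a \<longleftrightarrow> (\<forall>r x. 1/2 \<le> r \<longrightarrow> r < 1 \<longrightarrow> x \<in> ball 0 1 \<longrightarrow>
      (\<forall>k<M. cmod ((radial_deriv ^^ k) (dilated_quotient M p r) (x *s w)) \<le> B) \<and>
      cmod ((radial_deriv ^^ M) (dilated_quotient M p r) (x *s w))
        \<le> B * (1 + (\<Sum>i<n. (1 - r) / (cmod (1 - of_real r * a i * x))\<^sup>2)))"

text \<open>
  On the line through \<open>w\<close> the quotient is the product over \<open>i < n\<close> of the functions
  \<open>(1 - a i x)\<^sup>M / (1 - r a i x)\<close>, up to the constant \<open>p(0)\<^sup>M / p(0)\<close>.  Each of them satisfies the jet bound
  with the sum \<open>\<Psi>\<close> of the individual majorants, and jet bounds are stable under products.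
\<close>

lemma dilated_quotient_bound:
  fixes p :: "complex ^ 'd::finite \<Rightarrow> complex"
  assumes p: "p \<in> stable_polynomials" and M: "M > 0"
  shows "\<exists>(n :: nat) B. B \<ge> 0 \<and> (\<forall>w. norm w \<le> 1 \<longrightarrow> (\<exists>a. (\<forall>i. cmod (a i) \<le> 1) \<and> slice_estimate M p n B w a))"
proof -
  have pp: "p \<in> polynomials" and nz: "\<And>z. norm z < 1 \<Longrightarrow> p z \<noteq> 0"
    using p by (auto simp: stable_polynomials_def)
  obtain n where n: "\<And>w. \<exists>P :: complex poly. degree P \<le> n \<and> (\<forall>x. p (x *s w) = poly P x)"
    using polynomials_slice[OF pp] by blast
  obtain B0 where B0: "B0 \<ge> 0" "\<And>r a x. 1/2 \<le> r \<Longrightarrow> r < 1 \<Longrightarrow> cmod a \<le> 1 \<Longrightarrow> x \<in> ball 0 1 \<Longrightarrow>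
     jet_bound M (1 + (1 - r) / (cmod (1 - of_real r * a * x))\<^sup>2) B0
       (\<lambda>y. (1 - a * y) ^ M / (1 - of_real r * a * y)) x"
    using jet_bound_linear_factor[OF M] by blast
  define c where "c = p 0 ^ M * inverse (p 0)"
  define B where "B = cmod c * (2 ^ M * B0) ^ n"
  have B: "B \<ge> 0" using B0(1) by (simp add: B_def)
  show ?thesis
  proof (intro exI[of _ n] exI[of _ B] conjI B allI impI)
    fix w :: "complex ^ 'd" assume w: "norm w \<le> 1"
    obtain P :: "complex poly" where P: "degree P \<le> n" "\<And>x. p (x *s w) = poly P x" using n by blast
    have "poly P x \<noteq> 0" if "x \<in> ball 0 1" for x
      using nz[of "x *s w"] ball_subset_slice_domain[OF w] that by (auto simp: P(2) slice_domain_def)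
    from poly_factor_no_zero_in_disc[OF P(1) this]
    obtain a where a: "\<And>i. cmod (a i) \<le> 1" "\<And>x. poly P x = poly P 0 * (\<Prod>i<n. 1 - a i * x)"
      by blast
    have P0: "poly P 0 = p 0" using P(2)[of 0] by simp
    have factored: "p (x *s w) = p 0 * (\<Prod>i<n. 1 - a i * x)" for x
      using a(2)[of x] by (simp add: P(2) P0)
    have "(\<forall>k<M. cmod ((radial_deriv ^^ k) (dilated_quotient M p r) (x *s w)) \<le> B) \<and>
      cmod ((radial_deriv ^^ M) (dilated_quotient M p r) (x *s w))
        \<le> B * (1 + (\<Sum>i<n. (1 - r) / (cmod (1 - of_real r * a i * x))\<^sup>2))"
      if r: "1/2 \<le> r" "r < 1" and x: "x \<in> ball 0 1" for r x
    proof -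
      define \<Psi> where "\<Psi> = 1 + (\<Sum>i<n. (1 - r) / (cmod (1 - of_real r * a i * x))\<^sup>2)"
      have \<Psi>1: "\<Psi> \<ge> 1" using r by (auto simp: \<Psi>_def intro!: sum_nonneg)
      let ?f = "\<lambda>i y. (1 - a i * y) ^ M / (1 - of_real r * a i * y)"
      have nzf: "1 - of_real r * a i * y \<noteq> 0" if "y \<in> ball 0 1" for i y
      proof -
        have "cmod (of_real r * a i * y) = r * (cmod (a i) * cmod y)" using r by (simp add: norm_mult)
        also have "\<dots> \<le> r * (1 * 1)" using a(1) that r by (intro mult_left_mono mult_mono) auto
        also have "\<dots> < 1" using r by simp
        finally show ?thesis by auto
      qed
      have holf: "?f i holomorphic_on ball 0 1" for i
        using nzf by (intro holomorphic_intros) auto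
      have jf: "jet_bound M \<Psi> B0 (?f i) x" if "i \<in> {..<n}" for i
      proof (rule jet_bound_mono[OF B0(2)[OF r a(1)[of i] x]])
        show "1 + (1 - r) / (cmod (1 - of_real r * a i * x))\<^sup>2 \<le> \<Psi>"
          unfolding \<Psi>_def using r that
          by (intro add_left_mono member_le_sum[of i "{..<n}" "\<lambda>i. (1 - r) / (cmod (1 - of_real r * a i * x))\<^sup>2"]) auto
      qed (use B0 r in auto)
      have "jet_bound M \<Psi> ((2 ^ M * B0) ^ card {..<n}) (\<lambda>y. \<Prod>i<n. ?f i y) x"
        by (rule jet_bound_prod[OF open_ball x \<Psi>1 B0(1) M]) (use jf holf in auto)
      then have j: "jet_bound M \<Psi> B (\<lambda>y. c * (\<Prod>i<n. ?f i y)) x"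
        unfolding B_def card_lessThan by (intro jet_bound_cmult[OF open_ball _ x] holomorphic_on_prod holf)
      have eq: "dilated_quotient M p r (y *s w) = c * (\<Prod>i<n. ?f i y)" for y
      proof -
        have "r *\<^sub>R (y *s w) = (of_real r * y) *s w"
          by (simp only: scaleR_eq_vector_scalar_mult vector_smult_assoc)
        then have "dilated_quotient M p r (y *s w)
            = (p 0 * (\<Prod>i<n. 1 - a i * y)) ^ M * inverse (p 0 * (\<Prod>i<n. 1 - a i * (of_real r * y)))"
          by (simp only: dilated_quotient_def factored)
        also have "\<dots> = c * (\<Prod>i<n. ?f i y)"
          by (simp add: c_def power_mult_distrib prod_power_distrib prod_dividef divide_inverse
              prod_inversef[symmetric] prod.distrib mult_ac)
        finally show ?thesis .
      qed
      have qh: "dilated_quotient M p r \<in> hol_ball" using r by (intro dilated_quotient_hol_ball p) auto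
      have xs: "x \<in> slice_domain w" using x ball_subset_slice_domain[OF w] by blast
      have "(radial_deriv ^^ k) (dilated_quotient M p r) (x *s w) = (euler ^^ k) (\<lambda>y. c * (\<Prod>i<n. ?f i y)) x" for k
        unfolding radial_deriv_pow_slice[OF qh xs] eq ..
      then show ?thesis using j unfolding jet_bound_def \<Psi>_def by simp
    qed
    then show "\<exists>a. (\<forall>i. cmod (a i) \<le> 1) \<and> slice_estimate M p n B w a"
      using a(1) unfolding slice_estimate_def by blast
  qed
qed

lemma dilated_quotient_uniform_bound:
  fixes p :: "complex ^ 'd::finite \<Rightarrow> complex"
  assumes p: "p \<in> stable_polynomials" and M: "M > 0"
  shows "\<exists>B\<ge>0. \<forall>r k z. 1/2 \<le> r \<longrightarrow> r < 1 \<longrightarrow> k < M \<longrightarrow> norm z < 1 \<longrightarrow>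
    cmod ((radial_deriv ^^ k) (dilated_quotient M p r) z) \<le> B"
proof -
  obtain n :: nat and B where B: "B \<ge> 0" "\<And>w. norm w \<le> 1 \<Longrightarrow> (\<exists>a. (\<forall>i. cmod (a i) \<le> 1) \<and> slice_estimate M p n B w a)"
    using dilated_quotient_bound[OF p M] by (elim exE conjE) blast
  have pt: "cmod ((radial_deriv ^^ k) (dilated_quotient M p r) (x *s w)) \<le> B"
    if "1/2 \<le> r" "r < 1" "k < M" "norm w \<le> 1" "x \<in> ball 0 1" for r k w x
    using B(2)[OF that(4)] that unfolding slice_estimate_def by blast
  have "cmod ((radial_deriv ^^ k) (dilated_quotient M p r) z) \<le> B"
    if r: "1/2 \<le> r" "r < 1" "k < M" and z: "norm z < 1" for r k z
  proof -
    have "norm z *\<^sub>R sgn z = z" by (cases "z = 0") (auto simp: sgn_div_norm)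
    then have "z = of_real (norm z) *s (sgn z)" by (simp add: scaleR_eq_vector_scalar_mult)
    moreover have "norm (sgn z) \<le> 1" "(of_real (norm z) :: complex) \<in> ball 0 1"
      using z by (auto simp: norm_sgn)
    ultimately show ?thesis using pt[OF r, of "sgn z" "of_real (norm z)"] by simp
  qed
  then show ?thesis using B(1) by blast
qed

text \<open>
  Two of the four powers are estimated by \<open>1 - q\<close>, the other two give the Poisson integral.
\<close>

lemma nn_integral_circle_fourth_power_le:
  assumes b: "cmod b \<le> q" and q: "q < 1"
  shows "(\<integral>\<^sup>+t\<in>{0..1}. ennreal (1 / (cmod (1 - b * cis (2 * pi * t))) ^ 4) \<partial>lborel) \<le> ennreal (1 / (1 - q) ^ 3)"
proof -
  have q0: "0 \<le> q" using b norm_ge_zero order_trans by blast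
  let ?d = "\<lambda>t. cmod (1 - b * cis (2 * pi * t))"
  have d: "?d t \<ge> 1 - q" for t
    using norm_triangle_ineq2[of 1 "b * cis (2 * pi * t)"] b by (simp add: norm_mult)
  have m [measurable]: "(\<lambda>t :: real. ennreal (1 / (?d t)\<^sup>2) * indicator {0..1} t) \<in> borel_measurable lborel"
  proof -
    have "?d t \<noteq> 0" for t using d[of t] q by auto
    then have "continuous_on UNIV (\<lambda>t. 1 / (?d t)\<^sup>2)" by (intro continuous_intros) auto
    then have [measurable]: "(\<lambda>t. 1 / (?d t)\<^sup>2) \<in> borel_measurable borel" by (rule borel_measurable_continuous_onI)
    show ?thesis by measurable
  qed
  have "(\<integral>\<^sup>+t\<in>{0..1}. ennreal (1 / ?d t ^ 4) \<partial>lborel)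
      \<le> (\<integral>\<^sup>+t. ennreal (1 / (1 - q)\<^sup>2) * (ennreal (1 / (?d t)\<^sup>2) * indicator {0..1} t) \<partial>lborel)"
  proof (rule nn_integral_mono)
    fix t
    have "1 / ?d t ^ 4 \<le> 1 / (1 - q)\<^sup>2 * (1 / (?d t)\<^sup>2)"
    proof -
      have "(1 - q)\<^sup>2 \<le> (?d t)\<^sup>2" using d[of t] q by (intro power_mono) auto
      then have "1 / (?d t)\<^sup>2 \<le> 1 / (1 - q)\<^sup>2" using q by (intro frac_le) auto
      then have "1 / (?d t)\<^sup>2 * (1 / (?d t)\<^sup>2) \<le> 1 / (1 - q)\<^sup>2 * (1 / (?d t)\<^sup>2)"
        by (intro mult_right_mono) auto
      then show ?thesis by (simp add: power_numeral_reduce power2_eq_square mult.assoc)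
    qed
    then have "ennreal (1 / ?d t ^ 4) \<le> ennreal (1 / (1 - q)\<^sup>2) * ennreal (1 / (?d t)\<^sup>2)"
      by (subst ennreal_mult[symmetric]) (auto intro: ennreal_leI)
    then show "ennreal (1 / ?d t ^ 4) * indicator {0..1} t
        \<le> ennreal (1 / (1 - q)\<^sup>2) * (ennreal (1 / (?d t)\<^sup>2) * indicator {0..1} t)"
      by (auto simp: indicator_def)
  qed
  also have "\<dots> = ennreal (1 / (1 - q)\<^sup>2) * ennreal (1 / (1 - (cmod b)\<^sup>2))"
  proof -
    have "cmod b < 1" using b q by simp
    then show ?thesis by (subst nn_integral_cmult[OF m]) (simp add: poisson_circle_mean)
  qed
  also have "\<dots> = ennreal (1 / (1 - q)\<^sup>2 * (1 / (1 - (cmod b)\<^sup>2)))"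
  proof -
    have "(cmod b)\<^sup>2 \<le> 1" using b q by (intro power_le_one) auto
    then show ?thesis by (subst ennreal_mult) auto
  qed
  also have "\<dots> \<le> ennreal (1 / (1 - q)\<^sup>2 * (1 / (1 - q)))"
  proof (intro ennreal_leI mult_left_mono divide_left_mono)
    have "(cmod b)\<^sup>2 \<le> q\<^sup>2" using b by (intro power_mono) auto
    also have "q\<^sup>2 \<le> q" using q q0 by (simp add: power2_eq_square mult_left_le)
    finally show "1 - q \<le> 1 - (cmod b)\<^sup>2" by simp
    then show "0 < (1 - (cmod b)\<^sup>2) * (1 - q)" using q by (intro mult_pos_pos) auto
  qed auto
  also have "1 / (1 - q)\<^sup>2 * (1 / (1 - q)) = 1 / (1 - q) ^ 3" by (simp add: power2_eq_square power3_eq_cube)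
  finally show ?thesis .
qed

lemma nn_integral_interval_cube_le:
  assumes r: "1/2 \<le> r" "r < 1"
  shows "(\<integral>\<^sup>+\<rho>\<in>{0..1}. ennreal ((1 - r)\<^sup>2 / (1 - r * \<rho>) ^ 3) \<partial>lborel) \<le> 1"
proof -
  have p: "1 - r * x > 0" if "0 \<le> x" "x \<le> 1" for x
    using r that mult_left_le[of x r] by linarith
  \<comment> \<open>an antiderivative of the integrand\<close>
  define F where "F x = (1 - r)\<^sup>2 / (2 * r) * inverse ((1 - r * x)\<^sup>2)" for x
  have "(\<integral>\<^sup>+\<rho>\<in>{0..1}. ennreal ((1 - r)\<^sup>2 / (1 - r * \<rho>) ^ 3) \<partial>lborel) = ennreal (F 1 - F 0)"
  proof (rule nn_integral_FTC_Icc)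
    fix x :: real assume "x \<in> {0..1}"
    then have x: "0 \<le> x" "x \<le> 1" by auto
    define v where "v = 1 - r * x"
    have v: "v \<noteq> 0" using p[OF x] by (simp add: v_def)
    have "((\<lambda>x. (1 - r * x)\<^sup>2) has_real_derivative 2 * v * (- r)) (at x)"
      unfolding v_def by (auto intro!: derivative_eq_intros)
    from DERIV_cmult[OF DERIV_inverse'[OF this], of "(1 - r)\<^sup>2 / (2 * r)"]
    have "(F has_real_derivative (1 - r)\<^sup>2 / (2 * r) * - (inverse (v\<^sup>2) * (2 * v * (- r)) * inverse (v\<^sup>2))) (at x)"
      using v by (simp add: v_def F_def[abs_def])
    moreover have "(1 - r)\<^sup>2 / (2 * r) * - (inverse (v\<^sup>2) * (2 * v * (- r)) * inverse (v\<^sup>2)) = (1 - r)\<^sup>2 / v ^ 3"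
      using v r by (simp add: field_simps power2_eq_square power3_eq_cube)
    ultimately show "(F has_real_derivative (1 - r)\<^sup>2 / (1 - r * x) ^ 3) (at x)"
      by (simp add: v_def)
    show "0 \<le> (1 - r)\<^sup>2 / (1 - r * x) ^ 3" using p[OF x] by simp
  qed auto
  also have "\<dots> \<le> ennreal 1"
  proof (intro ennreal_leI)
    have "F 1 = 1 / (2 * r)" using r by (simp add: F_def)
    moreover have "1 / (2 * r) \<le> 1" using r by simp
    moreover have "F 0 \<ge> 0" using r by (simp add: F_def)
    ultimately show "F 1 - F 0 \<le> 1" by linarith
  qed
  finally show ?thesis by simp
qed

lemma one_plus_sum_squared_le:
  fixes y :: "nat \<Rightarrow> real"
  shows "(1 + (\<Sum>i<n. y i))\<^sup>2 \<le> real (Suc n) * (1 + (\<Sum>i<n. (y i)\<^sup>2))"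
proof -
  \<comment> \<open>the summand 1 becomes one more term, and Cauchy-Schwarz applies to \<open>n + 1\<close> terms\<close>
  define z where "z i = (if i = n then 1 else y i)" for i
  have "(\<Sum>i<Suc n. z i) = 1 + (\<Sum>i<n. y i)" "(\<Sum>i<Suc n. (z i)\<^sup>2) = 1 + (\<Sum>i<n. (y i)\<^sup>2)"
    by (auto simp: z_def intro!: sum.cong)
  then show ?thesis using sum_squared_le_sum_of_squares[of z "{..<Suc n}"] by (simp add: mult.commute)
qed

text \<open>
  For each \<open>w\<close> in the sphere the square of the majorant is integrated over the circle of radius \<open>\<rho>\<close>;
  the result depends on the \<open>a i\<close> only through \<open>|a i| \<le> 1\<close>, so it can be integrated over the sphere.
\<close>

lemma sphere_mean_dilated_quotient_le:
  fixes p :: "complex ^ 'd::finite \<Rightarrow> complex"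
  assumes p: "p \<in> stable_polynomials" and M: "M > 0"
  shows "\<exists>C\<ge>0. \<forall>r \<rho>. 1/2 \<le> r \<longrightarrow> r < 1 \<longrightarrow> 0 \<le> \<rho> \<longrightarrow> \<rho> < 1 \<longrightarrow>
     sphere_mean ((radial_deriv ^^ M) (dilated_quotient M p r)) \<rho>
       \<le> ennreal (C * (1 + (1 - r)\<^sup>2 / (1 - r * \<rho>) ^ 3))"
proof -
  obtain n :: nat and B where B: "B \<ge> 0" "\<And>w. norm w \<le> 1 \<Longrightarrow> (\<exists>a. (\<forall>i. cmod (a i) \<le> 1) \<and> slice_estimate M p n B w a)"
    using dilated_quotient_bound[OF p M] by (elim exE conjE) blast
  define K where "K = B\<^sup>2 * real (Suc n)"
  have K: "K \<ge> 0" by (simp add: K_def)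
  have "sphere_mean ((radial_deriv ^^ M) (dilated_quotient M p r)) \<rho>
       \<le> ennreal (K * real (Suc n) * (1 + (1 - r)\<^sup>2 / (1 - r * \<rho>) ^ 3))"
    if r: "1/2 \<le> r" "r < 1" and \<rho>: "0 \<le> \<rho>" "\<rho> < 1" for r \<rho>
  proof -
    interpret S: prob_space "sphere_measure :: (complex ^ 'd) measure" by (rule prob_space_sphere_measure)
    let ?G = "(radial_deriv ^^ M) (dilated_quotient M p r)"
    have Gh: "?G \<in> hol_ball"
      using r by (intro radial_deriv_pow_hol_ball dilated_quotient_hol_ball p) auto
    define q where "q = r * \<rho>"
    have q: "q < 1" "0 \<le> q"
    proof -
      have "r * \<rho> \<le> r" using r \<rho> by (intro mult_left_le) auto
      then show "q < 1" using r unfolding q_def by linarith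
      show "0 \<le> q" using r \<rho> by (simp add: q_def)
    qed
    define T where "T = (1 - r)\<^sup>2 / (1 - q) ^ 3"
    have T: "T \<ge> 0" using q by (simp add: T_def)
    have circ: "(\<integral>\<^sup>+t\<in>{0..1}. ennreal ((cmod (?G ((of_real \<rho> * cis (2 * pi * t)) *s w)))\<^sup>2) \<partial>lborel)
        \<le> ennreal (K * real (Suc n) * (1 + T))" if w: "norm w = 1" for w
    proof -
      have "norm w \<le> 1" using w by simp
      from B(2)[OF this] obtain a where a: "\<And>i. cmod (a i) \<le> 1" "\<And>x. x \<in> ball 0 1 \<Longrightarrow> cmod (?G (x *s w))
          \<le> B * (1 + (\<Sum>i<n. (1 - r) / (cmod (1 - of_real r * a i * x))\<^sup>2))"
        using r unfolding slice_estimate_def by blast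
      define b where "b i = of_real r * a i * of_real \<rho>" for i
      have bq: "cmod (b i) \<le> q" for i
      proof -
        have "cmod (b i) = r * \<rho> * cmod (a i)" using r \<rho> by (simp add: b_def norm_mult)
        also have "\<dots> \<le> r * \<rho> * 1" using a(1) r \<rho> by (intro mult_left_mono) auto
        finally show ?thesis by (simp add: q_def)
      qed
      let ?D = "\<lambda>i t. cmod (1 - b i * cis (2 * pi * t))"
      have Dnz: "?D i t \<noteq> 0" for i t
        using norm_triangle_ineq2[of 1 "b i * cis (2 * pi * t)"] bq[of i] q by (auto simp: norm_mult)
      have [measurable]: "(\<lambda>t. 1 / ?D i t ^ 4) \<in> borel_measurable borel" for i
        using Dnz by (intro borel_measurable_continuous_onI continuous_intros) auto
      have pt: "(cmod (?G ((of_real \<rho> * cis (2 * pi * t)) *s w)))\<^sup>2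
          \<le> K * (1 + (\<Sum>i<n. (1 - r)\<^sup>2 * (1 / ?D i t ^ 4)))" for t
      proof -
        have "of_real \<rho> * cis (2 * pi * t) \<in> ball 0 1" using \<rho> by (simp add: norm_mult)
        from a(2)[OF this]
        have "(cmod (?G ((of_real \<rho> * cis (2 * pi * t)) *s w)))\<^sup>2
            \<le> (B * (1 + (\<Sum>i<n. (1 - r) / (?D i t)\<^sup>2)))\<^sup>2"
          by (intro power_mono) (simp_all add: b_def mult.assoc)
        also have "\<dots> = B\<^sup>2 * (1 + (\<Sum>i<n. (1 - r) / (?D i t)\<^sup>2))\<^sup>2"
          by (rule power_mult_distrib)
        also have "\<dots> \<le> B\<^sup>2 * (real (Suc n) * (1 + (\<Sum>i<n. ((1 - r) / (?D i t)\<^sup>2)\<^sup>2)))"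
          by (intro mult_left_mono one_plus_sum_squared_le) auto
        also have "\<dots> = K * (1 + (\<Sum>i<n. (1 - r)\<^sup>2 * (1 / ?D i t ^ 4)))"
          by (simp add: K_def power_divide power_mult[symmetric] mult.assoc)
        finally show ?thesis .
      qed
      have "(\<integral>\<^sup>+t\<in>{0..1}. ennreal ((cmod (?G ((of_real \<rho> * cis (2 * pi * t)) *s w)))\<^sup>2) \<partial>lborel)
          \<le> (\<integral>\<^sup>+t. ennreal K * (indicator {0..1} t +
              (\<Sum>i<n. ennreal ((1 - r)\<^sup>2) * (ennreal (1 / ?D i t ^ 4) * indicator {0..1} t))) \<partial>lborel)"
      proof (rule nn_integral_mono)
        fix t :: real
        have "ennreal ((cmod (?G ((of_real \<rho> * cis (2 * pi * t)) *s w)))\<^sup>2)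
            \<le> ennreal (K * (1 + (\<Sum>i<n. (1 - r)\<^sup>2 * (1 / ?D i t ^ 4))))"
          by (intro ennreal_leI pt)
        also have "\<dots> = ennreal K * (1 + (\<Sum>i<n. ennreal ((1 - r)\<^sup>2) * ennreal (1 / ?D i t ^ 4)))"
        proof -
          have S: "ennreal (\<Sum>i<n. (1 - r)\<^sup>2 * (1 / ?D i t ^ 4))
              = (\<Sum>i<n. ennreal ((1 - r)\<^sup>2) * ennreal (1 / ?D i t ^ 4))"
            by (subst sum_ennreal[symmetric], force, intro sum.cong refl ennreal_mult) auto
          have "0 \<le> (\<Sum>i<n. (1 - r)\<^sup>2 * (1 / ?D i t ^ 4))" by (intro sum_nonneg) auto
          then show ?thesis unfolding S[symmetric] using K by (simp only: ennreal_mult ennreal_plus ennreal_1 zero_le_one add_nonneg_nonneg)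
        qed
        finally show "ennreal ((cmod (?G ((of_real \<rho> * cis (2 * pi * t)) *s w)))\<^sup>2) * indicator {0..1} t
            \<le> ennreal K * (indicator {0..1} t +
              (\<Sum>i<n. ennreal ((1 - r)\<^sup>2) * (ennreal (1 / ?D i t ^ 4) * indicator {0..1} t)))"
          by (auto simp: indicator_def)
      qed
      also have "\<dots> = ennreal K * (1 + (\<Sum>i<n. ennreal ((1 - r)\<^sup>2) *
            (\<integral>\<^sup>+t\<in>{0..1}. ennreal (1 / ?D i t ^ 4) \<partial>lborel)))"
        by (simp add: nn_integral_cmult nn_integral_add nn_integral_sum)
      also have "\<dots> \<le> ennreal K * (1 + (\<Sum>i<n. ennreal ((1 - r)\<^sup>2) * ennreal (1 / (1 - q) ^ 3)))"
        by (intro mult_left_mono add_left_mono sum_mono nn_integral_circle_fourth_power_le bq q) auto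
      also have "\<dots> = ennreal K * (1 + ennreal (real n * T))"
        using q by (simp add: T_def ennreal_mult[symmetric] ennreal_of_nat_eq_real_of_nat)
      also have "\<dots> = ennreal (K * (1 + real n * T))"
        using K T by (simp add: ennreal_mult)
      also have "\<dots> \<le> ennreal (K * real (Suc n) * (1 + T))"
      proof (intro ennreal_leI)
        have "K * (1 + real n * T) \<le> K * (real (Suc n) * (1 + T))"
          using K T by (intro mult_left_mono) (auto simp: algebra_simps)
        then show "K * (1 + real n * T) \<le> K * real (Suc n) * (1 + T)" by (simp only: mult.assoc)
      qed
      finally show ?thesis .
    qed
    have "sphere_mean ?G \<rho> \<le> (\<integral>\<^sup>+w. ennreal (K * real (Suc n) * (1 + T)) \<partial>(sphere_measure :: (complex ^ 'd) measure))"
      unfolding sphere_mean_circle_mean[OF Gh \<rho>]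
      by (rule nn_integral_mono_AE, rule AE_mp[OF sphere_measure_sphere], intro AE_I2 impI circ)
    also have "\<dots> = ennreal (K * real (Suc n) * (1 + T))" by (simp add: S.emeasure_space_1)
    finally show ?thesis by (simp add: T_def q_def)
  qed
  moreover have "K * real (Suc n) \<ge> 0" using K by simp
  ultimately show ?thesis by blast
qed

lemma sets_weight_measure: "sets (weight_measure u) = sets (restrict_space borel {0..1})"
  unfolding weight_measure_def by (simp add: sets_restrict_space)

lemma emeasure_radial_measure_norm:
  assumes s: "unit_interval_measure \<mu>" and A: "A \<in> sets \<mu>"
  shows "emeasure \<mu> A = (\<integral>\<^sup>+z. indicator A (norm z) \<partial>(radial_measure \<mu> :: (complex ^ 'd::finite) measure))"
proof -
  interpret S: prob_space "sphere_measure :: (complex ^ 'd) measure" by (rule prob_space_sphere_measure)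
  have "A \<in> sets borel" using A unfolding s by (auto simp: sets_restrict_space)
  then have [measurable]: "(\<lambda>z :: complex ^ 'd. indicator A (norm z) :: ennreal) \<in> borel_measurable borel"
    by measurable
  have "(\<integral>\<^sup>+z. indicator A (norm z) \<partial>(radial_measure \<mu> :: (complex ^ 'd) measure))
      = (\<integral>\<^sup>+r. (\<integral>\<^sup>+w. indicator A (norm (r *\<^sub>R w)) \<partial>(sphere_measure :: (complex ^ 'd) measure)) \<partial>\<mu>)"
    by (rule nn_integral_radial_measure[OF s]) measurable
  also have "\<dots> = (\<integral>\<^sup>+r. indicator A r \<partial>\<mu>)"
  proof (rule nn_integral_cong)
    fix r assume "r \<in> space \<mu>"
    then have r: "0 \<le> r" using space_unit_interval_measure[OF s] by auto
    have "(\<integral>\<^sup>+w. indicator A (norm (r *\<^sub>R w)) \<partial>(sphere_measure :: (complex ^ 'd) measure))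
        = (\<integral>\<^sup>+w. indicator A r \<partial>(sphere_measure :: (complex ^ 'd) measure))"
      by (rule nn_integral_cong_AE, rule AE_mp[OF sphere_measure_sphere], intro AE_I2 impI) (use r in simp)
    then show "(\<integral>\<^sup>+w. indicator A (norm (r *\<^sub>R w)) \<partial>(sphere_measure :: (complex ^ 'd) measure)) = indicator A r"
      by (simp add: S.emeasure_space_1)
  qed
  finally show ?thesis using A by simp
qed

text \<open>
  The image of a radial measure under the norm is the measure on \<open>[0, 1]\<close> it comes from.  So the
  hypothesis of the second claim, an equality of radial measures, identifies \<open>\<mu>\<close> itself.
\<close>

lemma radial_measure_inj:
  assumes "unit_interval_measure \<mu>" "unit_interval_measure \<nu>"
    and "(radial_measure \<mu> :: (complex ^ 'd::finite) measure) = radial_measure \<nu>"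
  shows "\<mu> = \<nu>"
  using assms emeasure_radial_measure_norm[where 'd = 'd]
  by (intro measure_eqI) auto

text \<open>
  A measure with a density has no mass at 1, so the boundary term disappears; on \<open>[0, 1]\<close> the density
  \<open>2 r u(r)\<close> is at most twice the bound for \<open>u\<close>.
\<close>

lemma L2_sqnorm_weight_measure_le:
  fixes f :: "complex ^ 'd::finite \<Rightarrow> complex"
  assumes u: "u \<in> borel_measurable (restrict_space lborel {0..1})"
      "AE r in restrict_space lborel {0..1}. 0 \<le> u r \<and> u r \<le> C"
    and f: "f \<in> hol_ball"
  shows "L2_sqnorm (weight_measure u) f \<le> ennreal (2 * max C 0) * (\<integral>\<^sup>+\<rho>\<in>{0..<1}. sphere_mean f \<rho> \<partial>lborel)"
proof -
  let ?L = "restrict_space lborel {0..1 :: real}"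
  let ?g = "\<lambda>z. ennreal ((cmod (cut_ball f z))\<^sup>2)"
  note cut_ball_measurable[OF f, measurable]
  have gm: "?g \<in> borel_measurable borel" by measurable
  have s: "unit_interval_measure (weight_measure u)" "unit_interval_measure ?L"
    by (simp_all add: sets_weight_measure sets_restrict_space)
  have wm: "(\<lambda>r. ennreal (u r * (2 * r))) \<in> borel_measurable ?L"
  proof -
    have [measurable]: "(\<lambda>r. r) \<in> borel_measurable ?L" by (simp add: measurable_restrict_space1)
    show ?thesis using u(1) by measurable
  qed
  have one: "emeasure (weight_measure u) {1} = 0"
  proof -
    have "{1} \<in> sets ?L" by (simp add: sets_restrict_space_iff)
    then have "emeasure (weight_measure u) {1} = (\<integral>\<^sup>+r. ennreal (u r * (2 * r)) * indicator {1} r \<partial>?L)"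
      unfolding weight_measure_def by (rule emeasure_density[OF wm])
    also have "\<dots> = (\<integral>\<^sup>+r. ennreal (u r * (2 * r)) * indicator {1} r * indicator {0..1} r \<partial>lborel)"
      by (subst nn_integral_restrict_space) auto
    also have "\<dots> = (\<integral>\<^sup>+r. 0 \<partial>(lborel :: real measure))"
    proof (rule nn_integral_cong_AE)
      show "AE r in lborel. ennreal (u r * (2 * r)) * indicator {1} r * indicator {0..1} r = 0"
        using AE_lborel_singleton[of "1 :: real"] by eventually_elim auto
    qed
    finally show ?thesis by simp
  qed
  have ball: "(\<integral>\<^sup>+z\<in>ball 0 1. ennreal ((cmod (f z))\<^sup>2) \<partial>radial_measure (weight_measure u))
      = (\<integral>\<^sup>+z. ?g z \<partial>radial_measure (weight_measure u))"
    by (intro nn_integral_cong) (auto simp: cut_ball_def indicator_def)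
  have "L2_sqnorm (weight_measure u) f = (\<integral>\<^sup>+r. (\<integral>\<^sup>+w. ?g (r *\<^sub>R w) \<partial>sphere_measure) \<partial>weight_measure u)"
    unfolding L2_sqnorm_def one ball by (simp add: nn_integral_radial_measure(1)[OF s(1) gm])
  also have "\<dots> = (\<integral>\<^sup>+r. ennreal (u r * (2 * r)) * (\<integral>\<^sup>+w. ?g (r *\<^sub>R w) \<partial>sphere_measure) \<partial>?L)"
    unfolding weight_measure_def
    by (rule nn_integral_density[OF wm nn_integral_radial_measure(2)[OF s(2) gm]])
  also have "\<dots> \<le> (\<integral>\<^sup>+r. ennreal (2 * max C 0) * (\<integral>\<^sup>+w. ?g (r *\<^sub>R w) \<partial>sphere_measure) \<partial>?L)"
  proof (rule nn_integral_mono_AE)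
    have "AE r in ?L. r \<in> space ?L" by (rule AE_space)
    with u(2) show "AE r in ?L. ennreal (u r * (2 * r)) * (\<integral>\<^sup>+w. ?g (r *\<^sub>R w) \<partial>sphere_measure)
        \<le> ennreal (2 * max C 0) * (\<integral>\<^sup>+w. ?g (r *\<^sub>R w) \<partial>sphere_measure)"
    proof eventually_elim
      case (elim r)
      then have r: "0 \<le> r" "r \<le> 1" by (auto simp: space_restrict_space)
      have "u r * (2 * r) \<le> max C 0 * (2 * 1)" using elim r by (intro mult_mono) auto
      then show ?case by (intro mult_right_mono ennreal_leI) auto
    qed
  qed
  also have "\<dots> = ennreal (2 * max C 0) * (\<integral>\<^sup>+r. (\<integral>\<^sup>+w. ?g (r *\<^sub>R w) \<partial>sphere_measure) \<partial>?L)"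
    by (rule nn_integral_cmult[OF nn_integral_radial_measure(2)[OF s(2) gm]])
  also have "(\<integral>\<^sup>+r. (\<integral>\<^sup>+w. ?g (r *\<^sub>R w) \<partial>sphere_measure) \<partial>?L)
      = (\<integral>\<^sup>+r. (\<integral>\<^sup>+w. ?g (r *\<^sub>R w) \<partial>sphere_measure) * indicator {0..1} r \<partial>lborel)"
    by (subst nn_integral_restrict_space) auto
  also have "\<dots> = (\<integral>\<^sup>+\<rho>\<in>{0..<1}. sphere_mean f \<rho> \<partial>lborel)"
  proof (rule nn_integral_cong_AE)
    show "AE r in lborel. (\<integral>\<^sup>+w. ?g (r *\<^sub>R w) \<partial>sphere_measure) * indicator {0..1} r
        = sphere_mean f r * indicator {0..<1} r"
      using AE_lborel_singleton[of "1 :: real"]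
      by eventually_elim (auto simp: sphere_mean_cut_ball indicator_def)
  qed
  finally show ?thesis .
qed

text \<open>
  With \<open>N < M\<close> the derivative of order \<open>N\<close> of the quotient is uniformly bounded on the ball.
\<close>

lemma besov_sqnorm_dilated_quotient_le:
  fixes p :: "complex ^ 'd::finite \<Rightarrow> complex"
  assumes p: "p \<in> stable_polynomials" and \<mu>: "unit_interval_measure \<mu>" "finite_measure \<mu>"
    and N: "1 \<le> N" "N < M"
  shows "\<exists>C. \<forall>r. 1/2 \<le> r \<longrightarrow> r < 1 \<longrightarrow> besov_sqnorm N \<mu> (dilated_quotient M p r) \<le> ennreal C"
proof -
  obtain B where B: "B \<ge> 0" "\<And>r k z. 1/2 \<le> r \<Longrightarrow> r < 1 \<Longrightarrow> k < M \<Longrightarrow> norm z < 1 \<Longrightarrow>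
    cmod ((radial_deriv ^^ k) (dilated_quotient M p r) z) \<le> B"
    using dilated_quotient_uniform_bound[OF p, of M] N by auto
  have "besov_sqnorm N \<mu> (dilated_quotient M p r) \<le> ennreal (measure \<mu> {0..1} * B\<^sup>2 + B\<^sup>2 * measure \<mu> {0..1})"
    if r: "1/2 \<le> r" "r < 1" for r
  proof -
    have h: "dilated_quotient M p r \<in> hol_ball" using r by (intro dilated_quotient_hol_ball p) auto
    have em: "emeasure \<mu> {0..1} = ennreal (measure \<mu> {0..1})"
      by (rule finite_measure.emeasure_eq_measure[OF \<mu>(2)])
    have "L2_sqnorm \<mu> ((radial_deriv ^^ N) (dilated_quotient M p r)) \<le> ennreal (B\<^sup>2) * emeasure \<mu> {0..1}"
      by (intro L2_sqnorm_bounded \<mu> radial_deriv_pow_hol_ball h B(2) r N)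
    moreover have "cmod (dilated_quotient M p r 0) \<le> B" using B(2)[OF r, of 0 0] N by simp
    ultimately have "besov_sqnorm N \<mu> (dilated_quotient M p r)
        \<le> emeasure \<mu> {0..1} * ennreal (B\<^sup>2) + ennreal (B\<^sup>2) * emeasure \<mu> {0..1}"
      unfolding besov_sqnorm_eq[OF \<mu>(1) h N(1)]
      by (intro add_mono mult_left_mono ennreal_leI power_mono) auto
    also have "\<dots> = ennreal (measure \<mu> {0..1} * B\<^sup>2 + B\<^sup>2 * measure \<mu> {0..1})"
      unfolding em by (subst ennreal_plus) (auto simp: ennreal_mult)
    finally show ?thesis .
  qed
  then show ?thesis by blast
qed

text \<open>
  Here the derivative of order \<open>N\<close> is the top one, which is unbounded as \<open>r\<close> tends to 1.  The bound on
  the spherical means, of order \<open>(1 - r)\<^sup>2 / (1 - r \<rho>)\<^sup>3\<close>, has a bounded integral in \<open>\<rho>\<close>.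
\<close>

lemma besov_sqnorm_dilated_quotient_le_weight:
  fixes p :: "complex ^ 'd::finite \<Rightarrow> complex"
  assumes p: "p \<in> stable_polynomials" and \<mu>: "finite_measure (weight_measure u)"
    and N: "1 \<le> N" and u: "bounded_weight u"
  shows "\<exists>C. \<forall>r. 1/2 \<le> r \<longrightarrow> r < 1 \<longrightarrow> besov_sqnorm N (weight_measure u) (dilated_quotient N p r) \<le> ennreal C"
proof -
  let ?\<mu> = "weight_measure u"
  have s: "unit_interval_measure ?\<mu>" by (rule sets_weight_measure)
  obtain D where D: "u \<in> borel_measurable (restrict_space lborel {0..1})"
      "AE r in restrict_space lborel {0..1}. 0 \<le> u r \<and> u r \<le> D"
    using u by (auto simp: bounded_weight_def)
  obtain B where B: "B \<ge> 0" "\<And>r k z. 1/2 \<le> r \<Longrightarrow> r < 1 \<Longrightarrow> k < N \<Longrightarrow> norm z < 1 \<Longrightarrow>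
    cmod ((radial_deriv ^^ k) (dilated_quotient N p r) z) \<le> B"
    using dilated_quotient_uniform_bound[OF p, of N] N by auto
  obtain C where C: "C \<ge> 0" "\<And>r \<rho>. 1/2 \<le> r \<Longrightarrow> r < 1 \<Longrightarrow> 0 \<le> \<rho> \<Longrightarrow> \<rho> < 1 \<Longrightarrow>
     sphere_mean ((radial_deriv ^^ N) (dilated_quotient N p r)) \<rho>
       \<le> ennreal (C * (1 + (1 - r)\<^sup>2 / (1 - r * \<rho>) ^ 3))"
    using sphere_mean_dilated_quotient_le[OF p, of N] N by auto
  have em: "emeasure ?\<mu> {0..1} = ennreal (measure ?\<mu> {0..1})"
    by (rule finite_measure.emeasure_eq_measure[OF \<mu>])
  have "besov_sqnorm N ?\<mu> (dilated_quotient N p r)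
      \<le> ennreal (measure ?\<mu> {0..1} * B\<^sup>2 + 2 * max D 0 * (C * 2))"
    if r: "1/2 \<le> r" "r < 1" for r
  proof -
    let ?G = "(radial_deriv ^^ N) (dilated_quotient N p r)"
    have h: "dilated_quotient N p r \<in> hol_ball" using r by (intro dilated_quotient_hol_ball p) auto
    have pos: "1 - r * \<rho> > 0" if "0 \<le> \<rho>" "\<rho> \<le> 1" for \<rho>
      using r that mult_left_le[of \<rho> r] by linarith
    have "(\<integral>\<^sup>+\<rho>\<in>{0..<1}. sphere_mean ?G \<rho> \<partial>lborel)
        \<le> (\<integral>\<^sup>+\<rho>. ennreal C * (indicator {0..1} \<rho> + ennreal ((1 - r)\<^sup>2 / (1 - r * \<rho>) ^ 3) * indicator {0..1} \<rho>) \<partial>lborel)"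
    proof (rule nn_integral_mono)
      fix \<rho> :: real
      show "sphere_mean ?G \<rho> * indicator {0..<1} \<rho>
          \<le> ennreal C * (indicator {0..1} \<rho> + ennreal ((1 - r)\<^sup>2 / (1 - r * \<rho>) ^ 3) * indicator {0..1} \<rho>)"
      proof (cases "\<rho> \<in> {0..<1}")
        case True
        then have "sphere_mean ?G \<rho> \<le> ennreal (C * (1 + (1 - r)\<^sup>2 / (1 - r * \<rho>) ^ 3))"
          using C(2)[OF r, of \<rho>] by simp
        also have "\<dots> = ennreal C * (1 + ennreal ((1 - r)\<^sup>2 / (1 - r * \<rho>) ^ 3))"
          using C(1) pos[of \<rho>] True by (simp add: ennreal_mult)
        finally show ?thesis using True by simp
      qed simp
    qed
    also have "\<dots> = ennreal C * (1 + (\<integral>\<^sup>+\<rho>\<in>{0..1}. ennreal ((1 - r)\<^sup>2 / (1 - r * \<rho>) ^ 3) \<partial>lborel))"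
      by (simp add: nn_integral_cmult nn_integral_add)
    also have "\<dots> \<le> ennreal C * (1 + 1)"
      by (intro mult_left_mono add_left_mono nn_integral_interval_cube_le r) auto
    also have "\<dots> = ennreal (C * 2)" using C(1) by (simp add: ennreal_mult)
    finally have i: "(\<integral>\<^sup>+\<rho>\<in>{0..<1}. sphere_mean ?G \<rho> \<partial>lborel) \<le> ennreal (C * 2)" .
    have "L2_sqnorm ?\<mu> ?G \<le> ennreal (2 * max D 0) * (\<integral>\<^sup>+\<rho>\<in>{0..<1}. sphere_mean ?G \<rho> \<partial>lborel)"
      by (intro L2_sqnorm_weight_measure_le D radial_deriv_pow_hol_ball h)
    also have "\<dots> \<le> ennreal (2 * max D 0) * ennreal (C * 2)" by (intro mult_left_mono i) auto
    finally have "L2_sqnorm ?\<mu> ?G \<le> ennreal (2 * max D 0) * ennreal (C * 2)" .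
    moreover have "cmod (dilated_quotient N p r 0) \<le> B" using B(2)[OF r, of 0 0] N by simp
    ultimately have "besov_sqnorm N ?\<mu> (dilated_quotient N p r)
        \<le> emeasure ?\<mu> {0..1} * ennreal (B\<^sup>2) + ennreal (2 * max D 0) * ennreal (C * 2)"
      unfolding besov_sqnorm_eq[OF s h N]
      by (intro add_mono mult_left_mono ennreal_leI power_mono) auto
    also have "\<dots> = ennreal (measure ?\<mu> {0..1} * B\<^sup>2 + 2 * max D 0 * (C * 2))"
    proof -
      have 1: "ennreal (measure ?\<mu> {0..1}) * ennreal (B\<^sup>2) = ennreal (measure ?\<mu> {0..1} * B\<^sup>2)"
        by (rule ennreal_mult[symmetric]) auto
      have 2: "ennreal (2 * max D 0) * ennreal (C * 2) = ennreal (2 * max D 0 * (C * 2))"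
        using C(1) by (intro ennreal_mult[symmetric]) auto
      show ?thesis unfolding em 1 2 using C(1) by (intro ennreal_plus[symmetric]) auto
    qed
    finally show ?thesis .
  qed
  then show ?thesis by blast
qed

section \<open>Approximation by multiples of a higher power\<close>

text \<open>
  On the sphere of radius \<open>1/2\<close> the differences are uniformly bounded and tend to 0 pointwise, since
  \<open>p\<close> has no zero there; and this spherical mean controls each single coefficient.
\<close>

lemma dilated_quotient_coeff_energy_tendsto:
  fixes p :: "complex ^ 'd::finite \<Rightarrow> complex"
  assumes p: "p \<in> stable_polynomials" and r: "\<And>n. 1/2 \<le> r n" "\<And>n. r n < 1" "r \<longlonglongrightarrow> 1"
  shows "(\<lambda>n. coeff_energy (\<lambda>z. dilated_quotient (Suc m) p (r n) z - p z ^ m) k) \<longlonglongrightarrow> 0"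
proof -
  let ?e = "\<lambda>n z. dilated_quotient (Suc m) p (r n) z - p z ^ m"
  have ph: "p \<in> hol_ball" and nz: "\<And>z. norm z < 1 \<Longrightarrow> p z \<noteq> 0"
    using p by (auto simp: stable_polynomials_def polynomials_hol_ball)
  have r0: "0 \<le> r n" "r n \<le> 1" for n using r(1,2)[of n] by auto
  have eh: "?e n \<in> hol_ball" for n
    by (intro hol_ball_diff dilated_quotient_hol_ball p r0 hol_ball_power ph)
  obtain B where B: "\<And>r k z. 1/2 \<le> r \<Longrightarrow> r < 1 \<Longrightarrow> k < Suc m \<Longrightarrow> norm z < 1 \<Longrightarrow>
    cmod ((radial_deriv ^^ k) (dilated_quotient (Suc m) p r) z) \<le> B"
    using dilated_quotient_uniform_bound[OF p, of "Suc m"] by auto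
  obtain B' where B': "\<And>z. norm z \<le> 1/2 \<Longrightarrow> cmod (p z ^ m) \<le> B'"
    using hol_ball_bounded[OF hol_ball_power[OF ph], of "1/2" m] by auto
  have bd: "cmod (?e n z) \<le> B + B'" if "norm z = 1/2" for n z
  proof -
    have "cmod (dilated_quotient (Suc m) p (r n) z) \<le> B" using B[OF r(1,2), of 0 z n] that by simp
    moreover have "cmod (p z ^ m) \<le> B'" using B' that by simp
    ultimately show ?thesis using norm_triangle_ineq4[of "dilated_quotient (Suc m) p (r n) z" "p z ^ m"] by linarith
  qed
  have pt: "(\<lambda>n. ?e n z) \<longlonglongrightarrow> 0" if z: "norm z < 1" for z
  proof -
    have "(\<lambda>n. r n *\<^sub>R z) \<longlonglongrightarrow> 1 *\<^sub>R z" by (intro tendsto_intros r(3))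
    moreover have "isCont p z"
      using hol_ball_continuous_on[OF ph] z by (simp add: continuous_on_eq_continuous_at)
    ultimately have "(\<lambda>n. p (r n *\<^sub>R z)) \<longlonglongrightarrow> p z"
      using isCont_tendsto_compose[of z p] by simp
    then have "(\<lambda>n. ?e n z) \<longlonglongrightarrow> p z ^ Suc m * inverse (p z) - p z ^ m"
      unfolding dilated_quotient_def by (intro tendsto_intros nz z)
    moreover have "p z ^ Suc m * inverse (p z) - p z ^ m = 0" using nz[OF z] by simp
    ultimately show ?thesis by (simp only:)
  qed
  have sm: "(\<lambda>n. sphere_mean (?e n) (1/2)) \<longlonglongrightarrow> 0"
  proof -
    interpret S: prob_space "sphere_measure :: (complex ^ 'd) measure" by (rule prob_space_sphere_measure)
    let ?u = "\<lambda>n w. ennreal ((cmod (cut_ball (?e n) ((1/2) *\<^sub>R w)))\<^sup>2)"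
    have m: "?u n \<in> borel_measurable sphere_measure" for n
    proof -
      note cut_ball_measurable[OF eh[of n], measurable]
      show ?thesis by measurable
    qed
    have "(\<lambda>n. \<integral>\<^sup>+w. ?u n w \<partial>sphere_measure) \<longlonglongrightarrow> (\<integral>\<^sup>+w. 0 \<partial>(sphere_measure :: (complex ^ 'd) measure))"
    proof (rule nn_integral_dominated_convergence[where w = "\<lambda>_. ennreal ((B + B')\<^sup>2)"])
      show "AE w in sphere_measure. ?u n w \<le> ennreal ((B + B')\<^sup>2)" for n
        using sphere_measure_sphere
      proof eventually_elim
        case (elim w)
        then have "norm ((1/2) *\<^sub>R w) = 1/2" by simp
        then show ?case using bd[of "(1/2) *\<^sub>R w" n]
          by (intro ennreal_leI power_mono) (auto simp: cut_ball_eq)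
      qed
      show "AE w in sphere_measure. (\<lambda>n. ?u n w) \<longlonglongrightarrow> 0"
        using sphere_measure_sphere
      proof eventually_elim
        case (elim w)
        then have h: "norm ((1/2) *\<^sub>R w) < 1" by simp
        have "(\<lambda>n. ennreal ((cmod (?e n ((1/2) *\<^sub>R w)))\<^sup>2)) \<longlonglongrightarrow> ennreal ((cmod 0)\<^sup>2)"
          by (intro tendsto_intros pt h)
        then show ?case by (simp add: cut_ball_eq[OF h])
      qed
    qed (auto simp: S.emeasure_space_1 m)
    then show ?thesis by (simp add: sphere_mean_cut_ball)
  qed
  have "(\<lambda>n. ennreal (4 ^ k) * sphere_mean (?e n) (1/2)) \<longlonglongrightarrow> ennreal (4 ^ k) * 0"
    by (intro ennreal_tendsto_cmult sm) simp
  then have lim: "(\<lambda>n. ennreal (4 ^ k) * sphere_mean (?e n) (1/2)) \<longlonglongrightarrow> 0" by simp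
  show ?thesis
  proof (rule tendsto_sandwich[OF _ _ tendsto_const lim])
    show "\<forall>\<^sub>F n in sequentially. coeff_energy (?e n) k \<le> ennreal (4 ^ k) * sphere_mean (?e n) (1/2)"
      by (intro always_eventually allI coeff_energy_le_sphere_mean eh)
  qed simp
qed

lemma besov_space_add:
  assumes "unit_interval_measure \<mu>" "finite_measure \<mu>" "N \<ge> 1" "f \<in> besov_space N \<mu>" "g \<in> besov_space N \<mu>"
  shows "(\<lambda>z. f z + g z) \<in> besov_space N \<mu>"
  using assms(4,5) besov_sqnorm_add_le[of f g N \<mu>]
  unfolding besov_space_iff[OF assms(1-3)]
  by (auto intro!: hol_ball_add elim!: le_less_trans simp: ennreal_mult_less_top)

lemma besov_space_cmult:
  assumes "unit_interval_measure \<mu>" "finite_measure \<mu>" "N \<ge> 1" "f \<in> besov_space N \<mu>"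
  shows "(\<lambda>z. c * f z) \<in> besov_space N \<mu>"
  using assms(4) unfolding besov_space_iff[OF assms(1-3)]
  by (auto intro!: hol_ball_cmult simp: besov_sqnorm_cmult ennreal_mult_less_top)

lemma besov_space_diff:
  assumes "unit_interval_measure \<mu>" "finite_measure \<mu>" "N \<ge> 1" "f \<in> besov_space N \<mu>" "g \<in> besov_space N \<mu>"
  shows "(\<lambda>z. f z - g z) \<in> besov_space N \<mu>"
  using besov_space_add[OF assms(1-4) besov_space_cmult[OF assms(1-3,5), of "-1"]] by simp

lemma besov_space_const:
  assumes "unit_interval_measure \<mu>" "finite_measure \<mu>" "N \<ge> 1"
  shows "(\<lambda>_. c) \<in> besov_space N \<mu>"
  using besov_weight_finite[OF assms(1,2), of N 0]
  by (simp add: besov_space_iff[OF assms] hol_ball_const besov_sqnorm_def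
      suminf_coeff_energy_const ennreal_mult_less_top)

lemma Mult_mult: "\<phi> \<in> Mult H \<Longrightarrow> \<psi> \<in> Mult H \<Longrightarrow> (\<lambda>x. \<phi> x * \<psi> x) \<in> Mult H"
  by (auto simp: Mult_def mult.assoc)

text \<open>
  This puts the averages of the functions \<open>1 / p(r z)\<close> into the multiplier algebra.
\<close>

lemma Mult_sum_list:
  assumes "unit_interval_measure \<mu>" "finite_measure \<mu>" "N \<ge> 1" "\<And>n. g n \<in> Mult (besov_space N \<mu>)"
  shows "(\<lambda>z. c * (\<Sum>n\<leftarrow>ns. g n z)) \<in> Mult (besov_space N \<mu>)"
proof -
  have "(\<lambda>z. (\<Sum>n\<leftarrow>ns. g n z) * f z) \<in> besov_space N \<mu>" if "f \<in> besov_space N \<mu>" for f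
  proof (induction ns)
    case Nil
    then show ?case using besov_space_cmult[OF assms(1-3) that, of 0] by simp
  next
    case (Cons n ns)
    have "(\<lambda>z. g n z * f z) \<in> besov_space N \<mu>" using assms(4) that by (auto simp: Mult_def)
    from besov_space_add[OF assms(1-3) this Cons] show ?case by (simp add: distrib_right)
  qed
  then show ?thesis
    using besov_space_cmult[OF assms(1-3)] by (auto simp: Mult_def mult.assoc)
qed

lemma ennreal_mult_lessI:
  fixes x :: ennreal
  assumes "C > 0" "\<delta> > 0" "x < ennreal (\<delta> / C)"
  shows "ennreal C * x < ennreal \<delta>"
proof -
  obtain y where y: "x = ennreal y" "y \<ge> 0" using assms(3) by (cases x) auto
  then have "y < \<delta> / C" using assms by (simp add: ennreal_less_iff)
  then have "C * y < \<delta>" using assms(1) by (simp add: field_simps)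
  then show ?thesis unfolding y(1) using assms y(2) by (simp add: ennreal_mult[symmetric] ennreal_less_iff)
qed

text \<open>
  The error \<open>\<psi> h p\<^sup>m\<^sup>+\<^sup>1 - g\<close> is split as
  \<open>\<psi> (h p\<^sup>m\<^sup>+\<^sup>1 - p\<^sup>m) + p\<^sup>m (\<psi> - \<phi>) + (\<phi> p\<^sup>m - g)\<close>.  The order of the choices matters: first \<open>\<phi>\<close>, then its
  dilate \<open>\<psi>\<close>, which makes the middle term small since \<open>p\<^sup>m\<close> is a bounded multiplier, and only then the
  average \<open>h\<close>, whose error is multiplied by the operator bound of \<open>\<psi>\<close>.
\<close>

lemma stable_polynomial_besov_class:
  fixes p :: "complex ^ 'd::finite \<Rightarrow> complex"
  assumes p: "p \<in> stable_polynomials" and \<mu>: "unit_interval_measure \<mu>" "finite_measure \<mu>" and N: "N \<ge> 1"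
    and C: "\<And>r. 1/2 \<le> r \<Longrightarrow> r < 1 \<Longrightarrow> besov_sqnorm N \<mu> (dilated_quotient (Suc m) p r) \<le> ennreal C"
  shows "p \<in> besov_class m N \<mu>"
proof -
  let ?H = "besov_space N \<mu> :: (complex ^ 'd \<Rightarrow> complex) set" and ?Q = "besov_sqnorm N \<mu>"
  note memb = besov_space_iff[OF \<mu> N]
  have pp: "p \<in> polynomials" and nz: "\<And>z. norm z < 1 \<Longrightarrow> p z \<noteq> 0"
    using p by (auto simp: stable_polynomials_def)
  have ph: "p \<in> hol_ball" by (rule polynomials_hol_ball[OF pp])
  have pM: "p \<in> Mult ?H" by (intro smooth_multiplier_Mult polynomials_smooth_multiplier pp \<mu> N)
  have pmM: "(\<lambda>z. p z ^ m) \<in> Mult ?H"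
    by (intro smooth_multiplier_Mult polynomials_power_smooth_multiplier pp \<mu> N)
  have pmh: "(\<lambda>z. p z ^ m) \<in> hol_ball" by (intro hol_ball_power ph)
  have MultH: "\<phi> \<in> ?H" if "\<phi> \<in> Mult ?H" for \<phi>
    using that besov_space_const[OF \<mu> N, of 1] by (force simp: Mult_def)
  have pm: "(\<lambda>z. p z ^ m) \<in> ?H" by (rule MultH[OF pmM])
  have sub1: "mult_closure ?H (besov_norm N \<mu>) (\<lambda>z. p z ^ Suc m) \<subseteq> mult_closure ?H (besov_norm N \<mu>) (\<lambda>z. p z ^ m)"
  proof
    fix g assume g: "g \<in> mult_closure ?H (besov_norm N \<mu>) (\<lambda>z. p z ^ Suc m)"
    show "g \<in> mult_closure ?H (besov_norm N \<mu>) (\<lambda>z. p z ^ m)"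
      unfolding mult_closure_def
    proof (intro CollectI conjI allI impI)
      show "g \<in> ?H" using g by (simp add: mult_closure_def)
      fix \<epsilon> :: real assume "\<epsilon> > 0"
      then obtain \<phi> where \<phi>: "\<phi> \<in> Mult ?H" "besov_norm N \<mu> (\<lambda>z. \<phi> z * p z ^ Suc m - g z) < \<epsilon>"
        using g by (auto simp: mult_closure_def)
      have "(\<lambda>z. \<phi> z * p z) \<in> Mult ?H" by (rule Mult_mult[OF \<phi>(1) pM])
      moreover have "besov_norm N \<mu> (\<lambda>z. (\<phi> z * p z) * p z ^ m - g z) < \<epsilon>"
        using \<phi>(2) by (simp add: mult_ac)
      ultimately show "\<exists>\<phi>\<in>Mult ?H. besov_norm N \<mu> (\<lambda>z. \<phi> z * p z ^ m - g z) < \<epsilon>"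
        by (intro bexI[of _ "\<lambda>z. \<phi> z * p z"])
    qed
  qed
  have sub2: "mult_closure ?H (besov_norm N \<mu>) (\<lambda>z. p z ^ m) \<subseteq> mult_closure ?H (besov_norm N \<mu>) (\<lambda>z. p z ^ Suc m)"
  proof
    fix g assume g: "g \<in> mult_closure ?H (besov_norm N \<mu>) (\<lambda>z. p z ^ m)"
    then have gH: "g \<in> ?H" by (simp add: mult_closure_def)
    show "g \<in> mult_closure ?H (besov_norm N \<mu>) (\<lambda>z. p z ^ Suc m)"
      unfolding mult_closure_def
    proof (intro CollectI conjI allI impI gH)
      fix \<epsilon> :: real assume e: "\<epsilon> > 0"
      \<comment> \<open>the three errors enter with the factors 2, 4 and 4, because the squared norm only satisfies the triangle inequality up to a factor 2\<close>
      define \<delta> where "\<delta> = \<epsilon>\<^sup>2 / 10"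
      have d: "\<delta> > 0" using e by (simp add: \<delta>_def)
      have sd: "sqrt \<delta> > 0" using d by simp
      then obtain \<phi> where \<phi>: "\<phi> \<in> Mult ?H" "besov_norm N \<mu> (\<lambda>z. \<phi> z * p z ^ m - g z) < sqrt \<delta>"
        using g unfolding mult_closure_def by blast
      define A where "A z = \<phi> z * p z ^ m - g z" for z
      have AH: "A \<in> ?H"
        unfolding A_def[abs_def] using \<phi>(1) pm by (intro besov_space_diff \<mu> N gH) (auto simp: Mult_def)
      have QA: "?Q A < ennreal \<delta>"
        using besov_norm_less_iff[OF \<mu> N AH sd] \<phi>(2) d by (simp add: A_def[abs_def])
      have \<phi>h: "\<phi> \<in> hol_ball" "?Q \<phi> < \<infinity>" using MultH[OF \<phi>(1)] by (auto simp: memb)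
      obtain C1 where C1: "C1 > 0" "\<And>f. f \<in> hol_ball \<Longrightarrow> ?Q (\<lambda>z. p z ^ m * f z) \<le> ennreal C1 * ?Q f"
        using smooth_multiplier_bounded[OF polynomials_power_smooth_multiplier[OF pp] \<mu>(1) N] by blast
      have "ennreal (\<delta> / C1) > 0" using d C1(1) by simp
      from dilate_tendsto_besov[OF \<phi>h this] obtain s where s: "0 < s" "s < 1"
        "?Q (\<lambda>z. \<phi> (s *\<^sub>R z) - \<phi> z) < ennreal (\<delta> / C1)" by blast
      define \<psi> where "\<psi> z = \<phi> (s *\<^sub>R z)" for z
      have \<psi>: "smooth_multiplier N \<psi>" unfolding \<psi>_def[abs_def] using s by (intro smooth_multiplier_dilate \<phi>h) auto
      have \<psi>h: "\<psi> \<in> hol_ball" using \<psi> by (simp add: smooth_multiplier_def)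
      define D where "D z = p z ^ m * (\<psi> z - \<phi> z)" for z
      have Dh: "D \<in> hol_ball" unfolding D_def[abs_def] by (intro hol_ball_mult hol_ball_diff pmh \<psi>h \<phi>h)
      have QD: "?Q D < ennreal \<delta>"
      proof -
        have "?Q D \<le> ennreal C1 * ?Q (\<lambda>z. \<psi> z - \<phi> z)"
          unfolding D_def[abs_def] by (intro C1 hol_ball_diff \<psi>h \<phi>h)
        also have "\<dots> < ennreal \<delta>"
          using s(3) by (intro ennreal_mult_lessI C1 d) (simp add: \<psi>_def)
        finally show ?thesis .
      qed
      obtain C2 where C2: "C2 > 0" "\<And>f. f \<in> hol_ball \<Longrightarrow> ?Q (\<lambda>z. \<psi> z * f z) \<le> ennreal C2 * ?Q f"
        using smooth_multiplier_bounded[OF \<psi> \<mu>(1) N] by blast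
      obtain r :: "nat \<Rightarrow> real" where r: "\<And>n. 1/2 \<le> r n" "\<And>n. r n < 1" and "incseq r" and rlim: "r \<longlonglongrightarrow> 1"
        by (rule exists_sequence_to_one) (rule that)
      have r0: "0 \<le> r n" "r n \<le> 1" for n using r[of n] by auto
      define E where "E n z = dilated_quotient (Suc m) p (r n) z - p z ^ m" for n z
      have qh: "dilated_quotient (Suc m) p (r n) \<in> hol_ball" for n by (intro dilated_quotient_hol_ball p r0)
      have Eh: "E n \<in> hol_ball" for n unfolding E_def[abs_def] by (intro hol_ball_diff qh pmh)
      obtain c where c: "?Q (\<lambda>z. -1 * p z ^ m) = ennreal c" "c \<ge> 0"
        using besov_space_cmult[OF \<mu> N pm, of "-1"] by (cases "?Q (\<lambda>z. -1 * p z ^ m)") (auto simp: memb)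
      have EQ: "?Q (E n) \<le> ennreal (2 * max C 0 + 2 * c)" for n
      proof -
        have "?Q (E n) \<le> 2 * ?Q (dilated_quotient (Suc m) p (r n)) + 2 * ?Q (\<lambda>z. -1 * p z ^ m)"
          using besov_sqnorm_add_le[OF qh[of n] hol_ball_cmult[OF pmh, of "-1"], of N \<mu>] by (simp add: E_def[abs_def])
        also have "\<dots> \<le> 2 * ennreal (max C 0) + 2 * ennreal c"
        proof (intro add_mono mult_left_mono)
          show "?Q (dilated_quotient (Suc m) p (r n)) \<le> ennreal (max C 0)"
            by (rule order_trans[OF C[OF r]]) (simp add: ennreal_leI)
          show "?Q (\<lambda>z. -1 * p z ^ m) \<le> ennreal c" using c(1) by (rule eq_refl)
        qed auto
        also have "\<dots> = ennreal (2 * max C 0 + 2 * c)"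
          using c(2) by (subst ennreal_plus) (auto simp: ennreal_mult)
        finally show ?thesis .
      qed
      have Elim: "(\<lambda>n. coeff_energy (E n) k) \<longlonglongrightarrow> 0" for k
        unfolding E_def[abs_def] by (rule dilated_quotient_coeff_energy_tendsto[OF p r rlim])
      have "\<delta> / C2 > 0" using d C2(1) by simp
      from averages_tendsto_0_besov[OF Eh besov_weight_finite[OF \<mu>] EQ Elim this]
      obtain ns where ns: "ns \<noteq> []"
        "?Q (\<lambda>z. 1 / of_nat (length ns) * (\<Sum>n\<leftarrow>ns. E n z)) < ennreal (\<delta> / C2)" by blast
      define g' where "g' n z = inverse (p (r n *\<^sub>R z))" for n z
      have g'M: "g' n \<in> Mult ?H" for n
        unfolding g'_def[abs_def] using r[of n]
        by (intro smooth_multiplier_Mult smooth_multiplier_dilate[OF stable_inverse_hol_ball[OF p]] \<mu> N) auto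
      define h where "h z = 1 / of_nat (length ns) * (\<Sum>n\<leftarrow>ns. g' n z)" for z
      have hM: "h \<in> Mult ?H" unfolding h_def[abs_def] by (intro Mult_sum_list \<mu> N g'M)
      have avg: "1 / of_nat (length ns) * (\<Sum>n\<leftarrow>ns. E n z) = h z * p z ^ Suc m - p z ^ m" for z
      proof -
        have "(\<Sum>n\<leftarrow>ks. E n z) = (\<Sum>n\<leftarrow>ks. g' n z) * p z ^ Suc m - of_nat (length ks) * p z ^ m" for ks
          by (induction ks) (auto simp: E_def g'_def dilated_quotient_def algebra_simps)
        then show ?thesis using ns(1) by (simp add: h_def field_simps)
      qed
      define F where "F z = \<psi> z * (h z * p z ^ Suc m - p z ^ m)" for z
      have avh: "(\<lambda>z. h z * p z ^ Suc m - p z ^ m) \<in> hol_ball"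
        using MultH[OF hM] by (intro hol_ball_diff hol_ball_mult hol_ball_power ph) (auto simp: memb)
      have Fh: "F \<in> hol_ball" unfolding F_def[abs_def] by (intro hol_ball_mult \<psi>h avh)
      have QF: "?Q F < ennreal \<delta>"
      proof -
        have "?Q F \<le> ennreal C2 * ?Q (\<lambda>z. h z * p z ^ Suc m - p z ^ m)"
          unfolding F_def[abs_def] by (intro C2 avh)
        also have "\<dots> < ennreal \<delta>"
          using ns(2) by (intro ennreal_mult_lessI C2 d) (simp only: avg)
        finally show ?thesis .
      qed
      have Ah: "A \<in> hol_ball" using AH by (simp add: memb)
      have \<psi>M: "\<psi> \<in> Mult ?H" by (intro smooth_multiplier_Mult \<psi> \<mu> N)
      have \<psi>hM: "(\<lambda>z. \<psi> z * h z) \<in> Mult ?H" by (intro Mult_mult \<psi>M hM)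
      define G where "G z = (\<psi> z * h z) * p z ^ Suc m - g z" for z
      have pSH: "(\<lambda>z. p z ^ Suc m) \<in> ?H"
        by (intro MultH smooth_multiplier_Mult polynomials_power_smooth_multiplier pp \<mu> N)
      have GH: "G \<in> ?H"
        unfolding G_def[abs_def] using \<psi>hM pSH by (intro besov_space_diff \<mu> N gH) (auto simp: Mult_def)
      have "G = (\<lambda>z. F z + (D z + A z))"
        by (rule ext) (simp add: G_def F_def D_def A_def algebra_simps)
      then have "?Q G \<le> 2 * ?Q F + 2 * ?Q (\<lambda>z. D z + A z)"
        using besov_sqnorm_add_le[OF Fh hol_ball_add[OF Dh Ah], of N \<mu>] by simp
      also have "\<dots> \<le> 2 * ?Q F + 2 * (2 * ?Q D + 2 * ?Q A)"
        by (intro add_left_mono mult_left_mono besov_sqnorm_add_le Dh Ah) simp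
      also have "\<dots> < ennreal (\<epsilon>\<^sup>2)"
      proof -
        obtain x where x: "?Q F = ennreal x" "x \<ge> 0" "x < \<delta>" using QF by (cases "?Q F") (auto simp: ennreal_less_iff)
        obtain y where y: "?Q D = ennreal y" "y \<ge> 0" "y < \<delta>" using QD by (cases "?Q D") (auto simp: ennreal_less_iff)
        obtain v where v: "?Q A = ennreal v" "v \<ge> 0" "v < \<delta>" using QA by (cases "?Q A") (auto simp: ennreal_less_iff)
        have "2 * ?Q F + 2 * (2 * ?Q D + 2 * ?Q A) = ennreal (2 * x + 2 * (2 * y + 2 * v))"
          using x y v by (simp add: ennreal_mult)
        also have "\<dots> < ennreal (\<epsilon>\<^sup>2)"
          using x y v e by (intro ennreal_lessI) (auto simp: \<delta>_def)
        finally show ?thesis .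
      qed
      finally have "besov_norm N \<mu> G < \<epsilon>" using besov_norm_less_iff[OF \<mu> N GH e] by simp
      then show "\<exists>\<phi>\<in>Mult ?H. besov_norm N \<mu> (\<lambda>z. \<phi> z * p z ^ Suc m - g z) < \<epsilon>"
        using \<psi>hM unfolding G_def[abs_def] by (intro bexI[of _ "\<lambda>z. \<psi> z * h z"])
    qed
  qed
  have "p 0 \<noteq> 0" using nz[of 0] by simp
  then show ?thesis
    unfolding besov_class_def mult_class_def using pM sub1 sub2
    by (auto intro!: bexI[of _ 0])
qed

text \<open>
  The first claim uses the quotients with \<open>M = N + 1\<close>, the second those with \<open>M = N\<close>; in both
  cases the class obtained is \<open>M - 1\<close>.
\<close>

theorem theorem3p5:
  fixes N :: nat and \<mu> :: "real measure" and \<omega> :: "(complex ^ 'd::finite) measure"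
  assumes "N \<ge> 1"
    and "admissible \<mu>"
    and "\<omega> = radial_measure \<mu>"
  shows "(stable_polynomials :: (complex ^ 'd \<Rightarrow> complex) set) \<subseteq> besov_class N N \<mu> \<and>
    ((\<exists>u. bounded_weight u \<and> \<omega> = radial_measure (weight_measure u)) \<longrightarrow>
       (stable_polynomials :: (complex ^ 'd \<Rightarrow> complex) set) \<subseteq> besov_class (N - 1) N \<mu>)"
proof (intro conjI impI subsetI)
  have \<mu>: "unit_interval_measure \<mu>" "finite_measure \<mu>" using assms(2) by (auto simp: admissible_def)
  fix p :: "complex ^ 'd \<Rightarrow> complex" assume p: "p \<in> stable_polynomials"
  show "p \<in> besov_class N N \<mu>"
  proof -
    obtain C where "\<And>r. 1/2 \<le> r \<Longrightarrow> r < 1 \<Longrightarrow> besov_sqnorm N \<mu> (dilated_quotient (Suc N) p r) \<le> ennreal C"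
      using besov_sqnorm_dilated_quotient_le[OF p \<mu> assms(1), of "Suc N"] by auto
    then show ?thesis by (rule stable_polynomial_besov_class[OF p \<mu> assms(1)])
  qed
  assume "\<exists>u. bounded_weight u \<and> \<omega> = radial_measure (weight_measure u)"
  then obtain u where u: "bounded_weight u" "radial_measure \<mu> = (radial_measure (weight_measure u) :: (complex ^ 'd) measure)"
    using assms(3) by auto
  have eq: "\<mu> = weight_measure u"
    by (rule radial_measure_inj[OF \<mu>(1) sets_weight_measure u(2)])
  obtain C where "\<And>r. 1/2 \<le> r \<Longrightarrow> r < 1 \<Longrightarrow> besov_sqnorm N \<mu> (dilated_quotient N p r) \<le> ennreal C"
    using besov_sqnorm_dilated_quotient_le_weight[OF p _ assms(1) u(1)] \<mu>(2) unfolding eq by auto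
  then show "p \<in> besov_class (N - 1) N \<mu>"
    using stable_polynomial_besov_class[OF p \<mu> assms(1), of "N - 1" C] assms(1) by simp
qed

end
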